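(* Let $N$ be a quaternionic manifold of dimension $8$ and let $M$ be a QC-hypersurface of $N$. Then $M$ (i.e. its quaternionic-contact distribution $H$) is integrable.
   Context: **Quaternionic manifold.** A quaternionic manifold $(N,\mathcal{Q})$ is a manifold with a rank 3 subbundle $\mathcal{Q}\subset\mathrm{End}(TN)$ locally spanned by $(I_1,I_2,I_3)$ with $I_i^2=-1$, $I_1I_2=-I_2I_1=I_3$, admitting a torsion-free connection preserving $\mathcal{Q}$. **QC distribution.** A codimension 3 distribution $H$ on a manifold $M^{4n+3}$ is quaternionic contact (QC) if there is a metric $g$ on $H$ (called compatible) such that locally there exist 1-forms $\eta_1,\eta_2,\eta_3$ vanishing exactly on $H$ and a pointwise quaternionic structure $(I_1,I_2,I_3)$ on $H$ with $d\eta_i|_H=g(I_i\cdot,\cdot)$. **QC-hypersurface.** A real hypersurface $M$ of $(N,\mathcal{Q})$ is a QC-hypersurface if the maximal $\mathcal{Q}$-invariant subspace $H$ of $TM$ is QC and its induced pointwise quaternionic structure spans $\mathcal{Q}|_H$ (restrictions to $H$ of elements of $\mathcal{Q}$). **Integrability ($n=1$).** Let $g$ be a compatible metric on $H$, and let $\eta_1,\eta_2,\eta_3$ be local 1-forms vanishing exactly on $H$ and $(I_1,I_2,I_3)$ a local pointwise quaternionic structure on $H$ with $d\eta_i|_H=g(I_i\cdot,\cdot)$. For a complement $W$ of $H$ in $TM$ let $(R_1,R_2,R_3)$ be the basis of $W$ dual to $(\eta_i|_W)$ and $\alpha_{ij}=(\iota_{R_i}d\eta_j)|_H\in H^*$.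 Put $T^W=\sum_{i,j}(\alpha_{ij}+\alpha_{ji})\otimes I_i\otimes I_j$. There is a unique complement $W^g$ for which $T^{W^g}$ has the form $\sum_{i,j}a_{ij}\otimes I_i\otimes I_j$ with $a_{ij}=a_{ji}\in H^*$ and $\sum_j a_{ij}\circ I_j=0$ for every $i$. The tensor $T^{W^g}$ (vertical torsion) is conformally invariant, and the QC distribution $H$ on a $7$-manifold is called integrable if $T^{W^g}=0$. *)

theory Defs
  imports "HOL-Analysis.Analysis"
begin

section \<open>Smooth maps between open subsets of Euclidean spaces\<close>

primrec Ck_on :: "nat \<Rightarrow> 'a::euclidean_space set \<Rightarrow> ('a \<Rightarrow> 'b::real_normed_vector) \<Rightarrow> bool" where
  "Ck_on 0 S f \<longleftrightarrow> continuous_on S f"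
| "Ck_on (Suc k) S f \<longleftrightarrow> (\<forall>x\<in>S. f differentiable (at x)) \<and>
     (\<forall>v. Ck_on k S (\<lambda>x. frechet_derivative f (at x) v))"

definition smooth_on :: "'a::euclidean_space set \<Rightarrow> ('a \<Rightarrow> 'b::real_normed_vector) \<Rightarrow> bool" where
  "smooth_on S f \<longleftrightarrow> open S \<and> (\<forall>k. Ck_on k S f)"


section \<open>Smooth manifolds\<close>

text \<open>A chart is a pair of its domain and a coordinate map, whose values off the domain are
  irrelevant. The point set of a manifold is the topspace of its topology.\<close>

type_synonym ('a, 'e) chart = "'a set \<times> ('a \<Rightarrow> 'e)"

record ('a, 'e) smfd =
  mtop :: "'a topology"
  atlas :: "('a, 'e) chart set"

abbreviation points :: "('a, 'e) smfd \<Rightarrow> 'a set" where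
  "points M \<equiv> topspace (mtop M)"

abbreviation mopen :: "('a, 'e) smfd \<Rightarrow> 'a set \<Rightarrow> bool" where
  "mopen M V \<equiv> openin (mtop M) V"

definition cinv :: "('a, 'e) chart \<Rightarrow> 'e \<Rightarrow> 'a" where
  "cinv c = inv_into (fst c) (snd c)"

definition smooth_manifold :: "('a, 'e::euclidean_space) smfd \<Rightarrow> bool" where
  "smooth_manifold M \<longleftrightarrow>
     Hausdorff_space (mtop M) \<and> second_countable (mtop M) \<and>
     (\<forall>p\<in>points M. \<exists>c\<in>atlas M. p \<in> fst c) \<and>
     (\<forall>c\<in>atlas M. mopen M (fst c) \<and> open (snd c ` fst c) \<and>
        homeomorphic_map (subtopology (mtop M) (fst c)) (top_of_set (snd c ` fst c)) (snd c)) \<and>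
     (\<forall>c\<in>atlas M. \<forall>d\<in>atlas M. smooth_on (snd c ` (fst c \<inter> fst d)) (snd d \<circ> cinv c))"

text \<open>A preferred chart \<open>chart_at M p\<close> is fixed around every point, and the tangent space at
  \<open>p\<close> is the model space \<open>'e\<close>, a tangent vector being represented by its
  components in the preferred chart. So tangent fields, 1-forms and fields of endomorphisms are
  functions into \<open>'e\<close>, \<open>'e \<Rightarrow>\<^sub>L real\<close> and
  \<open>'e \<Rightarrow>\<^sub>L 'e\<close>; since the preferred chart jumps from point to point, smoothness and
  derivatives of such fields are always taken after a change to the components in one chart.\<close>

definition chart_at :: "('a, 'e) smfd \<Rightarrow> 'a \<Rightarrow> ('a, 'e) chart" where
  "chart_at M p = (SOME c. c \<in> atlas M \<and> p \<in> fst c)"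

text \<open>Turns components with respect to \<open>c\<close> of a vector at \<open>p\<close> into
  components with respect to \<open>d\<close>.\<close>

definition trans_deriv ::
  "('a, 'e::euclidean_space) chart \<Rightarrow> ('a, 'e) chart \<Rightarrow> 'a \<Rightarrow> 'e \<Rightarrow> 'e" where
  "trans_deriv c d p = frechet_derivative (snd d \<circ> cinv c) (at (snd c p))"

definition smooth_fun ::
  "('a, 'e::euclidean_space) smfd \<Rightarrow> 'a set \<Rightarrow> ('a \<Rightarrow> real) \<Rightarrow> bool" where
  "smooth_fun M V h \<longleftrightarrow> (\<forall>c\<in>atlas M. smooth_on (snd c ` (fst c \<inter> V)) (h \<circ> cinv c))"

definition fun_deriv ::
  "('a, 'e::euclidean_space) smfd \<Rightarrow> ('a \<Rightarrow> real) \<Rightarrow> 'a \<Rightarrow> 'e \<Rightarrow> real" where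
  "fun_deriv M h p = frechet_derivative (h \<circ> cinv (chart_at M p)) (at (snd (chart_at M p) p))"

definition vf_coord ::
  "('a, 'e::euclidean_space) smfd \<Rightarrow> ('a, 'e) chart \<Rightarrow> ('a \<Rightarrow> 'e) \<Rightarrow> 'e \<Rightarrow> 'e" where
  "vf_coord M c X x = trans_deriv (chart_at M (cinv c x)) c (cinv c x) (X (cinv c x))"

definition smooth_vf ::
  "('a, 'e::euclidean_space) smfd \<Rightarrow> 'a set \<Rightarrow> ('a \<Rightarrow> 'e) \<Rightarrow> bool" where
  "smooth_vf M V X \<longleftrightarrow> (\<forall>c\<in>atlas M. smooth_on (snd c ` (fst c \<inter> V)) (vf_coord M c X))"

definition lie_bracket ::
  "('a, 'e::euclidean_space) smfd \<Rightarrow> ('a \<Rightarrow> 'e) \<Rightarrow> ('a \<Rightarrow> 'e) \<Rightarrow> 'a \<Rightarrow> 'e" where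
  "lie_bracket M X Y p = (let c = chart_at M p; x = snd c p in
     frechet_derivative (vf_coord M c Y) (at x) (X p) -
     frechet_derivative (vf_coord M c X) (at x) (Y p))"

definition smooth_form ::
  "('a, 'e::euclidean_space) smfd \<Rightarrow> 'a set \<Rightarrow> ('a \<Rightarrow> 'e \<Rightarrow>\<^sub>L real) \<Rightarrow> bool" where
  "smooth_form M V \<eta> \<longleftrightarrow> (\<forall>V' X. mopen M V' \<and> V' \<subseteq> V \<and> smooth_vf M V' X \<longrightarrow>
     smooth_fun M V' (\<lambda>p. blinfun_apply (\<eta> p) (X p)))"

definition form_coord ::
  "('a, 'e::euclidean_space) smfd \<Rightarrow> ('a, 'e) chart \<Rightarrow> ('a \<Rightarrow> 'e \<Rightarrow>\<^sub>L real) \<Rightarrow> 'e \<Rightarrow> 'e \<Rightarrow> real" where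
  "form_coord M c \<eta> x v =
     blinfun_apply (\<eta> (cinv c x)) (trans_deriv c (chart_at M (cinv c x)) (cinv c x) v)"

text \<open>Convention: \<open>d\<eta>(X,Y) = X(\<eta>(Y)) - Y(\<eta>(X)) - \<eta>([X,Y])\<close>, without a factor 1/2.\<close>

definition ext_deriv ::
  "('a, 'e::euclidean_space) smfd \<Rightarrow> ('a \<Rightarrow> 'e \<Rightarrow>\<^sub>L real) \<Rightarrow> 'a \<Rightarrow> 'e \<Rightarrow> 'e \<Rightarrow> real" where
  "ext_deriv M \<eta> p u v = (let c = chart_at M p; x = snd c p in
     frechet_derivative (\<lambda>y. form_coord M c \<eta> y v) (at x) u -
     frechet_derivative (\<lambda>y. form_coord M c \<eta> y u) (at x) v)"

definition smooth_endo ::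
  "('a, 'e::euclidean_space) smfd \<Rightarrow> 'a set \<Rightarrow> ('a \<Rightarrow> 'e \<Rightarrow>\<^sub>L 'e) \<Rightarrow> bool" where
  "smooth_endo M V J \<longleftrightarrow> (\<forall>V' X. mopen M V' \<and> V' \<subseteq> V \<and> smooth_vf M V' X \<longrightarrow>
     smooth_vf M V' (\<lambda>p. blinfun_apply (J p) (X p)))"

definition tangent_map ::
  "('b, 'f::euclidean_space) smfd \<Rightarrow> ('a, 'e::euclidean_space) smfd \<Rightarrow> ('b \<Rightarrow> 'a) \<Rightarrow> 'b \<Rightarrow> 'f \<Rightarrow> 'e" where
  "tangent_map M N f p = frechet_derivative (snd (chart_at N (f p)) \<circ> f \<circ> cinv (chart_at M p))
     (at (snd (chart_at M p) p))"

definition immersion ::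
  "('b, 'f::euclidean_space) smfd \<Rightarrow> ('a, 'e::euclidean_space) smfd \<Rightarrow> ('b \<Rightarrow> 'a) \<Rightarrow> bool" where
  "immersion M N f \<longleftrightarrow> continuous_map (mtop M) (mtop N) f \<and>
     (\<forall>c\<in>atlas M. \<forall>d\<in>atlas N.
        smooth_on (snd c ` {p \<in> fst c. f p \<in> fst d}) (snd d \<circ> f \<circ> cinv c)) \<and>
     (\<forall>p\<in>points M. inj (tangent_map M N f p))"


section \<open>Torsion-free connections\<close>

text \<open>A connection is a Koszul operator on local vector fields: \<open>nabla p v Y\<close> is
  \<open>\<nabla>\<^sub>v Y\<close> for \<open>v\<close> tangent at \<open>p\<close> and a field
  \<open>Y\<close> that is smooth near \<open>p\<close>. Since the function in the Leibniz rule need only be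
  smooth near \<open>p\<close>, the rule with a function equal to 1 near \<open>p\<close> makes
  \<open>nabla p v Y\<close> depend only on \<open>Y\<close> near \<open>p\<close>.\<close>

definition affine_connection ::
  "('a, 'e::euclidean_space) smfd \<Rightarrow> ('a \<Rightarrow> 'e \<Rightarrow> ('a \<Rightarrow> 'e) \<Rightarrow> 'e) \<Rightarrow> bool" where
  "affine_connection N nabla \<longleftrightarrow>
     (\<forall>V p Y Z h. mopen N V \<and> p \<in> V \<and> smooth_vf N V Y \<and> smooth_vf N V Z \<and> smooth_fun N V h \<longrightarrow>
        linear (\<lambda>v. nabla p v Y) \<and>
        (\<forall>v. nabla p v (\<lambda>q. Y q + Z q) = nabla p v Y + nabla p v Z) \<and>
        (\<forall>v. nabla p v (\<lambda>q. h q *\<^sub>R Y q) = fun_deriv N h p v *\<^sub>R Y p + h p *\<^sub>R nabla p v Y)) \<and>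
     (\<forall>V X Y. mopen N V \<and> smooth_vf N V X \<and> smooth_vf N V Y \<longrightarrow>
        smooth_vf N V (\<lambda>p. nabla p (X p) Y))"

definition torsion_free ::
  "('a, 'e::euclidean_space) smfd \<Rightarrow> ('a \<Rightarrow> 'e \<Rightarrow> ('a \<Rightarrow> 'e) \<Rightarrow> 'e) \<Rightarrow> bool" where
  "torsion_free N nabla \<longleftrightarrow>
     (\<forall>V p X Y. mopen N V \<and> p \<in> V \<and> smooth_vf N V X \<and> smooth_vf N V Y \<longrightarrow>
        nabla p (X p) Y - nabla p (Y p) X = lie_bracket N X Y p)"

text \<open>\<open>Q\<close> is preserved: for a local section \<open>J\<close> of \<open>Q\<close>, the endomorphism
  \<open>\<nabla>\<^sub>v J = \<nabla>\<^sub>v \<circ> J - J \<circ> \<nabla>\<^sub>v\<close> is in \<open>Q\<close>.\<close>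

definition preserves_subbundle ::
  "('a, 'e::euclidean_space) smfd \<Rightarrow> ('a \<Rightarrow> ('e \<Rightarrow>\<^sub>L 'e) set) \<Rightarrow> ('a \<Rightarrow> 'e \<Rightarrow> ('a \<Rightarrow> 'e) \<Rightarrow> 'e) \<Rightarrow> bool" where
  "preserves_subbundle N Q nabla \<longleftrightarrow>
     (\<forall>V J p v. mopen N V \<and> smooth_endo N V J \<and> (\<forall>q\<in>V. J q \<in> Q q) \<and> p \<in> V \<longrightarrow>
        (\<exists>K\<in>Q p. \<forall>Y. smooth_vf N V Y \<longrightarrow>
           nabla p v (\<lambda>q. blinfun_apply (J q) (Y q)) - blinfun_apply (J p) (nabla p v Y)
             = blinfun_apply K (Y p)))"


section \<open>Quaternionic manifolds\<close>

text \<open>Triples are indexed by the three-element type 3, whose elements are 1, 2 and 3. The maps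
  \<open>I i\<close> are only considered on the subspace \<open>S\<close>.\<close>

definition quaternionic_structure :: "'t::real_vector set \<Rightarrow> (3 \<Rightarrow> 't \<Rightarrow> 't) \<Rightarrow> bool" where
  "quaternionic_structure S I \<longleftrightarrow>
     (\<forall>i. \<forall>u\<in>S. \<forall>v\<in>S. \<forall>a b. I i (a *\<^sub>R u + b *\<^sub>R v) = a *\<^sub>R I i u + b *\<^sub>R I i v) \<and>
     (\<forall>i. \<forall>v\<in>S. I i v \<in> S \<and> I i (I i v) = - v) \<and>
     (\<forall>v\<in>S. I 1 (I 2 v) = I 3 v \<and> I 2 (I 1 v) = - I 3 v)"

definition quaternionic_manifold ::
  "('a, 'e::euclidean_space) smfd \<Rightarrow> ('a \<Rightarrow> ('e \<Rightarrow>\<^sub>L 'e) set) \<Rightarrow> bool" where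
  "quaternionic_manifold N Q \<longleftrightarrow> smooth_manifold N \<and>
     (\<forall>p\<in>points N. \<exists>V I. mopen N V \<and> p \<in> V \<and> (\<forall>i. smooth_endo N V (I i)) \<and>
        (\<forall>q\<in>V. quaternionic_structure UNIV (\<lambda>i::3. blinfun_apply (I i q)) \<and>
                Q q = span (range (\<lambda>i. I i q)))) \<and>
     (\<exists>nabla. affine_connection N nabla \<and> torsion_free N nabla \<and> preserves_subbundle N Q nabla)"


section \<open>Quaternionic contact distributions\<close>

text \<open>A distribution assigns to each point a subspace of the tangent space. Its smoothness is not
  required separately below, since a QC distribution is locally the common kernel of smooth
  1-forms.\<close>

definition metric_on_dist ::
  "('b, 'f::euclidean_space) smfd \<Rightarrow> ('b \<Rightarrow> 'f set) \<Rightarrow> ('b \<Rightarrow> 'f \<Rightarrow> 'f \<Rightarrow> real) \<Rightarrow> bool" where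
  "metric_on_dist M H g \<longleftrightarrow>
     (\<forall>p\<in>points M. (\<forall>u\<in>H p. \<forall>v\<in>H p. g p u v = g p v u) \<and>
        (\<forall>u\<in>H p. \<forall>v\<in>H p. \<forall>w\<in>H p. \<forall>a b.
            g p (a *\<^sub>R u + b *\<^sub>R v) w = a * g p u w + b * g p v w) \<and>
        (\<forall>u\<in>H p. u \<noteq> 0 \<longrightarrow> g p u u > 0)) \<and>
     (\<forall>V X Y. mopen M V \<and> smooth_vf M V X \<and> smooth_vf M V Y \<and> (\<forall>p\<in>V. X p \<in> H p \<and> Y p \<in> H p) \<longrightarrow>
        smooth_fun M V (\<lambda>p. g p (X p) (Y p)))"

definition qc_frame ::
  "('b, 'f::euclidean_space) smfd \<Rightarrow> ('b \<Rightarrow> 'f set) \<Rightarrow> ('b \<Rightarrow> 'f \<Rightarrow> 'f \<Rightarrow> real) \<Rightarrow> 'b set \<Rightarrow>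
    (3 \<Rightarrow> 'b \<Rightarrow> 'f \<Rightarrow>\<^sub>L real) \<Rightarrow> (3 \<Rightarrow> 'b \<Rightarrow> 'f \<Rightarrow> 'f) \<Rightarrow> bool" where
  "qc_frame M H g V \<eta> I \<longleftrightarrow> mopen M V \<and> (\<forall>i. smooth_form M V (\<eta> i)) \<and>
     (\<forall>p\<in>V. H p = {v. \<forall>i. blinfun_apply (\<eta> i p) v = 0} \<and>
        quaternionic_structure (H p) (\<lambda>i. I i p) \<and>
        (\<forall>i. \<forall>u\<in>H p. \<forall>v\<in>H p. ext_deriv M (\<eta> i) p u v = g p (I i p u) v))"

definition qc_compatible ::
  "('b, 'f::euclidean_space) smfd \<Rightarrow> ('b \<Rightarrow> 'f set) \<Rightarrow> ('b \<Rightarrow> 'f \<Rightarrow> 'f \<Rightarrow> real) \<Rightarrow> bool" where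
  "qc_compatible M H g \<longleftrightarrow> metric_on_dist M H g \<and>
     (\<forall>p\<in>points M. \<exists>V \<eta> I. p \<in> V \<and> qc_frame M H g V \<eta> I)"

definition qc_distribution ::
  "('b, 'f::euclidean_space) smfd \<Rightarrow> ('b \<Rightarrow> 'f set) \<Rightarrow> bool" where
  "qc_distribution M H \<longleftrightarrow> smooth_manifold M \<and> (\<exists>n. DIM('f) = 4 * n + 3) \<and>
     (\<forall>p\<in>points M. subspace (H p) \<and> dim (H p) + 3 = DIM('f)) \<and>
     (\<exists>g. qc_compatible M H g)"


section \<open>QC-hypersurfaces\<close>

definition max_invariant_subspace ::
  "('e::euclidean_space \<Rightarrow>\<^sub>L 'e) set \<Rightarrow> 'e set \<Rightarrow> 'e set" where
  "max_invariant_subspace A S =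
     span (\<Union>{U. subspace U \<and> U \<subseteq> S \<and> (\<forall>J\<in>A. blinfun_apply J ` U \<subseteq> U)})"

text \<open>A hypersurface is given by an immersion \<open>f\<close> of codimension 1; an embedded hypersurface
  \<open>M\<close> is the case where \<open>f\<close> is the inclusion. The tangent space of \<open>M\<close>
  inside that of \<open>N\<close> is the range of \<open>tangent_map M N f p\<close>.\<close>

definition hypersurface_dist ::
  "('a, 'e::euclidean_space) smfd \<Rightarrow> ('a \<Rightarrow> ('e \<Rightarrow>\<^sub>L 'e) set) \<Rightarrow>
    ('b, 'f::euclidean_space) smfd \<Rightarrow> ('b \<Rightarrow> 'a) \<Rightarrow> 'b \<Rightarrow> 'f set" where
  "hypersurface_dist N Q M f p =
     tangent_map M N f p -` max_invariant_subspace (Q (f p)) (range (tangent_map M N f p))"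

text \<open>The last conjunct says that the span of the \<open>I i\<close> and \<open>Q\<close> have the same
  restrictions to \<open>H\<close>. The span of the \<open>I i\<close> does not depend on the choice of
  \<open>g\<close>, \<open>\<eta>\<close>, \<open>I\<close>.\<close>

definition qc_hypersurface ::
  "('a, 'e::euclidean_space) smfd \<Rightarrow> ('a \<Rightarrow> ('e \<Rightarrow>\<^sub>L 'e) set) \<Rightarrow>
    ('b, 'f::euclidean_space) smfd \<Rightarrow> ('b \<Rightarrow> 'a) \<Rightarrow> bool" where
  "qc_hypersurface N Q M f \<longleftrightarrow>
     smooth_manifold M \<and> DIM('e) = DIM('f) + 1 \<and> immersion M N f \<and>
     (let H = hypersurface_dist N Q M f in
        qc_distribution M H \<and>
        (\<exists>g. qc_compatible M H g \<and>
          (\<forall>p\<in>points M. \<exists>V \<eta> I. p \<in> V \<and> qc_frame M H g V \<eta> I \<and>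
            (\<forall>K\<in>Q (f p). \<exists>a. \<forall>v\<in>H p.
               blinfun_apply K (tangent_map M N f p v) = tangent_map M N f p (\<Sum>i\<in>UNIV. a i *\<^sub>R I i p v)) \<and>
            (\<forall>a. \<exists>K\<in>Q (f p). \<forall>v\<in>H p.
               blinfun_apply K (tangent_map M N f p v) = tangent_map M N f p (\<Sum>i\<in>UNIV. a i *\<^sub>R I i p v)))))"


section \<open>Vertical torsion and integrability\<close>

definition complement_of :: "'t::real_vector set \<Rightarrow> 't set \<Rightarrow> bool" where
  "complement_of S W \<longleftrightarrow> subspace W \<and> S \<inter> W = {0} \<and> (\<forall>v. \<exists>s\<in>S. \<exists>w\<in>W. v = s + w)"

definition dual_basis ::
  "(3 \<Rightarrow> 'b \<Rightarrow> 'f::euclidean_space \<Rightarrow>\<^sub>L real) \<Rightarrow> 'b \<Rightarrow> 'f set \<Rightarrow> 3 \<Rightarrow> 'f" where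
  "dual_basis \<eta> p W =
     (THE R. \<forall>i. R i \<in> W \<and> (\<forall>j. blinfun_apply (\<eta> j p) (R i) = (if i = j then 1 else 0)))"

definition qc_alpha ::
  "('b, 'f::euclidean_space) smfd \<Rightarrow> (3 \<Rightarrow> 'b \<Rightarrow> 'f \<Rightarrow>\<^sub>L real) \<Rightarrow> 'b \<Rightarrow> 'f set \<Rightarrow> 3 \<Rightarrow> 3 \<Rightarrow> 'f \<Rightarrow> real" where
  "qc_alpha M \<eta> p W i j X = ext_deriv M (\<eta> j) p (dual_basis \<eta> p W i) X"

text \<open>An element of \<open>H\<^sup>* \<otimes> End(H) \<otimes> End(H)\<close> is represented as a multilinear function of
  three vectors of \<open>H\<close> and two covectors: \<open>a \<otimes> A \<otimes> B\<close> sends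
  \<open>X, Y, Z, l, m\<close> to \<open>a(X) l(A Y) m(B Z)\<close>. The function below is
  \<open>\<Sum>\<^sub>i\<^sub>j a\<^sub>i\<^sub>j \<otimes> I\<^sub>i \<otimes> I\<^sub>j\<close>. Covectors of \<open>H\<close> are given by covectors of the
  ambient tangent space.\<close>

type_synonym 't torsion_tensor = "'t \<Rightarrow> 't \<Rightarrow> 't \<Rightarrow> ('t \<Rightarrow>\<^sub>L real) \<Rightarrow> ('t \<Rightarrow>\<^sub>L real) \<Rightarrow> real"

definition sum_tensor ::
  "(3 \<Rightarrow> 't::real_normed_vector \<Rightarrow> 't) \<Rightarrow> (3 \<Rightarrow> 3 \<Rightarrow> 't \<Rightarrow> real) \<Rightarrow> 't torsion_tensor" where
  "sum_tensor I a X Y Z l m =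
     (\<Sum>i\<in>UNIV. \<Sum>j\<in>UNIV. a i j X * blinfun_apply l (I i Y) * blinfun_apply m (I j Z))"

definition tensor_eq_on ::
  "'t::real_normed_vector set \<Rightarrow> 't torsion_tensor \<Rightarrow> 't torsion_tensor \<Rightarrow> bool" where
  "tensor_eq_on S T T' \<longleftrightarrow> (\<forall>X\<in>S. \<forall>Y\<in>S. \<forall>Z\<in>S. \<forall>l m. T X Y Z l m = T' X Y Z l m)"

definition torsion_tensor ::
  "('b, 'f::euclidean_space) smfd \<Rightarrow> (3 \<Rightarrow> 'b \<Rightarrow> 'f \<Rightarrow>\<^sub>L real) \<Rightarrow> (3 \<Rightarrow> 'b \<Rightarrow> 'f \<Rightarrow> 'f) \<Rightarrow> 'b \<Rightarrow>
    'f set \<Rightarrow> 'f torsion_tensor" where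
  "torsion_tensor M \<eta> I p W =
     sum_tensor (\<lambda>i. I i p) (\<lambda>i j X. qc_alpha M \<eta> p W i j X + qc_alpha M \<eta> p W j i X)"

definition reduced_tensor ::
  "'t::real_normed_vector set \<Rightarrow> (3 \<Rightarrow> 't \<Rightarrow> 't) \<Rightarrow> 't torsion_tensor \<Rightarrow> bool" where
  "reduced_tensor S I T \<longleftrightarrow> (\<exists>a :: 3 \<Rightarrow> 3 \<Rightarrow> 't \<Rightarrow>\<^sub>L real.
     (\<forall>i j. \<forall>X\<in>S. blinfun_apply (a i j) X = blinfun_apply (a j i) X) \<and>
     (\<forall>i. \<forall>X\<in>S. (\<Sum>j\<in>UNIV. blinfun_apply (a i j) (I j X)) = 0) \<and>
     tensor_eq_on S T (sum_tensor I (\<lambda>i j. blinfun_apply (a i j))))"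

text \<open>The complement \<open>W\<^sup>g\<close> at the point \<open>p\<close>. The torsion tensor at \<open>p\<close> depends on
  a complementary subbundle only through its fibre at \<open>p\<close>; the metric \<open>g\<close> enters
  through the frame \<open>(\<eta>, I)\<close> adapted to it. The description is meaningful for
  \<open>n = 1\<close>, where such a complement exists and is unique.\<close>

definition torsion_complement ::
  "('b, 'f::euclidean_space) smfd \<Rightarrow> ('b \<Rightarrow> 'f set) \<Rightarrow> (3 \<Rightarrow> 'b \<Rightarrow> 'f \<Rightarrow>\<^sub>L real) \<Rightarrow>
    (3 \<Rightarrow> 'b \<Rightarrow> 'f \<Rightarrow> 'f) \<Rightarrow> 'b \<Rightarrow> 'f set" where
  "torsion_complement M H \<eta> I p =
     (THE W. complement_of (H p) W \<and>
        reduced_tensor (H p) (\<lambda>i. I i p) (torsion_tensor M \<eta> I p W))"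

definition vertical_torsion ::
  "('b, 'f::euclidean_space) smfd \<Rightarrow> ('b \<Rightarrow> 'f set) \<Rightarrow> (3 \<Rightarrow> 'b \<Rightarrow> 'f \<Rightarrow>\<^sub>L real) \<Rightarrow>
    (3 \<Rightarrow> 'b \<Rightarrow> 'f \<Rightarrow> 'f) \<Rightarrow> 'b \<Rightarrow> 'f torsion_tensor" where
  "vertical_torsion M H \<eta> I p = torsion_tensor M \<eta> I p (torsion_complement M H \<eta> I p)"

text \<open>By conformal invariance it does not matter whether all compatible metrics or one of them
  are considered; all are.\<close>

definition qc_integrable ::
  "('b, real ^ 7) smfd \<Rightarrow> ('b \<Rightarrow> (real ^ 7) set) \<Rightarrow> bool" where
  "qc_integrable M H \<longleftrightarrow> qc_distribution M H \<and>
     (\<forall>g V \<eta> I. qc_compatible M H g \<and> qc_frame M H g V \<eta> I \<longrightarrow>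
        (\<forall>p\<in>V. tensor_eq_on (H p) (vertical_torsion M H \<eta> I p) (\<lambda>X Y Z l m. 0)))"

end

theory Submission
  imports Defs
begin

text \<open>Let \<open>\<theta>\<close> be a conormal of the hypersurface and \<open>J\<^sub>i\<close> a local quaternionic frame of \<open>Q\<close>. Then
  \<open>H\<close> is the common kernel of the forms \<open>\<theta> \<circ> J\<^sub>i\<close> on the hypersurface, and a torsion-free connection
  preserving \<open>Q\<close> gives \<open>d(\<theta> \<circ> J\<^sub>j)(u,v) = (\<nabla>\<^sub>u\<theta>)(J\<^sub>j v) - (\<nabla>\<^sub>v\<theta>)(J\<^sub>j u)\<close> up to terms that involve the
  skew connection matrix of \<open>Q\<close>. On \<open>H\<close> the right-hand side is \<open>h(J\<^sub>j u, v) - h(u, J\<^sub>j v)\<close> for the second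
  fundamental form \<open>h\<close>. Comparing this with the quaternionic contact condition shows first that any adapted frame
  \<open>(\<eta>, I)\<close> can be written as \<open>\<eta>\<^sub>i = \<theta> \<circ> J\<^sub>i\<close>, with \<open>J\<^sub>i\<close> extending \<open>I\<^sub>i\<close>, after rescaling \<open>\<theta>\<close> and rotating
  the \<open>J\<^sub>i\<close>, and then that \<open>h = g / 2\<close> on \<open>H\<close>. Since \<open>h\<close> is nondegenerate on \<open>H\<close>, the fields \<open>- J\<^sub>i \<nu>\<close>, where
  \<open>\<nu>\<close> is a suitable normal, can be corrected inside \<open>H\<close> so that the symmetrised forms
  \<open>\<alpha>\<^sub>i\<^sub>j + \<alpha>\<^sub>j\<^sub>i\<close> vanish identically on \<open>H\<close>; by uniqueness, the complement they span is the one defining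
  the vertical torsion.\<close>

subsection \<open>Smooth maps\<close>

text \<open>The hypothesis that the induced structure spans \<open>Q\<close> on \<open>H\<close>
  concerns one compatible metric and one frame near each point, whereas integrability speaks of
  every compatible metric and every adapted frame. An arbitrary frame is therefore compared with
  that metric and with the frame of \<open>Q\<close> at the same time; linear algebra on
  \<open>H\<close> at a single point then leaves only a scalar and a rotation. A pointwise scalar is
  not enough: the rescaled conormal and the rotated frame are differentiated. So the comparison is
  made at all points near the given one, always with the conormal that belongs to the given one, and
  the scalar is recovered as a quotient of differentiable coefficients. Scalar, rotation and
  conormal are differentiated only at the coordinate point \<open>x0\<close>; the identities between
  them hold eventually near it. That the coefficients form a rotation matters once more: the
  relations of the rotated frame survive, its connection matrix is skew, and the connection terms
  cancel in the symmetrised forms.\<close>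

lemma Ck_on_cong:
  assumes "open S" "Ck_on k S f" "\<And>x. x \<in> S \<Longrightarrow> f x = g x"
  shows "Ck_on k S g"
  using assms(2,3)
proof (induction k arbitrary: f g)
  case 0
  then show ?case using continuous_on_eq by fastforce
next
  case (Suc k)
  have fg: "g differentiable (at x)" "frechet_derivative g (at x) = frechet_derivative f (at x)" if "x \<in> S" for x
  proof -
    have "f differentiable (at x)" using Suc.prems that by simp
    then have "(g has_derivative frechet_derivative f (at x)) (at x)"
      using has_derivative_transform_within_open[of f "frechet_derivative f (at x)" x UNIV S g]
        assms(1) that Suc.prems(2) by (simp add: frechet_derivative_works)
    then show "g differentiable (at x)" "frechet_derivative g (at x) = frechet_derivative f (at x)"
      by (auto simp: differentiable_def dest: frechet_derivative_at[symmetric])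
  qed
  have "Ck_on k S (\<lambda>x. frechet_derivative g (at x) v)" for v
    by (rule Suc.IH[of "\<lambda>x. frechet_derivative f (at x) v"]) (use Suc.prems fg in auto)
  then show ?case using fg by simp
qed

lemma Ck_on_subset: "Ck_on k S f \<Longrightarrow> T \<subseteq> S \<Longrightarrow> Ck_on k T f"
  by (induction k arbitrary: f) (auto intro: continuous_on_subset)

lemma Ck_on_SucD: "Ck_on (Suc k) S f \<Longrightarrow> Ck_on k S f"
proof (induction k arbitrary: f)
  case 0
  then show ?case
    by (meson Ck_on.simps continuous_at_imp_continuous_on differentiable_imp_continuous_within)
next
  case (Suc k)
  then show ?case by (meson Ck_on.simps(2))
qed

lemma Ck_on_const: "Ck_on k S (\<lambda>x. c)"
  by (induction k arbitrary: c) auto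

lemma Ck_on_SucI:
  assumes "open S" "\<And>x. x \<in> S \<Longrightarrow> (f has_derivative f' x) (at x)"
    "\<And>v. Ck_on k S (\<lambda>x. f' x v)"
  shows "Ck_on (Suc k) S f"
proof -
  have "Ck_on k S (\<lambda>x. frechet_derivative f (at x) v)" for v
    by (rule Ck_on_cong[OF assms(1) assms(3)[of v]]) (simp add: frechet_derivative_at[OF assms(2), symmetric])
  then show ?thesis using assms(2) by (auto simp: differentiable_def)
qed

lemma Ck_on_add:
  assumes "open S" "Ck_on k S f" "Ck_on k S g"
  shows "Ck_on k S (\<lambda>x. f x + g x)"
  using assms(2,3)
proof (induction k arbitrary: f g)
  case 0
  then show ?case by (auto intro: continuous_intros)
next
  case (Suc k)
  show ?case
    by (rule Ck_on_SucI[OF assms(1),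
          where f' = "\<lambda>x v. frechet_derivative f (at x) v + frechet_derivative g (at x) v"])
       (use Suc in \<open>auto intro!: has_derivative_add simp: frechet_derivative_works\<close>)
qed

lemma Ck_on_sum:
  assumes "open S" "\<And>i. i \<in> A \<Longrightarrow> Ck_on k S (f i)"
  shows "Ck_on k S (\<lambda>x. \<Sum>i\<in>A. f i x)"
  using assms(2)
  by (induction A rule: infinite_finite_induct) (auto intro: Ck_on_const Ck_on_add[OF assms(1)])

lemma Ck_on_linear:
  assumes "open S" "bounded_linear L" "Ck_on k S f"
  shows "Ck_on k S (\<lambda>x. L (f x))"
  using assms(3)
proof (induction k arbitrary: f)
  case 0
  then show ?case using bounded_linear.continuous_on[OF assms(2)] by simp
next
  case (Suc k)
  show ?case
    by (rule Ck_on_SucI[OF assms(1), where f' = "\<lambda>x v. L (frechet_derivative f (at x) v)"])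
       (use Suc in \<open>auto intro!: bounded_linear.has_derivative[OF assms(2)] simp: frechet_derivative_works\<close>)
qed

lemma Ck_on_scaleR:
  assumes "open S" "Ck_on k S f" "Ck_on k S g"
  shows "Ck_on k S (\<lambda>x. f x *\<^sub>R g x)"
  using assms(2,3)
proof (induction k arbitrary: f g)
  case 0
  then show ?case by (auto intro: continuous_intros)
next
  case (Suc k)
  have "Ck_on k S f" "Ck_on k S g" using Suc.prems Ck_on_SucD by blast+
  then have "Ck_on k S (\<lambda>x. f x *\<^sub>R frechet_derivative g (at x) v + frechet_derivative f (at x) v *\<^sub>R g x)" for v
    using Suc by (intro Ck_on_add[OF assms(1)]) auto
  then show ?case
    by (intro Ck_on_SucI[OF assms(1),
          where f' = "\<lambda>x v. f x *\<^sub>R frechet_derivative g (at x) v + frechet_derivative f (at x) v *\<^sub>R g x"])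
       (use Suc.prems in \<open>auto intro!: has_derivative_scaleR simp: frechet_derivative_works\<close>)
qed

lemma linear_basis_expansion:
  fixes L :: "'a::euclidean_space \<Rightarrow> 'b::real_vector"
  assumes "linear L"
  shows "L v = (\<Sum>b\<in>Basis. (v \<bullet> b) *\<^sub>R L b)"
proof -
  have "L v = L (\<Sum>b\<in>Basis. (v \<bullet> b) *\<^sub>R b)" by (simp add: euclidean_representation)
  also have "\<dots> = (\<Sum>b\<in>Basis. (v \<bullet> b) *\<^sub>R L b)"
    by (simp add: linear_sum[OF assms] linear_cmul[OF assms])
  finally show ?thesis .
qed

text \<open>\<open>Ck_on\<close> controls derivatives in fixed directions, whereas the chain rule
  evaluates the derivative of \<open>g\<close> in the moving direction \<open>?f' x v\<close>.
  Expanding that direction over \<open>Basis\<close> leaves fixed directions with scalar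
  coefficients. Only \<open>g\<close> varies in the induction, since its derivatives are composed
  with the same \<open>f\<close>.\<close>

lemma Ck_on_compose:
  fixes f :: "'a::euclidean_space \<Rightarrow> 'b::euclidean_space"
  assumes "open S" "open T" "Ck_on k S f" "Ck_on k T g" "f ` S \<subseteq> T"
  shows "Ck_on k S (\<lambda>x. g (f x))"
  using assms(3,4)
proof (induction k arbitrary: g)
  case 0
  then show ?case using continuous_on_compose2 assms(5) by (metis Ck_on.simps(1))
next
  case (Suc k)
  let ?f' = "\<lambda>x. frechet_derivative f (at x)" and ?g' = "\<lambda>y. frechet_derivative g (at y)"
  have f1: "(f has_derivative ?f' x) (at x)" if "x \<in> S" for x
    using Suc.prems that by (simp add: frechet_derivative_works)
  have g1: "(g has_derivative ?g' y) (at y)" if "y \<in> T" for y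
    using Suc.prems that by (simp add: frechet_derivative_works)
  have "Ck_on k S (\<lambda>x. \<Sum>b\<in>Basis. (?f' x v \<bullet> b) *\<^sub>R ?g' (f x) b)" for v
  proof (intro Ck_on_sum[OF assms(1)] Ck_on_scaleR[OF assms(1)])
    fix b :: 'b
    show "Ck_on k S (\<lambda>x. ?f' x v \<bullet> b)"
      using Suc.prems by (intro Ck_on_linear[OF assms(1) bounded_linear_inner_left]) auto
    show "Ck_on k S (\<lambda>x. ?g' (f x) b)"
      by (rule Suc.IH) (use Suc.prems Ck_on_SucD in auto)
  qed
  moreover have "(\<Sum>b\<in>Basis. (?f' x v \<bullet> b) *\<^sub>R ?g' (f x) b) = ?g' (f x) (?f' x v)" if "x \<in> S" for x v
  proof -
    have "linear (?g' (f x))" using g1[of "f x"] assms(5) that has_derivative_linear by blast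
    from linear_basis_expansion[OF this] show ?thesis by metis
  qed
  ultimately have "Ck_on k S (\<lambda>x. ?g' (f x) (?f' x v))" for v
    by (rule Ck_on_cong[OF assms(1)])
  moreover have "((\<lambda>x. g (f x)) has_derivative (\<lambda>v. ?g' (f x) (?f' x v))) (at x)" if "x \<in> S" for x
    using has_derivative_compose[OF f1[OF that] g1[of "f x"]] assms(5) that by auto
  ultimately show ?case
    by (intro Ck_on_SucI[OF assms(1), where f' = "\<lambda>x v. ?g' (f x) (?f' x v)"])
qed

lemma smooth_on_open: "smooth_on S f \<Longrightarrow> open S"
  by (simp add: smooth_on_def)

lemma smooth_on_cong:
  "smooth_on S f \<Longrightarrow> (\<And>x. x \<in> S \<Longrightarrow> f x = g x) \<Longrightarrow> smooth_on S g"
  unfolding smooth_on_def using Ck_on_cong by blast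

lemma smooth_on_subset: "smooth_on S f \<Longrightarrow> open T \<Longrightarrow> T \<subseteq> S \<Longrightarrow> smooth_on T f"
  unfolding smooth_on_def using Ck_on_subset by blast

lemma smooth_on_const: "open S \<Longrightarrow> smooth_on S (\<lambda>x. c)"
  by (simp add: smooth_on_def Ck_on_const)

lemma smooth_on_linear: "bounded_linear L \<Longrightarrow> smooth_on S f \<Longrightarrow> smooth_on S (\<lambda>x. L (f x))"
  by (simp add: smooth_on_def Ck_on_linear)

lemma smooth_on_scaleR:
  "smooth_on S f \<Longrightarrow> smooth_on S g \<Longrightarrow> smooth_on S (\<lambda>x. f x *\<^sub>R g x)"
  by (simp add: smooth_on_def Ck_on_scaleR)

lemma smooth_on_compose:
  fixes f :: "'a::euclidean_space \<Rightarrow> 'b::euclidean_space"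
  shows "smooth_on S f \<Longrightarrow> smooth_on T g \<Longrightarrow> f ` S \<subseteq> T \<Longrightarrow> smooth_on S (\<lambda>x. g (f x))"
  unfolding smooth_on_def using Ck_on_compose by blast

lemma smooth_on_differentiable: "smooth_on S f \<Longrightarrow> x \<in> S \<Longrightarrow> f differentiable (at x)"
  unfolding smooth_on_def by (metis Ck_on.simps(2))

lemma smooth_on_has_derivative:
  "smooth_on S f \<Longrightarrow> x \<in> S \<Longrightarrow> (f has_derivative frechet_derivative f (at x)) (at x)"
  using smooth_on_differentiable frechet_derivative_works by blast

lemma smooth_on_frechet: "smooth_on S f \<Longrightarrow> smooth_on S (\<lambda>x. frechet_derivative f (at x) v)"
  unfolding smooth_on_def by (metis Ck_on.simps(2))

subsection \<open>Derivatives at a point\<close>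

text \<open>The second difference of \<open>f\<close> in the directions \<open>u\<close>, \<open>v\<close> is
  \<open>s\<^sup>2 * B\<^sub>u v + o(s\<^sup>2)\<close> by the mean value theorem, and it is symmetric in
  \<open>u\<close> and \<open>v\<close>.\<close>

lemma second_difference_bound:
  fixes f :: "'a::euclidean_space \<Rightarrow> real"
  assumes S: "open S" "x \<in> S"
    and f: "\<And>y. y \<in> S \<Longrightarrow> (f has_derivative f' y) (at y)"
    and B: "((\<lambda>y. f' y u) has_derivative B) (at x)"
    and e: "e > 0"
  shows "\<exists>d>0. \<forall>s. 0 < s \<and> s < d \<longrightarrow>
    \<bar>f (x + s *\<^sub>R u + s *\<^sub>R v) - f (x + s *\<^sub>R u) - f (x + s *\<^sub>R v) + f x - s\<^sup>2 * B v\<bar>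
      \<le> e * s\<^sup>2 * (2 * norm u + norm v)"
proof -
  from S obtain r where r: "r > 0" "ball x r \<subseteq> S" using open_contains_ball by blast
  from B e obtain d0 where d0: "d0 > 0"
    "\<And>y. norm (y - x) < d0 \<Longrightarrow> \<bar>f' y u - f' x u - B (y - x)\<bar> \<le> e * norm (y - x)"
    unfolding has_derivative_at_alt by (metis real_norm_def)
  interpret B: bounded_linear B using B by (rule has_derivative_bounded_linear)
  \<comment> \<open>The summand 1 keeps the denominator of \<open>d\<close> positive; for
    \<open>s < d\<close> all points \<open>x + t u + c v\<close> with \<open>t\<close> and
    \<open>c\<close> between 0 and \<open>s\<close> stay within both radii.\<close>
  let ?n = "norm u + norm v + 1"
  define d where "d = min r d0 / ?n"
  have n: "?n > 0" using norm_ge_zero[of u] norm_ge_zero[of v] by linarith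
  have "d > 0" unfolding d_def using r d0 n by simp
  moreover have "\<bar>f (x + s *\<^sub>R u + s *\<^sub>R v) - f (x + s *\<^sub>R u) - f (x + s *\<^sub>R v) + f x - s\<^sup>2 * B v\<bar>
      \<le> e * s\<^sup>2 * (2 * norm u + norm v)" if s: "0 < s" "s < d" for s
  proof -
    have sn: "s * ?n < min r d0" using s n by (simp add: d_def field_simps)
    have small: "norm (t *\<^sub>R u + c *\<^sub>R v) \<le> s * norm u + c * norm v" "norm (t *\<^sub>R u + c *\<^sub>R v) < min r d0"
      if "0 \<le> t" "t \<le> s" "0 \<le> c" "c \<le> s" for t c
    proof -
      have "norm (t *\<^sub>R u + c *\<^sub>R v) \<le> t * norm u + c * norm v"
        using norm_triangle_ineq[of "t *\<^sub>R u" "c *\<^sub>R v"] that by simp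
      moreover have "t * norm u \<le> s * norm u" "c * norm v \<le> s * norm v"
        using that by (auto intro: mult_right_mono)
      moreover have "s * norm u + s * norm v < s * ?n" using s by (simp add: algebra_simps)
      ultimately show "norm (t *\<^sub>R u + c *\<^sub>R v) \<le> s * norm u + c * norm v"
        "norm (t *\<^sub>R u + c *\<^sub>R v) < min r d0" using sn by linarith+
    qed
    \<comment> \<open>The first difference in direction \<open>v\<close> as a function of the
      displacement along \<open>u\<close>; its increment over the interval from 0 to
      \<open>s\<close> is the second difference. Writing \<open>0 *\<^sub>R v\<close> lets one
      derivative rule cover both summands.\<close>
    define \<phi> where "\<phi> t = f (x + (t *\<^sub>R u + s *\<^sub>R v)) - f (x + (t *\<^sub>R u + 0 *\<^sub>R v))" for t
    have inS: "x + (t *\<^sub>R u + c *\<^sub>R v) \<in> S" if "0 \<le> t" "t \<le> s" "0 \<le> c" "c \<le> s" for t c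
    proof -
      have "x + (t *\<^sub>R u + c *\<^sub>R v) \<in> ball x r" using small(2)[OF that] unfolding mem_ball dist_commute[of x] by (simp add: dist_norm)
      then show ?thesis using r by blast
    qed
    have der: "((\<lambda>t. f (x + (t *\<^sub>R u + c *\<^sub>R v))) has_derivative
        (\<lambda>h. h * f' (x + (t *\<^sub>R u + c *\<^sub>R v)) u)) (at t)" if "0 \<le> t" "t \<le> s" "0 \<le> c" "c \<le> s" for t c
    proof -
      have 1: "((\<lambda>t. x + (t *\<^sub>R u + c *\<^sub>R v)) has_derivative (\<lambda>h. h *\<^sub>R u)) (at t)"
        by (auto intro!: derivative_eq_intros)
      have "((\<lambda>t. f (x + (t *\<^sub>R u + c *\<^sub>R v))) has_derivative (\<lambda>h. f' (x + (t *\<^sub>R u + c *\<^sub>R v)) (h *\<^sub>R u))) (at t)"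
        using has_derivative_compose[OF 1 f[OF inS[OF that]]] by simp
      moreover have "linear (f' (x + (t *\<^sub>R u + c *\<^sub>R v)))"
        using f[OF inS[OF that]] has_derivative_linear by blast
      ultimately show ?thesis by (simp add: linear_cmul)
    qed
    let ?\<phi>' = "\<lambda>t. f' (x + (t *\<^sub>R u + s *\<^sub>R v)) u - f' (x + (t *\<^sub>R u + 0 *\<^sub>R v)) u"
    have "(\<phi> has_derivative (\<lambda>h. h * ?\<phi>' t)) (at t)" if "0 \<le> t" "t \<le> s" for t
      unfolding \<phi>_def right_diff_distrib
      using that s by (intro has_derivative_diff der) auto
    then obtain z where z: "0 < z" "z < s" "\<phi> s - \<phi> 0 = s * ?\<phi>' z"
      using mvt_simple[of 0 s \<phi> "\<lambda>t h. h * ?\<phi>' t"] s has_derivative_at_withinI[of \<phi>]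
      by auto
    have a: "\<bar>f' (x + (z *\<^sub>R u + c *\<^sub>R v)) u - f' x u - (z * B u + c * B v)\<bar>
        \<le> e * (s * norm u + c * norm v)" if "0 \<le> c" "c \<le> s" for c
    proof -
      have "\<bar>f' (x + (z *\<^sub>R u + c *\<^sub>R v)) u - f' x u - B (z *\<^sub>R u + c *\<^sub>R v)\<bar>
          \<le> e * norm (z *\<^sub>R u + c *\<^sub>R v)"
        using d0(2)[of "x + (z *\<^sub>R u + c *\<^sub>R v)"] small(2)[of z c] z that by simp
      also have "\<dots> \<le> e * (s * norm u + c * norm v)"
        using small(1)[of z c] z that e by (intro mult_left_mono) auto
      finally show ?thesis by (simp add: B.add B.scaleR)
    qed
    \<comment> \<open>Subtracting the linear approximations for \<open>c = s\<close> and
      \<open>c = 0\<close> cancels the terms \<open>z * B u\<close>, and the two errors add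
      up.\<close>
    have "\<bar>?\<phi>' z - s * B v\<bar> \<le> e * (s * norm u + s * norm v) + e * (s * norm u)"
      using a[of s] a[of 0] s by (simp add: algebra_simps)
    then have "s * \<bar>?\<phi>' z - s * B v\<bar> \<le> s * (e * (s * norm u + s * norm v) + e * (s * norm u))"
      using s by (intro mult_left_mono) auto
    moreover have "s * \<bar>?\<phi>' z - s * B v\<bar> = \<bar>\<phi> s - \<phi> 0 - s\<^sup>2 * B v\<bar>"
      using s z(3) by (simp add: abs_mult[of s, simplified, symmetric] power2_eq_square algebra_simps abs_mult_pos')
    moreover have "\<phi> s - \<phi> 0 = f (x + s *\<^sub>R u + s *\<^sub>R v) - f (x + s *\<^sub>R u) - f (x + s *\<^sub>R v) + f x"
      by (simp add: \<phi>_def algebra_simps)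
    ultimately show ?thesis by (simp add: power2_eq_square algebra_simps)
  qed
  ultimately show ?thesis by blast
qed

lemma second_derivative_symmetric_real:
  fixes f :: "'a::euclidean_space \<Rightarrow> real"
  assumes S: "open S" "x \<in> S"
    and f: "\<And>y. y \<in> S \<Longrightarrow> (f has_derivative f' y) (at y)"
    and B: "\<And>u. ((\<lambda>y. f' y u) has_derivative B u) (at x)"
  shows "B u v = B v u"
proof (rule ccontr)
  assume ne: "B u v \<noteq> B v u"
  let ?m = "3 * norm u + 3 * norm v + 1"
  have m: "?m > 0" using norm_ge_zero[of u] norm_ge_zero[of v] by linarith
  \<comment> \<open>The error bounds for the two orders of \<open>u\<close> and \<open>v\<close> add
    up to \<open>e * s\<^sup>2 * (3 * norm u + 3 * norm v)\<close>, which for this \<open>e\<close>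
    is less than \<open>s\<^sup>2\<close> times the supposed gap.\<close>
  define e where "e = \<bar>B u v - B v u\<bar> / (2 * ?m)"
  have e: "e > 0" using ne m by (simp add: e_def)
  let ?D = "\<lambda>s. f (x + s *\<^sub>R u + s *\<^sub>R v) - f (x + s *\<^sub>R u) - f (x + s *\<^sub>R v) + f x"
  from second_difference_bound[OF S f B e, of u v] obtain d1 where
    d1: "d1 > 0" "\<And>s. 0 < s \<Longrightarrow> s < d1 \<Longrightarrow> \<bar>?D s - s\<^sup>2 * B u v\<bar> \<le> e * s\<^sup>2 * (2 * norm u + norm v)"
    by blast
  from second_difference_bound[OF S f B e, of v u] obtain d2 where
    d2: "d2 > 0" "\<And>s. 0 < s \<Longrightarrow> s < d2 \<Longrightarrow>
      \<bar>f (x + s *\<^sub>R v + s *\<^sub>R u) - f (x + s *\<^sub>R v) - f (x + s *\<^sub>R u) + f x - s\<^sup>2 * B v u\<bar>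
        \<le> e * s\<^sup>2 * (2 * norm v + norm u)"
    by blast
  define s where "s = min d1 d2 / 2"
  have s: "0 < s" "s < d1" "s < d2" using d1(1) d2(1) by (auto simp: s_def min_def)
  have "\<bar>?D s - s\<^sup>2 * B v u\<bar> \<le> e * s\<^sup>2 * (2 * norm v + norm u)"
    using d2(2)[of s] s by (simp add: algebra_simps)
  with d1(2)[of s] s have "\<bar>s\<^sup>2 * B u v - s\<^sup>2 * B v u\<bar> \<le> e * s\<^sup>2 * (3 * norm u + 3 * norm v)"
    by (simp add: algebra_simps)
  then have "s\<^sup>2 * \<bar>B u v - B v u\<bar> \<le> s\<^sup>2 * (e * (3 * norm u + 3 * norm v))"
    unfolding right_diff_distrib[symmetric] abs_mult by (simp add: algebra_simps)
  then have "\<bar>B u v - B v u\<bar> \<le> e * (3 * norm u + 3 * norm v)" using s by simp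
  also have "\<dots> < e * (2 * ?m)" using e m by (intro mult_strict_left_mono) auto
  also have "\<dots> = \<bar>B u v - B v u\<bar>" using m by (simp add: e_def)
  finally show False by simp
qed

lemma second_derivative_symmetric:
  fixes f :: "'a::euclidean_space \<Rightarrow> 'b::euclidean_space"
  assumes "open S" "x \<in> S"
    and f: "\<And>y. y \<in> S \<Longrightarrow> (f has_derivative f' y) (at y)"
    and B: "\<And>u. ((\<lambda>y. f' y u) has_derivative B u) (at x)"
  shows "B u v = B v u"
proof (rule euclidean_eqI)
  fix b :: 'b
  show "B u v \<bullet> b = B v u \<bullet> b"
    by (rule second_derivative_symmetric_real[where f = "\<lambda>y. f y \<bullet> b" and f' = "\<lambda>y u. f' y u \<bullet> b"
            and B = "\<lambda>u v. B u v \<bullet> b", OF assms(1,2)])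
       (use f B in \<open>auto intro: has_derivative_inner_left\<close>)
qed

lemma has_derivative_cong_nhds:
  assumes "(f has_derivative D) (at x)" "\<forall>\<^sub>F y in nhds x. f y = g y"
  shows "(g has_derivative D) (at x)"
proof (rule has_derivative_transform_eventually[OF assms(1)])
  show "f x = g x" using assms(2) by (rule eventually_nhds_x_imp_x)
  show "\<forall>\<^sub>F y in at x. f y = g y"
    unfolding eventually_at_filter using assms(2) by (rule eventually_mono) simp
qed simp

text \<open>The product rule for a family of linear maps known only through its values on fixed
  vectors. Expanding \<open>w x\<close> over \<open>Basis\<close> reduces it to products with scalar
  functions, so no operator space is involved.\<close>

lemma has_derivative_apply:
  fixes w :: "'a::euclidean_space \<Rightarrow> 'b::euclidean_space"
    and L :: "'a \<Rightarrow> 'b \<Rightarrow> 'c::real_normed_vector"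
  assumes lin: "\<forall>\<^sub>F x in nhds x0. linear (L x)"
    and L: "\<And>e. ((\<lambda>x. L x e) has_derivative L' e) (at x0)"
    and w: "(w has_derivative w') (at x0)"
  shows "((\<lambda>x. L x (w x)) has_derivative (\<lambda>u. L' (w x0) u + L x0 (w' u))) (at x0)"
proof -
  have l0: "linear (L x0)" using lin eventually_nhds_x_imp_x by blast
  \<comment> \<open>Linearity of \<open>L' e u\<close> in \<open>e\<close> follows from linearity of
    \<open>L x\<close> near \<open>x0\<close> by uniqueness of the derivative.\<close>
  have L'exp: "L' e u = (\<Sum>b\<in>Basis. (e \<bullet> b) *\<^sub>R L' b u)" for e u
  proof -
    have "((\<lambda>x. \<Sum>b\<in>Basis. (e \<bullet> b) *\<^sub>R L x b) has_derivative (\<lambda>u. \<Sum>b\<in>Basis. (e \<bullet> b) *\<^sub>R L' b u)) (at x0)"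
      by (intro has_derivative_sum has_derivative_scaleR_right L)
    moreover have "\<forall>\<^sub>F x in nhds x0. (\<Sum>b\<in>Basis. (e \<bullet> b) *\<^sub>R L x b) = L x e"
      using lin by eventually_elim (rule linear_basis_expansion[symmetric])
    ultimately have "((\<lambda>x. L x e) has_derivative (\<lambda>u. \<Sum>b\<in>Basis. (e \<bullet> b) *\<^sub>R L' b u)) (at x0)"
      by (rule has_derivative_cong_nhds)
    from has_derivative_unique[OF L[of e] this] show ?thesis by simp
  qed
  have "((\<lambda>x. \<Sum>b\<in>Basis. (w x \<bullet> b) *\<^sub>R L x b) has_derivative
      (\<lambda>u. \<Sum>b\<in>Basis. (w x0 \<bullet> b) *\<^sub>R L' b u + (w' u \<bullet> b) *\<^sub>R L x0 b)) (at x0)"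
    by (intro has_derivative_sum has_derivative_scaleR L has_derivative_inner_left w)
  moreover have "(\<lambda>u. \<Sum>b\<in>Basis. (w x0 \<bullet> b) *\<^sub>R L' b u + (w' u \<bullet> b) *\<^sub>R L x0 b) =
      (\<lambda>u. L' (w x0) u + L x0 (w' u))"
    by (rule ext) (subst sum.distrib, subst L'exp[symmetric], subst linear_basis_expansion[OF l0, symmetric], rule refl)
  moreover have "\<forall>\<^sub>F x in nhds x0. (\<Sum>b\<in>Basis. (w x \<bullet> b) *\<^sub>R L x b) = L x (w x)"
    using lin by eventually_elim (rule linear_basis_expansion[symmetric])
  ultimately show ?thesis
    by (auto intro: has_derivative_cong_nhds)
qed

subsection \<open>Conormals of hyperplanes\<close>

lemma differentiable_prod:
  fixes f :: "'i \<Rightarrow> 'a::real_normed_vector \<Rightarrow> real"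
  assumes "\<And>i. i \<in> I \<Longrightarrow> f i differentiable (at x)"
  shows "(\<lambda>x. \<Prod>i\<in>I. f i x) differentiable (at x)"
  using assms by (induction I rule: infinite_finite_induct) (auto intro: differentiable_mult)

lemma differentiable_det:
  fixes A :: "'a::real_normed_vector \<Rightarrow> real^'n^'n"
  assumes "\<And>i j. (\<lambda>x. A x $ i $ j) differentiable (at x)"
  shows "(\<lambda>x. det (A x)) differentiable (at x)"
  unfolding det_def
  by (auto intro!: differentiable_sum differentiable_mult differentiable_prod assms simp: finite_permutations)

text \<open>A generalised cross product: row \<open>i0\<close> of the determinant is
  \<open>z\<close>, the other rows are the images under \<open>L\<close> of the standard basis
  vectors, matched by \<open>g\<close>. Being polynomial in \<open>L\<close>, it gives a conormal of
  the image hyperplane that depends differentiably on \<open>L\<close> without any choice of a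
  normal.\<close>

definition conormal :: "'n \<Rightarrow> ('n \<Rightarrow> 'm) \<Rightarrow> (real^'m \<Rightarrow> real^'n) \<Rightarrow> real^'n \<Rightarrow> real" where
  "conormal i0 g L z = det (\<chi> i. if i = i0 then z else L (axis (g i) 1))"

lemma linear_conormal: "linear (conormal i0 g L)"
proof (rule linearI)
  show "conormal i0 g L (a + b) = conormal i0 g L a + conormal i0 g L b" for a b
    unfolding conormal_def using det_row_add[of i0 "\<lambda>_. a" "\<lambda>_. b"] by simp
  show "conormal i0 g L (c *\<^sub>R a) = c *\<^sub>R conormal i0 g L a" for c a
    unfolding conormal_def using det_row_mul[of i0 c "\<lambda>_. a"] by (simp add: scalar_mult_eq_scaleR cong: if_cong)
qed

text \<open>The transposed matrix forms combinations of the rows, that is, a multiple of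
  \<open>z\<close> plus an arbitrary value of \<open>L\<close>. As \<open>L\<close> is injective,
  this is injective exactly when \<open>z\<close> is outside the range of \<open>L\<close>.\<close>

lemma conormal_eq_0_iff:
  fixes L :: "real^'m \<Rightarrow> real^'n"
  assumes g: "bij_betw g (- {i0}) UNIV" and L: "linear L" "inj L"
  shows "conormal i0 g L z = 0 \<longleftrightarrow> z \<in> range L"
proof -
  let ?A = "(\<chi> i. if i = i0 then z else L (axis (g i) 1)) :: real^'n^'n"
  let ?h = "inv_into (- {i0}) g"
  have sum: "transpose ?A *v y = y $ i0 *\<^sub>R z + L (\<chi> k. y $ ?h k)" for y
  proof -
    have "transpose ?A *v y = (\<Sum>i\<in>UNIV. y $ i *\<^sub>R ?A $ i)"
      by (simp add: matrix_mult_sum row_def scalar_mult_eq_scaleR vec_eq_iff)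
    also have "\<dots> = y $ i0 *\<^sub>R z + (\<Sum>i\<in>-{i0}. y $ i *\<^sub>R L (axis (g i) 1))"
      by (subst sum.remove[of _ i0]) (auto simp: Compl_eq_Diff_UNIV intro!: sum.cong)
    also have "(\<Sum>i\<in>-{i0}. y $ i *\<^sub>R L (axis (g i) 1)) =
        (\<Sum>i\<in>-{i0}. y $ ?h (g i) *\<^sub>R L (axis (g i) 1))"
      using g by (intro sum.cong) (auto simp: bij_betw_def inv_into_f_f)
    also have "\<dots> = (\<Sum>k\<in>UNIV. y $ ?h k *\<^sub>R L (axis k 1))"
      by (rule sum.reindex_bij_betw[OF g])
    also have "\<dots> = L (\<Sum>k\<in>UNIV. y $ ?h k *\<^sub>R axis k 1)"
      by (simp add: linear_sum[OF L(1)] linear_cmul[OF L(1)])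
    also have "(\<Sum>k\<in>UNIV. y $ ?h k *\<^sub>R axis k 1) = (\<chi> k. y $ ?h k)"
      using basis_expansion[of "\<chi> k. y $ ?h k"] by (simp add: scalar_mult_eq_scaleR)
    finally show ?thesis .
  qed
  have lin: "linear (\<lambda>y. transpose ?A *v y)" by (rule matrix_vector_mul_linear)
  have "conormal i0 g L z \<noteq> 0 \<longleftrightarrow> inj (\<lambda>y. transpose ?A *v y)"
    unfolding conormal_def det_nz_iff_inj[OF lin, symmetric] matrix_of_matrix_vector_mul det_transpose ..
  also have "\<dots> \<longleftrightarrow> z \<notin> range L"
  proof
    assume inj: "inj (\<lambda>y. transpose ?A *v y)"
    show "z \<notin> range L"
    proof
      assume "z \<in> range L"
      then obtain v where v: "z = L v" by blast
      \<comment> \<open>For \<open>z = L v\<close>, the coefficient -1 at row \<open>i0\<close>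
        cancels the coordinates of \<open>v\<close> at the other rows: a nonzero kernel
        vector.\<close>
      define y :: "real^'n" where "y = (\<chi> i. if i = i0 then -1 else v $ g i)"
      have "(\<chi> k. y $ ?h k) = v"
        using g by (auto simp: y_def vec_eq_iff bij_betw_def f_inv_into_f)
           (metis ComplD UNIV_I inv_into_into singletonI)
      then have "transpose ?A *v y = transpose ?A *v 0"
        unfolding sum by (simp add: y_def v zero_vec_def[symmetric] linear_0[OF L(1)])
      then have "y = 0" using inj by (simp add: inj_def)
      moreover have "y $ i0 = -1" by (simp add: y_def)
      ultimately show False by simp
    qed
  next
    assume z: "z \<notin> range L"
    have "y = 0" if "transpose ?A *v y = 0" for y
    proof -
      have eq: "y $ i0 *\<^sub>R z + L (\<chi> k. y $ ?h k) = 0" using that sum by simp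
      have i0: "y $ i0 = 0"
      proof (rule ccontr)
        assume ne: "y $ i0 \<noteq> 0"
        from eq have "y $ i0 *\<^sub>R z = L (- (\<chi> k. y $ ?h k))"
          by (simp add: linear_neg[OF L(1)] eq_neg_iff_add_eq_0)
        then have "z = L ((1 / y $ i0) *\<^sub>R (- (\<chi> k. y $ ?h k)))"
          unfolding linear_cmul[OF L(1)] using ne by (metis divide_self_if scaleR_one scaleR_scaleR times_divide_eq_left mult_1)
        with z show False by blast
      qed
      with eq have "L (\<chi> k. y $ ?h k) = L 0" by (simp add: linear_0[OF L(1)])
      then have "(\<chi> k. y $ ?h k) = 0" using L(2) by (simp add: inj_def)
      then have "y $ ?h k = 0" for k by (metis vec_lambda_beta zero_index)
      then have "y $ i = 0" if "i \<noteq> i0" for i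
        using g that by (metis ComplI bij_betw_def inv_into_f_f singletonD)
      with i0 show "y = 0" by (metis vec_eq_iff zero_index)
    qed
    then show "inj (\<lambda>y. transpose ?A *v y)" unfolding linear_injective_0[OF lin] by blast
  qed
  finally show ?thesis by blast
qed

lemma differentiable_conormal:
  assumes "\<And>v. (\<lambda>x. P x v) differentiable (at x)"
  shows "(\<lambda>x. conormal i0 g (P x) z) differentiable (at x)"
  unfolding conormal_def
proof (rule differentiable_det)
  fix i j
  have "(\<lambda>x. P x (axis (g i) 1) \<bullet> axis j 1) differentiable (at x)"
    using assms by (intro differentiable_inner) auto
  then show "(\<lambda>x. (\<chi> i. if i = i0 then z else P x (axis (g i) 1)) $ i $ j) differentiable (at x)"
    by (cases "i = i0") (simp_all add: inner_axis)
qed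

subsection \<open>Frames of 1-forms\<close>

text \<open>The exterior derivative on constant coordinate fields, whose bracket vanishes.\<close>

definition coord_d :: "('a::euclidean_space \<Rightarrow> 'a \<Rightarrow> real) \<Rightarrow> 'a \<Rightarrow> 'a \<Rightarrow> 'a \<Rightarrow> real" where
  "coord_d \<omega> x u v = frechet_derivative (\<lambda>y. \<omega> y v) (at x) u - frechet_derivative (\<lambda>y. \<omega> y u) (at x) v"

lemma coord_d_eq:
  assumes "\<And>v. ((\<lambda>y. \<omega> y v) has_derivative \<omega>' v) (at x)"
  shows "coord_d \<omega> x u v = \<omega>' v u - \<omega>' u v"
  using frechet_derivative_at[OF assms] by (metis coord_d_def)

lemma eventually_nonzero:
  fixes f :: "'a::real_normed_vector \<Rightarrow> real"
  assumes "f differentiable (at x)" "f x \<noteq> 0"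
  shows "\<forall>\<^sub>F y in nhds x. f y \<noteq> 0"
proof -
  have "(f \<longlongrightarrow> f x) (at x)"
    using differentiable_imp_continuous_within[OF assms(1)] by (simp add: continuous_within)
  then show ?thesis
    unfolding eventually_nhds_conv_at using tendsto_imp_eventually_ne assms(2) by blast
qed

text \<open>Cramer's rule on vectors that are dual at \<open>x0\<close>: the coefficients are
  quotients of determinants with denominator 1 at \<open>x0\<close>, hence differentiable there. The
  kernel condition extends the identity from the span of the \<open>w k\<close> to all
  vectors.\<close>

lemma coefficient_functions:
  fixes \<eta> \<zeta> :: "'n::finite \<Rightarrow> 'a::euclidean_space \<Rightarrow> 'a \<Rightarrow> real"
  assumes lin: "\<forall>\<^sub>F x in nhds x0. \<forall>i. linear (\<eta> i x) \<and> linear (\<zeta> i x)"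
    and ker: "\<forall>\<^sub>F x in nhds x0. \<forall>v. (\<forall>j. \<zeta> j x v = 0) \<longrightarrow> (\<forall>i. \<eta> i x v = 0)"
    and d\<eta>: "\<And>i v. (\<lambda>x. \<eta> i x v) differentiable (at x0)"
    and d\<zeta>: "\<And>i v. (\<lambda>x. \<zeta> i x v) differentiable (at x0)"
    and dual: "\<And>j k. \<zeta> j x0 (w k) = (if j = k then 1 else 0)"
  obtains A where "\<And>i j. A i j differentiable (at x0)"
    "\<forall>\<^sub>F x in nhds x0. \<forall>i v. \<eta> i x v = (\<Sum>j\<in>UNIV. A i j x * \<zeta> j x v)"
proof
  define E where "E x = (\<chi> k j. \<zeta> j x (w k))" for x
  define A where "A i j x = det (\<chi> k l. if l = j then \<eta> i x (w k) else E x $ k $ l) / det (E x)" for i j x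
  have dE: "(\<lambda>x. det (E x)) differentiable (at x0)"
    by (rule differentiable_det) (simp add: E_def d\<zeta>)
  have "E x0 = mat 1" by (auto simp: E_def dual mat_def vec_eq_iff)
  then have E0: "det (E x0) = 1" by simp
  show "A i j differentiable (at x0)" for i j
    unfolding A_def
  proof (rule differentiable_divide)
    show "(\<lambda>x. det (\<chi> k l. if l = j then \<eta> i x (w k) else E x $ k $ l)) differentiable (at x0)"
    proof (rule differentiable_det)
      fix k l
      show "(\<lambda>x. (\<chi> k l. if l = j then \<eta> i x (w k) else E x $ k $ l) $ k $ l) differentiable (at x0)"
        by (cases "l = j") (simp_all add: E_def d\<eta> d\<zeta>)
    qed
  qed (use dE E0 in auto)
  have "\<forall>\<^sub>F x in nhds x0. det (E x) \<noteq> 0"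
    by (rule eventually_nonzero[OF dE]) (simp add: E0)
  then show "\<forall>\<^sub>F x in nhds x0. \<forall>i v. \<eta> i x v = (\<Sum>j\<in>UNIV. A i j x * \<zeta> j x v)"
    using lin ker
  proof (eventually_elim, intro allI)
    fix x i v
    assume dx: "det (E x) \<noteq> 0" and lx: "\<forall>i. linear (\<eta> i x) \<and> linear (\<zeta> i x)"
      and kx: "\<forall>v. (\<forall>j. \<zeta> j x v = 0) \<longrightarrow> (\<forall>i. \<eta> i x v = 0)"
    have "E x *v (\<chi> j. A i j x) = (\<chi> k. \<eta> i x (w k))"
      unfolding cramer[OF dx] by (simp add: A_def cong: if_cong)
    then have \<eta>w: "\<eta> i x (w k) = (\<Sum>j\<in>UNIV. A i j x * \<zeta> j x (w k))" for k
      by (auto simp: vec_eq_iff matrix_vector_mult_def E_def mult.commute)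
    \<comment> \<open>The transposed system replaces \<open>v\<close> by a combination
      \<open>v'\<close> of the \<open>w k\<close> on which all \<open>\<zeta> j x\<close> take the
      same values; the difference lies in the common kernel.\<close>
    have "det (transpose (E x)) \<noteq> 0" using dx by simp
    from cramer[OF this] obtain l where l: "transpose (E x) *v l = (\<chi> j. \<zeta> j x v)" by blast
    define v' where "v' = (\<Sum>k\<in>UNIV. l $ k *\<^sub>R w k)"
    have v': "\<phi> v' = (\<Sum>k\<in>UNIV. l $ k * \<phi> (w k))" if "linear \<phi>" for \<phi> :: "'a \<Rightarrow> real"
      by (simp add: v'_def linear_sum[OF that] linear_cmul[OF that])
    have \<zeta>: "\<zeta> j x v' = \<zeta> j x v" for j
      using l lx by (auto simp: v' vec_eq_iff matrix_vector_mult_def E_def transpose_def mult.commute)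
    then have "\<zeta> j x (v - v') = 0" for j using lx by (simp add: linear_diff)
    then have "\<eta> i x (v - v') = 0" using kx by blast
    then have "\<eta> i x v = \<eta> i x v'" using lx by (simp add: linear_diff)
    also have "\<dots> = (\<Sum>k\<in>UNIV. \<Sum>j\<in>UNIV. l $ k * (A i j x * \<zeta> j x (w k)))"
      using lx by (simp add: v' \<eta>w sum_distrib_left)
    also have "\<dots> = (\<Sum>j\<in>UNIV. A i j x * \<zeta> j x v')"
      using lx by (subst sum.swap) (simp add: v' sum_distrib_left mult.left_commute)
    finally show "\<eta> i x v = (\<Sum>j\<in>UNIV. A i j x * \<zeta> j x v)" by (simp add: \<zeta>)
  qed
qed

text \<open>The derivatives of the coefficients enter only with a factor
  \<open>\<zeta> j x0 u\<close> or \<open>\<zeta> j x0 v\<close>, which is 0.\<close>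

lemma coord_d_combination:
  fixes \<eta> :: "'a::euclidean_space \<Rightarrow> 'a \<Rightarrow> real" and \<zeta> :: "'n::finite \<Rightarrow> 'a \<Rightarrow> 'a \<Rightarrow> real"
  assumes A: "\<And>j. A j differentiable (at x0)"
    and d\<zeta>: "\<And>j v. (\<lambda>x. \<zeta> j x v) differentiable (at x0)"
    and eq: "\<forall>\<^sub>F x in nhds x0. \<forall>v. \<eta> x v = (\<Sum>j\<in>UNIV. A j x * \<zeta> j x v)"
    and uv: "\<And>j. \<zeta> j x0 u = 0" "\<And>j. \<zeta> j x0 v = 0"
  shows "coord_d \<eta> x0 u v = (\<Sum>j\<in>UNIV. A j x0 * coord_d (\<zeta> j) x0 u v)"
proof -
  let ?A' = "\<lambda>j. frechet_derivative (A j) (at x0)"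
  let ?\<zeta>' = "\<lambda>j v. frechet_derivative (\<lambda>x. \<zeta> j x v) (at x0)"
  have "((\<lambda>x. \<eta> x v) has_derivative (\<lambda>h. \<Sum>j\<in>UNIV. A j x0 * ?\<zeta>' j v h + ?A' j h * \<zeta> j x0 v)) (at x0)" for v
  proof (rule has_derivative_cong_nhds)
    show "((\<lambda>x. \<Sum>j\<in>UNIV. A j x * \<zeta> j x v) has_derivative
        (\<lambda>h. \<Sum>j\<in>UNIV. A j x0 * ?\<zeta>' j v h + ?A' j h * \<zeta> j x0 v)) (at x0)"
      using A d\<zeta> by (intro has_derivative_sum has_derivative_mult) (auto simp: frechet_derivative_works)
    show "\<forall>\<^sub>F x in nhds x0. (\<Sum>j\<in>UNIV. A j x * \<zeta> j x v) = \<eta> x v"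
      using eq by eventually_elim simp
  qed
  from coord_d_eq[of \<eta>, OF this] show ?thesis
    by (simp add: uv coord_d_def right_diff_distrib sum_subtractf)
qed

text \<open>The forms are jointly injective on the orthogonal complement of their common kernel, and
  by the dimension hypothesis they map it onto \<open>real^'n\<close>.\<close>

lemma dual_vectors_exist:
  fixes \<eta> :: "'n::finite \<Rightarrow> 'a::euclidean_space \<Rightarrow> real"
  assumes lin: "\<And>i. linear (\<eta> i)" and dim: "dim {v. \<forall>i. \<eta> i v = 0} + CARD('n) = DIM('a)"
  obtains w where "\<And>j k. \<eta> j (w k) = (if j = k then 1 else 0)"
proof -
  let ?K = "{v. \<forall>i. \<eta> i v = 0}"
  let ?e = "\<lambda>v. (\<chi> i. \<eta> i v) :: real^'n"
  have e: "linear ?e"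
    by (rule linearI) (auto simp: vec_eq_iff linear_add[OF lin] linear_cmul[OF lin])
  have K: "subspace ?K"
    by (auto simp: subspace_def linear_add[OF lin] linear_cmul[OF lin] linear_0[OF lin])
  let ?C = "{y. \<forall>x\<in>?K. orthogonal x y}"
  have C: "subspace ?C" using subspace_orthogonal_to_vectors by blast
  have dimC: "dim ?C = CARD('n)"
    using dim_subspace_orthogonal_to_vectors[OF K subspace_UNIV] dim by (simp add: dim_UNIV)
  have inj: "inj_on ?e (span ?C)"
  proof -
    have "x = 0" if "x \<in> ?C" "?e x = 0" for x
    proof -
      from that(2) have "x \<in> ?K" by (auto simp: vec_eq_iff)
      with that(1) show ?thesis by (auto simp: orthogonal_def)
    qed
    then show ?thesis
      using C linear_injective_on_subspace_0[OF e C] by (simp add: span_eq_iff[THEN iffD2])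
  qed
  have "dim (?e ` ?C) = CARD('n)" using dim_image_eq[OF e inj] dimC by simp
  then have "?e ` ?C = UNIV"
    using dim_eq_full[of "?e ` ?C"] linear_subspace_image[OF e C] by (simp add: span_eq_iff[THEN iffD2])
  then have im: "axis k 1 \<in> ?e ` ?C" for k by simp
  have "\<exists>w. \<forall>j. \<eta> j w = (if j = k then 1 else 0)" for k
  proof -
    from im[of k] obtain w where "axis k 1 = ?e w" by blast
    then have "\<eta> j w = axis k 1 $ j" for j by simp
    then have "\<forall>j. \<eta> j w = (if j = k then 1 else 0)" by (simp add: axis_def)
    then show ?thesis by blast
  qed
  then obtain w where "\<And>j k. \<eta> j (w k) = (if j = k then 1 else 0)" by metis
  then show ?thesis using that by blast
qed

subsection \<open>Twisted pull-backs\<close>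

text \<open>Here \<open>P\<close> is the differential of an immersion, \<open>B\<close> its second
  derivative and \<open>\<Gamma>\<close> a Christoffel symbol, so \<open>\<tau> u\<close> and
  \<open>D u\<close> are the covariant derivatives of \<open>\<theta>\<close> and \<open>J\<close>
  along \<open>P x0 u\<close>. Antisymmetrising removes \<open>B\<close>; of the inserted
  \<open>\<Gamma>\<close> terms some cancel in pairs and the others drop out by symmetry of
  \<open>\<Gamma>\<close>.\<close>

lemma coord_d_twisted:
  fixes P :: "'a::euclidean_space \<Rightarrow> 'a \<Rightarrow> 'b::euclidean_space" and \<theta> :: "'a \<Rightarrow> 'b \<Rightarrow> real"
    and J :: "'a \<Rightarrow> 'b \<Rightarrow> 'b" and \<Gamma> :: "'b \<Rightarrow> 'b \<Rightarrow> 'b"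
  assumes lin: "\<forall>\<^sub>F x in nhds x0. linear (\<theta> x)" "\<forall>\<^sub>F x in nhds x0. linear (J x)"
    and \<theta>: "\<And>z. ((\<lambda>x. \<theta> x z) has_derivative \<theta>' z) (at x0)"
    and J: "\<And>z. ((\<lambda>x. J x z) has_derivative J' z) (at x0)"
    and P: "\<And>v. ((\<lambda>x. P x v) has_derivative B v) (at x0)" and B: "\<And>u v. B u v = B v u"
    and \<Gamma>: "\<And>y z. \<Gamma> y z = \<Gamma> z y"
    and \<omega>: "\<forall>\<^sub>F x in nhds x0. \<forall>v. \<omega> x v = \<theta> x (J x (P x v))"
  defines "\<tau> u z \<equiv> \<theta>' z u - \<theta> x0 (\<Gamma> (P x0 u) z)"
    and "D u z \<equiv> J' z u + \<Gamma> (P x0 u) (J x0 z) - J x0 (\<Gamma> (P x0 u) z)"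
  shows "coord_d \<omega> x0 u v = \<tau> u (J x0 (P x0 v)) - \<tau> v (J x0 (P x0 u))
      + \<theta> x0 (D u (P x0 v)) - \<theta> x0 (D v (P x0 u))"
proof -
  have l: "linear (\<theta> x0)" "linear (J x0)" using lin by (auto dest: eventually_nhds_x_imp_x)
  have "((\<lambda>x. \<theta> x (J x (P x v))) has_derivative
      (\<lambda>u. \<theta>' (J x0 (P x0 v)) u + \<theta> x0 (J' (P x0 v) u + J x0 (B v u)))) (at x0)" for v
    by (intro has_derivative_apply lin \<theta> J P)
  then have "((\<lambda>x. \<omega> x v) has_derivative
      (\<lambda>u. \<theta>' (J x0 (P x0 v)) u + \<theta> x0 (J' (P x0 v) u + J x0 (B v u)))) (at x0)" for v
    by (rule has_derivative_cong_nhds) (use \<omega> in \<open>eventually_elim, simp\<close>)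
  from coord_d_eq[of \<omega>, OF this] show ?thesis
    by (simp add: \<tau>_def D_def linear_add[OF l(1)] linear_diff[OF l(1)] B[of u v] \<Gamma>[of "P x0 v" "P x0 u"])
qed

text \<open>Differentiating \<open>\<theta> x (P x v) = 0\<close> expresses
  \<open>\<tau> u (P x0 v)\<close>, up to sign the second fundamental form, through \<open>B\<close>
  and \<open>\<Gamma>\<close>, which are both symmetric.\<close>

lemma second_fundamental_form_symmetric:
  fixes P :: "'a::euclidean_space \<Rightarrow> 'a \<Rightarrow> 'b::euclidean_space" and \<theta> :: "'a \<Rightarrow> 'b \<Rightarrow> real"
  assumes lin: "\<forall>\<^sub>F x in nhds x0. linear (\<theta> x)"
    and \<theta>: "\<And>z. ((\<lambda>x. \<theta> x z) has_derivative \<theta>' z) (at x0)"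
    and P: "\<And>v. ((\<lambda>x. P x v) has_derivative B v) (at x0)" and B: "\<And>u v. B u v = B v u"
    and \<Gamma>: "\<And>y z. \<Gamma> y z = \<Gamma> z y"
    and \<theta>P: "\<forall>\<^sub>F x in nhds x0. \<forall>v. \<theta> x (P x v) = 0"
  defines "\<tau> u z \<equiv> \<theta>' z u - \<theta> x0 (\<Gamma> (P x0 u) z)"
  shows "\<tau> u (P x0 v) = \<tau> v (P x0 u)"
proof -
  have "((\<lambda>x. \<theta> x (P x v)) has_derivative (\<lambda>u. \<theta>' (P x0 v) u + \<theta> x0 (B v u))) (at x0)" for v
    by (intro has_derivative_apply lin \<theta> P)
  then have "((\<lambda>x. 0) has_derivative (\<lambda>u. \<theta>' (P x0 v) u + \<theta> x0 (B v u))) (at x0)" for v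
    by (rule has_derivative_cong_nhds) (use \<theta>P in \<open>eventually_elim, simp\<close>)
  then have "\<theta>' (P x0 v) u + \<theta> x0 (B v u) = 0" for u v
    using has_derivative_unique[OF _ has_derivative_const[of 0]] by metis
  from this[of v u] this[of u v] show ?thesis
    by (simp add: \<tau>_def B[of u v] \<Gamma>[of "P x0 v" "P x0 u"])
qed

subsection \<open>Quaternionic linear algebra\<close>

definition sym_bilinear_on :: "'t::real_vector set \<Rightarrow> ('t \<Rightarrow> 't \<Rightarrow> real) \<Rightarrow> bool" where
  "sym_bilinear_on S g \<longleftrightarrow> (\<forall>u\<in>S. \<forall>v\<in>S. g u v = g v u) \<and>
     (\<forall>u\<in>S. \<forall>v\<in>S. \<forall>w\<in>S. \<forall>a b. g (a *\<^sub>R u + b *\<^sub>R v) w = a * g u w + b * g v w)"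

definition inner_on :: "'t::real_vector set \<Rightarrow> ('t \<Rightarrow> 't \<Rightarrow> real) \<Rightarrow> bool" where
  "inner_on S g \<longleftrightarrow> sym_bilinear_on S g \<and> (\<forall>u\<in>S. u \<noteq> 0 \<longrightarrow> g u u > 0)"

locale sym_bilinear =
  fixes S :: "'t::real_vector set" and g :: "'t \<Rightarrow> 't \<Rightarrow> real"
  assumes S: "subspace S" and g: "sym_bilinear_on S g"
begin

lemma S_intros [simp, intro]:
  "0 \<in> S" "u \<in> S \<Longrightarrow> v \<in> S \<Longrightarrow> u + v \<in> S" "u \<in> S \<Longrightarrow> v \<in> S \<Longrightarrow> u - v \<in> S"
  "u \<in> S \<Longrightarrow> - u \<in> S" "u \<in> S \<Longrightarrow> c *\<^sub>R u \<in> S"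
  using S by (auto intro: subspace_0 subspace_add subspace_diff subspace_neg subspace_scale)

lemma sym: "u \<in> S \<Longrightarrow> v \<in> S \<Longrightarrow> g u v = g v u"
  using g unfolding sym_bilinear_on_def by blast

lemma comb_left:
  "u \<in> S \<Longrightarrow> v \<in> S \<Longrightarrow> w \<in> S \<Longrightarrow> g (a *\<^sub>R u + b *\<^sub>R v) w = a * g u w + b * g v w"
  using g unfolding sym_bilinear_on_def by blast

lemma left [simp]:
  assumes "u \<in> S" "v \<in> S" "w \<in> S"
  shows "g (u + v) w = g u w + g v w" "g (u - v) w = g u w - g v w"
  using comb_left[OF assms, of 1 1] comb_left[OF assms, of 1 "-1"] by simp_all

lemma left_scale [simp]:
  assumes "u \<in> S" "w \<in> S"
  shows "g (- u) w = - g u w" "g (c *\<^sub>R u) w = c * g u w"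
  using comb_left[OF assms(1,1,2), of "-1" 0] comb_left[OF assms(1,1,2), of c 0] by simp_all

lemma left_0 [simp]: "w \<in> S \<Longrightarrow> g 0 w = 0"
  using left_scale(2)[of 0 w 0] by simp

lemma right [simp]:
  assumes "u \<in> S" "v \<in> S" "w \<in> S"
  shows "g w (u + v) = g w u + g w v" "g w (u - v) = g w u - g w v"
  using assms left[of u v w] by (simp_all add: sym[of w])

lemma right_scale [simp]:
  assumes "u \<in> S" "w \<in> S"
  shows "g w (- u) = - g w u" "g w (c *\<^sub>R u) = c * g w u"
  using assms left_scale[of u w] by (simp_all add: sym[of w])

lemma right_0 [simp]: "w \<in> S \<Longrightarrow> g w 0 = 0"
  by (simp add: sym[of w 0])

end

locale inner_product = sym_bilinear +
  assumes pos: "u \<in> S \<Longrightarrow> u \<noteq> 0 \<Longrightarrow> g u u > 0"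
begin

lemma eq_0I: "u \<in> S \<Longrightarrow> (\<And>v. v \<in> S \<Longrightarrow> g u v = 0) \<Longrightarrow> u = 0"
  using pos by force

lemma eqI: "u \<in> S \<Longrightarrow> v \<in> S \<Longrightarrow> (\<And>w. w \<in> S \<Longrightarrow> g u w = g v w) \<Longrightarrow> u = v"
  using eq_0I[of "u - v"] by auto

end

locale quaternionic =
  fixes S :: "'t::real_vector set" and K :: "3 \<Rightarrow> 't \<Rightarrow> 't"
  assumes S: "subspace S" and qs: "quaternionic_structure S K"
begin

lemma S_intros [simp, intro]:
  "0 \<in> S" "u \<in> S \<Longrightarrow> v \<in> S \<Longrightarrow> u + v \<in> S" "u \<in> S \<Longrightarrow> v \<in> S \<Longrightarrow> u - v \<in> S"
  "u \<in> S \<Longrightarrow> - u \<in> S" "u \<in> S \<Longrightarrow> c *\<^sub>R u \<in> S"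
  using S by (auto intro: subspace_0 subspace_add subspace_diff subspace_neg subspace_scale)

lemma K_in [simp, intro]: "v \<in> S \<Longrightarrow> K i v \<in> S"
  using qs by (simp add: quaternionic_structure_def)

lemma comb: "u \<in> S \<Longrightarrow> v \<in> S \<Longrightarrow> K i (a *\<^sub>R u + b *\<^sub>R v) = a *\<^sub>R K i u + b *\<^sub>R K i v"
  using qs by (simp add: quaternionic_structure_def)

lemma linear [simp]:
  assumes "u \<in> S" "v \<in> S"
  shows "K i (u + v) = K i u + K i v" "K i (u - v) = K i u - K i v"
  using comb[OF assms, of i 1 1] comb[OF assms, of i 1 "-1"] by simp_all

lemma scale [simp]:
  assumes "u \<in> S"
  shows "K i (- u) = - K i u" "K i (c *\<^sub>R u) = c *\<^sub>R K i u"
  using comb[OF assms assms, of i "-1" 0] comb[OF assms assms, of i c 0] by simp_all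

lemma K_0 [simp]: "K i 0 = 0"
  using scale(2)[of 0 i 0] by simp

lemma mult [simp]:
  assumes v: "v \<in> S"
  shows "K i (K i v) = - v" "K 1 (K 2 v) = K 3 v" "K 2 (K 1 v) = - K 3 v"
    "K 2 (K 3 v) = K 1 v" "K 3 (K 2 v) = - K 1 v" "K 3 (K 1 v) = K 2 v" "K 1 (K 3 v) = - K 2 v"
proof -
  show sq: "K i (K i v) = - v" for i using qs v by (simp add: quaternionic_structure_def)
  have m: "K 1 (K 2 u) = K 3 u" "K 2 (K 1 u) = - K 3 u" if "u \<in> S" for u
    using qs that by (simp_all add: quaternionic_structure_def)
  show "K 1 (K 2 v) = K 3 v" "K 2 (K 1 v) = - K 3 v" using m v by auto
  have sq': "K i (K i u) = - u" if "u \<in> S" for i u using qs that by (simp add: quaternionic_structure_def)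
  show "K 1 (K 3 v) = - K 2 v"
    using m(1)[OF v] sq'[of "K 2 v" 1] v by simp
  show "K 3 (K 1 v) = K 2 v"
    using m(2)[of "K 1 v"] sq[of 1] v by simp
  show "K 2 (K 3 v) = K 1 v"
    using arg_cong[OF m(2)[OF v], of "K 2"] sq'[of "K 1 v" 2] v by simp
  show "K 3 (K 2 v) = - K 1 v"
    using m(1)[of "K 2 v"] sq[of 2] v by simp
qed

text \<open>The action of the imaginary quaternion with coordinates \<open>a\<close>.\<close>

definition im :: "(3 \<Rightarrow> real) \<Rightarrow> 't \<Rightarrow> 't" where
  "im a v = (\<Sum>j\<in>UNIV. a j *\<^sub>R K j v)"

lemma im_3: "im a v = a 1 *\<^sub>R K 1 v + a 2 *\<^sub>R K 2 v + a 3 *\<^sub>R K 3 v"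
  by (simp add: im_def sum_3)

lemma im_in [simp, intro]: "v \<in> S \<Longrightarrow> im a v \<in> S"
  by (simp add: im_3)

lemma im_linear [simp]:
  assumes "u \<in> S"
  shows "v \<in> S \<Longrightarrow> im a (u + v) = im a u + im a v" "im a (c *\<^sub>R u) = c *\<^sub>R im a u"
    "im a (- u) = - im a u"
  using assms by (simp_all add: im_3 algebra_simps)

text \<open>Quaternion multiplication: the real part is minus the scalar product, the imaginary part
  the cross product of \<open>a\<close> and \<open>b\<close>.\<close>

lemma im_im:
  assumes "v \<in> S"
  shows "im a (im b v) = - (a 1 * b 1 + a 2 * b 2 + a 3 * b 3) *\<^sub>R v
    + (a 2 * b 3 - a 3 * b 2) *\<^sub>R K 1 v + (a 3 * b 1 - a 1 * b 3) *\<^sub>R K 2 v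
    + (a 1 * b 2 - a 2 * b 1) *\<^sub>R K 3 v"
  using assms by (simp add: im_3 sum_3 algebra_simps)

lemma im_im_ex: "\<exists>s c. \<forall>v\<in>S. im a (im b v) = s *\<^sub>R v + im c v"
proof -
  let ?c = "\<lambda>i::3. if i = 1 then a 2 * b 3 - a 3 * b 2 else
      if i = 2 then a 3 * b 1 - a 1 * b 3 else a 1 * b 2 - a 2 * b 1"
  have "\<forall>v\<in>S. im a (im b v) = (- (a 1 * b 1 + a 2 * b 2 + a 3 * b 3)) *\<^sub>R v + im ?c v"
    by (simp add: im_im) (simp add: im_3)
  then show ?thesis by blast
qed

text \<open>Multiplying by the conjugate of the quaternion with real part \<open>s\<close> and
  imaginary part \<open>c\<close> yields its squared norm times \<open>Z\<close>.\<close>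

lemma independent:
  assumes Z: "Z \<in> S" "Z \<noteq> 0" and eq: "s *\<^sub>R Z + im c Z = 0"
  shows "s = 0 \<and> (\<forall>i. c i = 0)"
proof -
  have "0 = s *\<^sub>R (s *\<^sub>R Z + im c Z) - im c (s *\<^sub>R Z + im c Z)"
    unfolding eq using Z(1) by (simp add: im_3)
  also have "\<dots> = s\<^sup>2 *\<^sub>R Z - im c (im c Z)"
    using Z(1) by (simp add: power2_eq_square algebra_simps)
  also have "\<dots> = (s\<^sup>2 + (c 1)\<^sup>2 + (c 2)\<^sup>2 + (c 3)\<^sup>2) *\<^sub>R Z"
    using Z(1) by (simp add: im_im sum_3 power2_eq_square algebra_simps)
  finally have "s\<^sup>2 + (c 1)\<^sup>2 + (c 2)\<^sup>2 + (c 3)\<^sup>2 = 0" using Z(2) by simp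
  then have "s = 0 \<and> c 1 = 0 \<and> c 2 = 0 \<and> c 3 = 0"
    by (simp add: add_nonneg_eq_0_iff)
  then show ?thesis by (simp add: forall_3)
qed

end

text \<open>Membership in SO(3), in the form that mirrors \<open>I 1 (I 2 v) = I 3 v\<close>: rows
  of norm 1, the first two orthogonal, the third their cross product.\<close>

definition so3 :: "(3 \<Rightarrow> 3 \<Rightarrow> real) \<Rightarrow> bool" where
  "so3 A \<longleftrightarrow> (\<forall>i. (A i 1 * A i 1 + A i 2 * A i 2 + A i 3 * A i 3) = 1) \<and> (A 1 1 * A 2 1 + A 1 2 * A 2 2 + A 1 3 * A 2 3) = 0 \<and>
     A 3 1 = A 1 2 * A 2 3 - A 1 3 * A 2 2 \<and> A 3 2 = A 1 3 * A 2 1 - A 1 1 * A 2 3 \<and>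
     A 3 3 = A 1 1 * A 2 2 - A 1 2 * A 2 1"

lemma so3_quaternionic_structure:
  assumes "subspace S" "quaternionic_structure S K" "so3 A"
  shows "quaternionic_structure S (\<lambda>i v. \<Sum>j\<in>UNIV. A i j *\<^sub>R K j v)"
proof -
  interpret quaternionic S K using assms by unfold_locales
  have d: "A 1 1 * A 2 1 + A 1 2 * A 2 2 + A 1 3 * A 2 3 = 0"
      "A 2 1 * A 1 1 + A 2 2 * A 1 2 + A 2 3 * A 1 3 = 0"
      "A 1 2 * A 2 3 - A 1 3 * A 2 2 = A 3 1" "A 1 3 * A 2 1 - A 1 1 * A 2 3 = A 3 2"
      "A 1 1 * A 2 2 - A 1 2 * A 2 1 = A 3 3" "A 2 2 * A 1 3 - A 2 3 * A 1 2 = - A 3 1"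
      "A 2 3 * A 1 1 - A 2 1 * A 1 3 = - A 3 2" "A 2 1 * A 1 2 - A 2 2 * A 1 1 = - A 3 3"
    using assms(3) by (simp_all add: so3_def algebra_simps)
  have "im (A 1) (im (A 2) v) = im (A 3) v" "im (A 2) (im (A 1) v) = - im (A 3) v"
    if "v \<in> S" for v
    unfolding im_im[OF that] d by (simp_all add: im_3)
  moreover have "im (A i) (im (A i) v) = - v" if "v \<in> S" for i v
    using assms(3) that by (simp add: im_im so3_def)
  ultimately show ?thesis
    unfolding im_def[symmetric] quaternionic_structure_def by auto
qed

text \<open>By \<open>independent\<close>, coefficients can be compared at the single vector
  \<open>Z\<close>; the relations \<open>I i (I i Z) = - Z\<close> and
  \<open>I 1 (I 2 Z) = I 3 Z\<close> then become the equations of \<open>so3\<close>.\<close>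

lemma quaternionic_structure_so3:
  assumes S: "subspace S" and K: "quaternionic_structure S K" and I: "quaternionic_structure S I"
    and Z: "Z \<in> S" "Z \<noteq> 0" and A: "\<And>i v. v \<in> S \<Longrightarrow> I i v = (\<Sum>j\<in>UNIV. A i j *\<^sub>R K j v)"
  shows "so3 A"
proof -
  interpret K: quaternionic S K using S K by unfold_locales
  interpret I: quaternionic S I using S I by unfold_locales
  have A: "I i v = K.im (A i) v" if "v \<in> S" for i v using A that by (simp add: K.im_def)
  have "(1 - (A i 1 * A i 1 + A i 2 * A i 2 + A i 3 * A i 3)) *\<^sub>R Z + K.im (\<lambda>_. 0) Z = 0" for i
    using I.mult(1)[OF Z(1), of i] Z(1) by (simp add: A K.im_im K.im_3 algebra_simps)
  from K.independent[OF Z this] have 1: "(A i 1 * A i 1 + A i 2 * A i 2 + A i 3 * A i 3) = 1" for i by simp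
  let ?c = "\<lambda>i::3. if i = 1 then A 1 2 * A 2 3 - A 1 3 * A 2 2 - A 3 1 else
      if i = 2 then A 1 3 * A 2 1 - A 1 1 * A 2 3 - A 3 2 else A 1 1 * A 2 2 - A 1 2 * A 2 1 - A 3 3"
  have "(- (A 1 1 * A 2 1 + A 1 2 * A 2 2 + A 1 3 * A 2 3)) *\<^sub>R Z + K.im ?c Z = 0"
    using I.mult(2)[OF Z(1)] Z(1) by (simp add: A K.im_im) (simp add: K.im_3 algebra_simps)
  from K.independent[OF Z this] have 2: "(A 1 1 * A 2 1 + A 1 2 * A 2 2 + A 1 3 * A 2 3) = 0" and 3: "\<forall>i. ?c i = 0" by auto
  from 1 2 3[rule_format, of 1] 3[rule_format, of 2] 3[rule_format, of 3] show ?thesis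
    by (simp add: so3_def)
qed

section \<open>Rigidity of quaternionic structures with an inner product\<close>

locale quaternionic_inner = quaternionic S K + inner_product S g for S :: "'t::real_vector set" and K g +
  assumes skew: "u \<in> S \<Longrightarrow> v \<in> S \<Longrightarrow> g (K i u) v = - g u (K i v)"
begin

lemma im_skew: "u \<in> S \<Longrightarrow> v \<in> S \<Longrightarrow> g (im a u) v = - g u (im a v)"
  by (simp add: im_3 skew)

text \<open>With \<open>e\<^sub>0 = Z\<close> and \<open>e\<^sub>j = K\<^sub>j Z\<close>, evaluating the hypothesis on
  pairs of these vectors gives linear equations for the entries of \<open>C\<close> and the numbers
  \<open>h e\<^sub>p e\<^sub>q\<close>.\<close>

lemma hermitian_defect_scalar:
  assumes h: "sym_bilinear_on S h" and Z: "Z \<in> S" "Z \<noteq> 0"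
    and C: "\<And>j u v. u \<in> S \<Longrightarrow> v \<in> S \<Longrightarrow> h (K j u) v - h u (K j v) = g (im (C j) u) v"
  shows "\<exists>s. \<forall>j k. C j k = (if j = k then s else 0)"
proof -
  interpret h: sym_bilinear S h using S h by unfold_locales
  define n where "n = g Z Z"
  have n: "n > 0" using pos Z by (simp add: n_def)
  then have n0: "n \<noteq> 0" by simp
  have z: "g (K i v) v = 0" if "v \<in> S" for i v
    using skew[of v v i] sym[of v "K i v"] that by simp
  have gt: "g (K i Z) Z = 0" "g Z (K i Z) = 0" "g (K i Z) (K i Z) = n" for i
    using z[OF Z(1)] skew[of Z Z i] skew[of Z "K i Z" i] Z(1) by (simp_all add: n_def)
  have gt2: "g (K 1 Z) (K 2 Z) = 0" "g (K 2 Z) (K 1 Z) = 0" "g (K 1 Z) (K 3 Z) = 0"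
    "g (K 3 Z) (K 1 Z) = 0" "g (K 2 Z) (K 3 Z) = 0" "g (K 3 Z) (K 2 Z) = 0"
    using skew[of Z "K 2 Z" 1] skew[of Z "K 1 Z" 2] skew[of Z "K 3 Z" 1] skew[of Z "K 1 Z" 3]
      skew[of Z "K 3 Z" 2] skew[of Z "K 2 Z" 3] Z(1) by (simp_all add: gt)
  note C = C[unfolded im_3]
  have hs: "h (K i Z) Z = h Z (K i Z)" "h (K 2 Z) (K 1 Z) = h (K 1 Z) (K 2 Z)"
    "h (K 3 Z) (K 1 Z) = h (K 1 Z) (K 3 Z)" "h (K 3 Z) (K 2 Z) = h (K 2 Z) (K 3 Z)" for i
    using h.sym Z(1) by auto
  have c0: "c = 0" if "a - b = c * n" "b - a = c * n" for a b c
  proof -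
    have "2 * (c * n) = 0" using that by linarith
    then show ?thesis using n by simp
  qed
  \<comment> \<open>Each off-diagonal entry occurs in two equations whose left-hand sides agree up
    to a sign that contradicts the sign of the entry.\<close>
  have "C 1 2 = 0"
    using C[of Z "K 2 Z" 1] C[of "K 3 Z" "K 1 Z" 1] Z(1) by (simp add: gt gt2 hs) (erule (1) c0 | simp add: n0)
  moreover have "C 1 3 = 0"
    using C[of Z "K 3 Z" 1] C[of "K 2 Z" "K 1 Z" 1] Z(1) by (simp add: gt gt2 hs) (erule (1) c0 | simp add: n0)
  moreover have "C 2 1 = 0"
    using C[of Z "K 1 Z" 2] C[of "K 3 Z" "K 2 Z" 2] Z(1) by (simp add: gt gt2 hs) (erule (1) c0 | simp add: n0)
  moreover have "C 2 3 = 0"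
    using C[of Z "K 3 Z" 2] C[of "K 1 Z" "K 2 Z" 2] Z(1) by (simp add: gt gt2 hs) (erule (1) c0 | simp add: n0)
  moreover have "C 3 1 = 0"
    using C[of Z "K 1 Z" 3] C[of "K 2 Z" "K 3 Z" 3] Z(1) by (simp add: gt gt2 hs) (erule (1) c0 | simp add: n0)
  moreover have "C 3 2 = 0"
    using C[of Z "K 2 Z" 3] C[of "K 1 Z" "K 3 Z" 3] Z(1) by (simp add: gt gt2 hs) (erule (1) c0 | simp add: n0)
  moreover have "n * C 1 1 = h (K 1 Z) (K 1 Z) + h Z Z" "n * C 2 2 = h (K 2 Z) (K 2 Z) + h Z Z"
    "n * C 3 3 = h (K 3 Z) (K 3 Z) + h Z Z" "n * C 1 1 = h (K 3 Z) (K 3 Z) + h (K 2 Z) (K 2 Z)"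
    "n * C 2 2 = h (K 3 Z) (K 3 Z) + h (K 1 Z) (K 1 Z)"
    "n * C 3 3 = h (K 2 Z) (K 2 Z) + h (K 1 Z) (K 1 Z)"
    using C[of Z "K 1 Z" 1] C[of Z "K 2 Z" 2] C[of Z "K 3 Z" 3] C[of "K 2 Z" "K 3 Z" 1]
      C[of "K 3 Z" "K 1 Z" 2] C[of "K 1 Z" "K 2 Z" 3] Z(1) by (simp_all add: gt gt2 hs algebra_simps)
  \<comment> \<open>Each diagonal entry is given by two complementary pairs among the four values
    \<open>h e e\<close>, with \<open>e\<close> one of \<open>Z\<close>, \<open>K 1 Z\<close>,
    \<open>K 2 Z\<close>, \<open>K 3 Z\<close>. The difference of two entries is thus equal to a
    number and to its negative.\<close>
  then have "n * C 1 1 = n * C 2 2" "n * C 1 1 = n * C 3 3" by linarith+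
  then have "C 1 1 = C 2 2" "C 1 1 = C 3 3" using n by simp_all
  ultimately have "\<forall>j k. C j k = (if j = k then C 1 1 else 0)" by (simp add: forall_3)
  then show ?thesis by blast
qed

text \<open>If \<open>g' = g (G \<cdot>, \<cdot>)\<close>, then \<open>G\<close> is a product of imaginary quaternions in the span
  of the \<open>K\<^sub>j\<close>; being symmetric, it is a scalar.\<close>

lemma conformal_rigidity:
  assumes I: "quaternionic_structure S I" and g': "inner_on S g'" and Z: "Z \<in> S" "Z \<noteq> 0"
    and B: "\<And>i u v. u \<in> S \<Longrightarrow> v \<in> S \<Longrightarrow> g' (I i u) v = g (im (B i) u) v"
  shows "\<exists>\<gamma>. \<gamma> \<noteq> 0 \<and> (\<forall>i. \<forall>v\<in>S. im (B i) v = \<gamma> *\<^sub>R I i v)"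
proof -
  interpret I: quaternionic S I using S I by unfold_locales
  interpret g': inner_product S g' using S g' by unfold_locales (auto simp: inner_on_def)
  have G: "g (im (B i) (I i u)) v = - g' u v" if "u \<in> S" "v \<in> S" for i u v
    using B[of "I i u" v i] that by simp
  have B31: "im (B 3) (I 1 u) = im (B 2) u" if "u \<in> S" for u
    using that B[of "I 1 u" _ 3, symmetric] B[of u _ 2] by (intro eqI) auto
  define n where "n = B 3 1 * B 3 1 + B 3 2 * B 3 2 + B 3 3 * B 3 3"
  have sq: "im (B 3) (im (B 3) u) = - n *\<^sub>R u" if "u \<in> S" for u
    using that by (simp add: im_im n_def)
  have n: "n \<noteq> 0"
  proof
    assume "n = 0"
    then have "B 3 1 = 0 \<and> B 3 2 = 0 \<and> B 3 3 = 0"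
      by (simp add: n_def add_nonneg_eq_0_iff)
    then have "g' (I 3 Z) (I 3 Z) = 0" using B[of Z "I 3 Z" 3] Z(1) by (simp add: im_3)
    moreover have "I 3 Z \<noteq> 0" using I.mult(1)[OF Z(1), of 3] Z(2) by auto
    ultimately show False using g'.pos[of "I 3 Z"] Z(1) by simp
  qed
  \<comment> \<open>From \<open>I 3 (I 1 u) = I 2 u\<close> comes
    \<open>im (B 3) (I 1 u) = im (B 2) u\<close>. The square of \<open>im (B 3)\<close> is the
    nonzero scalar \<open>- n\<close>, so it can be inverted, and \<open>I 1\<close> becomes a
    product of two imaginary quaternions.\<close>
  have I1: "I 1 u = (- 1 / n) *\<^sub>R im (B 3) (im (B 2) u)" if "u \<in> S" for u
    using B31[OF that] sq[of "I 1 u"] n that by simp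
  obtain s c where sc: "\<And>u. u \<in> S \<Longrightarrow> im (B 3) (im (B 2) u) = s *\<^sub>R u + im c u"
    using im_im_ex by meson
  obtain t d where td: "\<And>u. u \<in> S \<Longrightarrow> im (B 1) (im c u) = t *\<^sub>R u + im d u"
    using im_im_ex by meson
  define e where "e = (\<lambda>j. (- 1 / n) * (s * B 1 j + d j))"
  have BI: "im (B 1) (I 1 u) = (- t / n) *\<^sub>R u + im e u" if "u \<in> S" for u
    using that by (simp add: I1 sc td) (simp add: e_def im_3 algebra_simps)
  \<comment> \<open>The map \<open>im (B 1) (I 1 u)\<close> represents \<open>- g'\<close> and is
    symmetric for \<open>g\<close>, whereas \<open>im e\<close> is skew; so the imaginary part
    vanishes.\<close>
  have "g (im e u) v = 0" if "u \<in> S" "v \<in> S" for u v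
  proof -
    have "g (im (B 1) (I 1 u)) v = g (im (B 1) (I 1 v)) u"
      using G that g'.sym by simp
    then have "g (im e u) v = g (im e v) u" using that by (simp add: BI sym[of u v])
    then show ?thesis using im_skew[of u v e] sym[of u "im e v"] that by simp
  qed
  then have "im e u = 0" if "u \<in> S" for u using eq_0I that by auto
  then have G1: "g' u v = (t / n) * g u v" if "u \<in> S" "v \<in> S" for u v
    using G[OF that, of 1] that by (simp add: BI)
  have "t / n \<noteq> 0" using G1[OF Z(1) Z(1)] g'.pos[OF Z] by auto
  moreover have "im (B i) v = (t / n) *\<^sub>R I i v" if "v \<in> S" for i v
    using that B[of v _ i, symmetric] G1[of "I i v"] by (intro eqI) auto
  ultimately show ?thesis by blast
qed

end

text \<open>\<open>k = h - g / 2\<close> satisfies \<open>k (I\<^sub>j u) v = k u (I\<^sub>j v)\<close>, which forces \<open>k = 0\<close> because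
  \<open>I\<^sub>3 = I\<^sub>1 I\<^sub>2 = - I\<^sub>2 I\<^sub>1\<close>.\<close>

lemma hermitian_part_eq:
  assumes S: "subspace S" and I: "quaternionic_structure S I"
    and h: "sym_bilinear_on S h" and g: "sym_bilinear_on S g"
    and skew: "\<And>i u v. u \<in> S \<Longrightarrow> v \<in> S \<Longrightarrow> g (I i u) v = - g u (I i v)"
    and eq: "\<And>j u v. u \<in> S \<Longrightarrow> v \<in> S \<Longrightarrow> h (I j u) v - h u (I j v) = g (I j u) v"
    and uv: "u \<in> S" "v \<in> S"
  shows "g u v = 2 * h u v"
proof -
  interpret I: quaternionic S I using S I by unfold_locales
  interpret h: sym_bilinear S h using S h by unfold_locales
  interpret g: sym_bilinear S g using S g by unfold_locales
  define k where "k u v = h u v - g u v / 2" for u v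
  have k: "k (I j u) v = k u (I j v)" if "u \<in> S" "v \<in> S" for j u v
    using eq[OF that, of j] skew[OF that, of j] by (simp add: k_def)
  have k3: "k a (I 3 b) = 0" if "a \<in> S" "b \<in> S" for a b
  proof -
    have "k (I 3 a) b = k (I 1 (I 2 a)) b" using that by simp
    also have "\<dots> = k a (I 2 (I 1 b))" using k that I.K_in by metis
    also have "\<dots> = - k a (I 3 b)" using that by (simp add: k_def)
    finally show ?thesis using k[OF that, of 3] by simp
  qed
  have "k u (I 3 (I 3 v)) = 0" using k3[of u "I 3 v"] uv by simp
  then show ?thesis using uv by (simp add: k_def)
qed

subsection \<open>The vertical torsion\<close>

text \<open>As \<open>g\<close> is only given on \<open>H\<close>, it is extended by means of the
  projection \<open>\<pi>\<close> along the \<open>w i\<close> and the squares of the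
  \<open>\<eta> i\<close> to a positive definite form \<open>G\<close> on the whole space. The
  endomorphism \<open>L\<close> that represents \<open>G\<close> is injective and therefore
  surjective.\<close>

lemma riesz_on_kernel:
  fixes \<eta> :: "'n::finite \<Rightarrow> 't::euclidean_space \<Rightarrow> real"
  assumes lin: "\<And>i. linear (\<eta> i)" and dual: "\<And>j k. \<eta> j (w k) = (if j = k then 1 else 0)"
    and H: "H = {v. \<forall>i. \<eta> i v = 0}" and g: "inner_on H g" and \<phi>: "linear \<phi>"
  shows "\<exists>c\<in>H. \<forall>X\<in>H. g c X = \<phi> X"
proof -
  have S: "subspace H"
    unfolding H by (auto simp: subspace_def linear_add[OF lin] linear_cmul[OF lin] linear_0[OF lin])
  interpret inner_product H g using S g by unfold_locales (auto simp: inner_on_def)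
  define \<pi> where "\<pi> v = v - (\<Sum>i\<in>UNIV. \<eta> i v *\<^sub>R w i)" for v
  have \<pi>H: "\<pi> v \<in> H" for v
    by (simp add: H \<pi>_def linear_diff[OF lin] linear_sum[OF lin] linear_cmul[OF lin] dual if_distrib cong: if_cong)
  have \<pi>: "linear \<pi>"
    by (rule linearI) (simp_all add: \<pi>_def linear_add[OF lin] linear_cmul[OF lin] scaleR_add_left
      sum.distrib scaleR_sum_right algebra_simps)
  have \<pi>id: "\<pi> v = v" if "v \<in> H" for v using that by (simp add: H \<pi>_def)
  define G where "G u v = g (\<pi> u) (\<pi> v) + (\<Sum>i\<in>UNIV. \<eta> i u * \<eta> i v)" for u v
  have G1: "linear (\<lambda>u. G u v)" for v
    by (rule linearI) (simp_all add: G_def linear_add[OF \<pi>] linear_cmul[OF \<pi>] \<pi>H linear_add[OF lin]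
      linear_cmul[OF lin] sum.distrib sum_distrib_left algebra_simps)
  have Gs: "G u v = G v u" for u v
    by (simp add: G_def sym[OF \<pi>H \<pi>H] mult.commute)
  have G2: "linear (G u)" for u using G1[of u] Gs by presburger
  have Gpos: "u = 0" if "G u u = 0" for u
  proof -
    have "g (\<pi> u) (\<pi> u) \<ge> 0" using pos[OF \<pi>H, of u] \<pi>H[of u] by (cases "\<pi> u = 0") auto
    moreover have "(\<Sum>i\<in>UNIV. \<eta> i u * \<eta> i u) \<ge> 0" by (simp add: sum_nonneg)
    ultimately have 1: "g (\<pi> u) (\<pi> u) = 0" and "(\<Sum>i\<in>UNIV. \<eta> i u * \<eta> i u) = 0"
      using that unfolding G_def by linarith+
    then have "\<eta> i u = 0" for i by (simp add: sum_nonneg_eq_0_iff)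
    then have "\<pi> u = u" by (simp add: \<pi>_def)
    with 1 pos[OF \<pi>H, of u] show ?thesis by (cases "u = 0") auto
  qed
  define L where "L c = (\<Sum>b\<in>Basis. G c b *\<^sub>R b)" for c
  have Lb: "L c \<bullet> b = G c b" if "b \<in> Basis" for c b
    using that by (simp add: L_def inner_sum_left inner_Basis if_distrib cong: if_cong)
  have L: "linear L"
    by (rule linearI) (simp_all add: L_def linear_add[OF G1] linear_cmul[OF G1] scaleR_add_left
      sum.distrib scaleR_sum_right)
  have ext: "\<psi> v = \<psi>' v" if "linear \<psi>" "linear \<psi>'" "\<And>b. b \<in> Basis \<Longrightarrow> \<psi> b = \<psi>' b"
    for \<psi> \<psi>' :: "'t \<Rightarrow> real" and v
    using linear_eq_stdbasis[OF that(1,2)] that(3) by metis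
  have "c = 0" if "L c = 0" for c
  proof (rule Gpos)
    have "G c b = 0" if "b \<in> Basis" for b using Lb[OF that, of c] \<open>L c = 0\<close> by simp
    then show "G c c = 0" using ext[OF G2 linear_zero, of c c] by simp
  qed
  then have "inj L" by (simp add: linear_injective_0[OF L])
  then have "surj L" by (rule linear_injective_imp_surjective[OF L]) simp
  then obtain c where c: "L c = (\<Sum>b\<in>Basis. \<phi> (\<pi> b) *\<^sub>R b)" by (metis surjD)
  have "linear (\<lambda>v. \<phi> (\<pi> v))" using linear_compose[OF \<pi> \<phi>] by (simp add: o_def)
  moreover have "G c b = \<phi> (\<pi> b)" if "b \<in> Basis" for b
    using that by (simp add: Lb[OF that, symmetric] c inner_sum_left inner_Basis if_distrib cong: if_cong)
  ultimately have Gc: "G c v = \<phi> (\<pi> v)" for v using ext[OF G2] by blast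
  have "g (\<pi> c) X = \<phi> X" if X: "X \<in> H" for X
  proof -
    have "\<eta> i X = 0" for i using X by (simp add: H)
    then show ?thesis using Gc[of X] by (simp add: G_def \<pi>id[OF X])
  qed
  then show ?thesis using \<pi>H by blast
qed

text \<open>The vectors \<open>r i\<close> below are the fields \<open>- J\<^sub>i \<nu>\<close> for a suitable normal \<open>\<nu>\<close>. The symmetric part
  of the torsion of the complement they span is removed by correcting them inside \<open>H\<close>: the
  terms \<open>c i\<close> represent the mixed part of the second fundamental form, and \<open>E\<close> represents
  the normal connection form.\<close>

lemma torsion_free_frame_exists:
  fixes \<eta> :: "3 \<Rightarrow> 't::euclidean_space \<Rightarrow> real" and P :: "'t \<Rightarrow> 'e::euclidean_space"
  assumes \<eta>lin: "\<And>i. linear (\<eta> i)" and dual: "\<And>j k. \<eta> j (w k) = (if j = k then 1 else 0)"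
    and H: "H = {v. \<forall>i. \<eta> i v = 0}" and g: "inner_on H g"
    and P: "linear P" and \<theta>: "linear \<theta>" and ker: "\<And>z. \<theta> z = 0 \<longleftrightarrow> z \<in> range P"
    and J: "quaternionic_structure UNIV J" and I: "quaternionic_structure H I"
    and IJ: "\<And>i X. X \<in> H \<Longrightarrow> P (I i X) = J i (P X)" and \<eta>J: "\<And>i v. \<eta> i v = \<theta> (J i (P v))"
    and \<tau>1: "\<And>z. linear (\<lambda>u. \<tau> u z)" and \<tau>2: "\<And>u. linear (\<tau> u)"
    and \<tau>sym: "\<And>u v. \<tau> u (P v) = \<tau> v (P u)"
    and a: "\<And>i j u. u \<in> H \<Longrightarrow> a i j u + a j i u = 0"
    and D: "\<And>j u v. D j u v = \<tau> u (J j (P v)) - \<tau> v (J j (P u))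
        + (\<Sum>k\<in>UNIV. a j k u * \<eta> k v) - (\<Sum>k\<in>UNIV. a j k v * \<eta> k u)"
    and gD: "\<And>j X Y. X \<in> H \<Longrightarrow> Y \<in> H \<Longrightarrow> D j X Y = g (I j X) Y"
  shows "\<exists>R. (\<forall>i j. \<eta> j (R i) = (if i = j then 1 else 0)) \<and>
    (\<forall>i j. \<forall>X\<in>H. D j (R i) X + D i (R j) X = 0)"
proof -
  have S: "subspace H"
    unfolding H by (auto simp: subspace_def linear_add[OF \<eta>lin] linear_cmul[OF \<eta>lin] linear_0[OF \<eta>lin])
  interpret I: quaternionic H I using S I by unfold_locales
  interpret J: quaternionic UNIV J using J by unfold_locales auto
  interpret g: inner_product H g using S g by unfold_locales (auto simp: inner_on_def)
  have \<eta>H: "\<eta> i X = 0" if "X \<in> H" for i X using that by (simp add: H)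
  note \<tau>l = linear_add[OF \<tau>2] linear_diff[OF \<tau>2] linear_neg[OF \<tau>2] linear_cmul[OF \<tau>2] linear_0[OF \<tau>2]
    linear_add[OF \<tau>1] linear_diff[OF \<tau>1] linear_neg[OF \<tau>1] linear_cmul[OF \<tau>1] linear_0[OF \<tau>1]
  note Pl = linear_add[OF P] linear_diff[OF P] linear_neg[OF P] linear_cmul[OF P]
  note \<theta>l = linear_add[OF \<theta>] linear_diff[OF \<theta>] linear_neg[OF \<theta>] linear_cmul[OF \<theta>]
  \<comment> \<open>The sign is such that the formula for \<open>D\<close> reads
    \<open>h (I j u) v - h u (I j v) = g (I j u) v\<close> on \<open>H\<close>.\<close>
  define h where "h u v = - \<tau> u (P v)" for u v
  have hsym: "h u v = h v u" for u v by (simp add: h_def \<tau>sym[of u])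
  have hl: "h (u + u') v = h u v + h u' v" "h (u - u') v = h u v - h u' v" "h (c *\<^sub>R u) v = c * h u v"
      "h (- u) v = - h u v" "h v (u + u') = h v u + h v u'" "h v (u - u') = h v u - h v u'"
      "h v (c *\<^sub>R u) = c * h v u" "h v (- u) = - h v u" for u u' v c
    by (simp_all add: h_def \<tau>l Pl)
  have skew: "g (I i u) v = - g u (I i v)" if "u \<in> H" "v \<in> H" for i u v
    using gD[OF that, of i] gD[OF that(2,1), of i] g.sym[of "I i v" u] that by (simp add: D)
  have gh: "g X Y = 2 * h X Y" if "X \<in> H" "Y \<in> H" for X Y
  proof (rule hermitian_part_eq[where S = H and I = I and g = g and h = h])
    show "sym_bilinear_on H h" unfolding sym_bilinear_on_def by (intro conjI ballI allI) (rule hsym, simp add: hl)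
    show "sym_bilinear_on H g" using g by (simp add: inner_on_def)
    show "g (I i u) v = - g u (I i v)" if "u \<in> H" "v \<in> H" for i u v using skew that .
    show "h (I j u) v - h u (I j v) = g (I j u) v" if "u \<in> H" "v \<in> H" for j u v
      using gD[OF that, of j] that \<eta>H by (simp add: D IJ[symmetric] h_def \<tau>sym[of "I j u"])
  qed (use S I that in auto)
  have hI: "h (I i X) Y = - h X (I i Y)" if "X \<in> H" "Y \<in> H" for i X Y
    using skew[OF that, of i] that by (simp add: gh)
  \<comment> \<open>A normal for which all \<open>J i \<nu>\<close> are tangent:
    \<open>\<theta> \<nu>\<close> is \<open>\<eta> 1 (w 1) = 1\<close>, \<open>J 1 \<nu>\<close> is
    \<open>- P (w 1)\<close>, and on \<open>J 2 \<nu>\<close> and \<open>J 3 \<nu>\<close> the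
    conormal has the values \<open>- \<eta> 3 (w 1)\<close> and \<open>\<eta> 2 (w 1)\<close>, both
    0.\<close>
  define \<nu> where "\<nu> = J 1 (P (w 1))"
  have \<theta>P: "\<theta> (P v) = 0" for v using ker by blast
  have \<nu>: "\<theta> \<nu> = 1" "\<theta> (J i \<nu>) = 0" for i
  proof -
    show "\<theta> \<nu> = 1" using \<eta>J[of 1 "w 1"] dual[of 1 1] by (simp add: \<nu>_def)
    have "\<forall>i. \<theta> (J i \<nu>) = 0"
      using \<eta>J[of 2 "w 1"] \<eta>J[of 3 "w 1"] dual[of 2 1] dual[of 3 1]
      by (simp add: \<nu>_def forall_3 \<theta>l \<theta>P)
    then show "\<theta> (J i \<nu>) = 0" for i by blast
  qed
  have "\<exists>r. P r = - J i \<nu>" for i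
    using ker[of "- J i \<nu>"] \<nu>(2)[of i] by (auto simp: \<theta>l)
  then obtain r where r: "\<And>i. P (r i) = - J i \<nu>" by metis
  have Jij: "\<theta> (J j (J i \<nu>)) = (if i = j then -1 else 0)" for i j
  proof -
    have "\<forall>i j. \<theta> (J j (J i \<nu>)) = (if i = j then -1 else 0)" by (simp add: forall_3 \<nu> \<theta>l)
    then show ?thesis by blast
  qed
  have \<eta>r: "\<eta> j (r i) = (if i = j then 1 else 0)" for i j
    by (simp add: \<eta>J r Jij \<theta>l)
  \<comment> \<open>The factor 2 compensates \<open>g = 2 h\<close>: with respect to
    \<open>h\<close>, the vector \<open>c i\<close> represents \<open>h (r i)\<close> on
    \<open>H\<close>.\<close>
  have "\<exists>c\<in>H. \<forall>X\<in>H. g c X = 2 * h (r i) X" for i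
  proof (rule riesz_on_kernel[OF \<eta>lin dual H g])
    show "linear (\<lambda>X. 2 * h (r i) X)" by (rule linearI) (simp_all add: hl)
  qed
  then obtain c where c: "\<And>i. c i \<in> H" "\<And>i X. X \<in> H \<Longrightarrow> h (c i) X = h (r i) X"
    using gh by (metis mult_left_cancel zero_neq_numeral)
  have "\<exists>E\<in>H. \<forall>X\<in>H. g E X = 2 * \<tau> X \<nu>"
  proof (rule riesz_on_kernel[OF \<eta>lin dual H g])
    show "linear (\<lambda>X. 2 * \<tau> X \<nu>)" by (rule linearI) (simp_all add: \<tau>l)
  qed
  then obtain E where E: "E \<in> H" "\<And>X. X \<in> H \<Longrightarrow> h E X = \<tau> X \<nu>"
    using gh by (metis mult_left_cancel zero_neq_numeral)
  \<comment> \<open>The symmetrised forms contain \<open>V i\<close> only in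
    \<open>c i + 2 V i\<close>, which this choice makes \<open>- I i E\<close>. Symmetrising
    \<open>- I j (I i E)\<close> gives \<open>2 E\<close> for \<open>i = j\<close> and 0 otherwise;
    the term with \<open>\<tau> X\<close> and \<open>\<nu>\<close> has the same pattern with the
    opposite sign, and \<open>E\<close> is chosen to match it.\<close>
  define V where "V i = - (1/2) *\<^sub>R c i - (1/2) *\<^sub>R I i E" for i
  have V: "V i \<in> H" for i using c(1) E(1) by (simp add: V_def)
  define R where "R i = r i + V i" for i
  have \<eta>R: "\<eta> j (R i) = (if i = j then 1 else 0)" for i j
    by (simp add: R_def linear_add[OF \<eta>lin] \<eta>r \<eta>H[OF V])
  have alpha: "D j (R i) X = - h (r i) (I j X) + 2 * h (I j (V i)) X + \<tau> X (J j (J i \<nu>)) - a j i X"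
    if X: "X \<in> H" for i j X
  proof -
    have "D j (R i) X = \<tau> (R i) (J j (P X)) - \<tau> X (J j (P (R i))) - (\<Sum>k\<in>UNIV. a j k X * \<eta> k (R i))"
      using X by (simp add: D \<eta>H)
    also have "(\<Sum>k\<in>UNIV. a j k X * \<eta> k (R i)) = a j i X"
      by (simp add: \<eta>R if_distrib cong: if_cong)
    also have "\<tau> (R i) (J j (P X)) = - h (r i) (I j X) + h (I j (V i)) X"
      using X V hI[OF V X] by (simp add: IJ[symmetric] R_def hl h_def \<tau>l)
    also have "\<tau> X (J j (P (R i))) = - \<tau> X (J j (J i \<nu>)) - h (I j (V i)) X"
      using IJ[OF V, of j i] hsym[of _ X] by (simp add: R_def Pl r \<tau>l h_def)
    finally show ?thesis by simp
  qed
  have zero: "D j (R i) X + D i (R j) X = 0" if X: "X \<in> H" for i j X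
  proof -
    have c': "h (r i) (I j X) = - h (I j (c i)) X" for i j
      using c X hI[OF c(1) X] by simp
    have cV: "c i + 2 *\<^sub>R V i = - I i E" for i by (simp add: V_def algebra_simps)
    \<comment> \<open>The connection terms \<open>a j i X\<close> and \<open>a i j X\<close> cancel
      by skewness.\<close>
    have "D j (R i) X + D i (R j) X = h (I j (c i + 2 *\<^sub>R V i)) X + h (I i (c j + 2 *\<^sub>R V j)) X
        + \<tau> X (J j (J i \<nu>) + J i (J j \<nu>))"
      using a[OF X, of i j] V c(1) by (simp add: alpha[OF X] c' hl \<tau>l)
    also have "\<dots> = h (I j (- I i E)) X + h (I i (- I j E)) X + \<tau> X (J j (J i \<nu>) + J i (J j \<nu>))"
      by (simp only: cV)
    also have "h (I j (- I i E)) X + h (I i (- I j E)) X = (if i = j then 2 * h E X else 0)"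
    proof -
      have "\<forall>i j. h (I j (- I i E)) X + h (I i (- I j E)) X = (if i = j then 2 * h E X else 0)"
        using E(1) by (simp add: forall_3 hl)
      then show ?thesis by blast
    qed
    also have "\<tau> X (J j (J i \<nu>) + J i (J j \<nu>)) = (if i = j then - 2 * \<tau> X \<nu> else 0)"
    proof -
      have "\<forall>i j. \<tau> X (J j (J i \<nu>) + J i (J j \<nu>)) = (if i = j then - 2 * \<tau> X \<nu> else 0)"
        by (simp add: forall_3 \<tau>l)
      then show ?thesis by blast
    qed
    finally show ?thesis using E(2)[OF X] by simp
  qed
  from \<eta>R zero show ?thesis by blast
qed

text \<open>The two frames differ by vectors \<open>x i\<close> of \<open>H\<close>, on which
  \<open>D\<close> is given by \<open>g\<close>. The trace conditions thus become a homogeneous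
  linear system for the \<open>x i\<close> with quaternionic coefficients, whose only solution is
  0.\<close>

lemma reduced_frame_unique:
  fixes H :: "'t::real_vector set"
  assumes S: "subspace H" and I: "quaternionic_structure H I" and g: "inner_on H g"
    and skew: "\<And>i u v. u \<in> H \<Longrightarrow> v \<in> H \<Longrightarrow> g (I i u) v = - g u (I i v)"
    and D: "\<And>j v. linear (\<lambda>u. D j u v)"
    and gD: "\<And>j X Y. X \<in> H \<Longrightarrow> Y \<in> H \<Longrightarrow> D j X Y = g (I j X) Y"
    and RR': "\<And>i. R' i - R i \<in> H"
    and R: "\<And>i X. X \<in> H \<Longrightarrow> (\<Sum>j\<in>UNIV. D j (R i) (I j X) + D i (R j) (I j X)) = 0"
    and R': "\<And>i X. X \<in> H \<Longrightarrow> (\<Sum>j\<in>UNIV. D j (R' i) (I j X) + D i (R' j) (I j X)) = 0"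
  shows "R' = R"
proof -
  interpret quaternionic_inner H I g
    using S I g skew by unfold_locales (auto simp: inner_on_def)
  define x where "x i = R' i - R i" for i
  have x: "x i \<in> H" for i using RR' by (simp add: x_def)
  have Dx: "D j (R' i) v - D j (R i) v = D j (x i) v" for i j v
    by (simp add: x_def linear_diff[OF D])
  have "(\<Sum>j\<in>UNIV. g (I j (x i)) (I j X) + g (I i (x j)) (I j X)) = 0" if X: "X \<in> H" for i X
  proof -
    have "(\<Sum>j\<in>UNIV. D j (x i) (I j X) + D i (x j) (I j X)) =
        (\<Sum>j\<in>UNIV. D j (R' i) (I j X) + D i (R' j) (I j X)) -
        (\<Sum>j\<in>UNIV. D j (R i) (I j X) + D i (R j) (I j X))"
      by (simp add: Dx[symmetric] sum_subtractf[symmetric] algebra_simps)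
    also have "\<dots> = 0" using R R' X by simp
    finally show ?thesis using gD X x by simp
  qed
  note sum0 = this
  have skew': "g u (I i v) = - g (I i u) v" if "u \<in> H" "v \<in> H" for i u v
    using skew that by simp
  \<comment> \<open>The first summand contributes \<open>g (x i) X\<close> for each of the three
    \<open>j\<close>, the second once more for \<open>j = i\<close>: hence the 4. For the other
    \<open>j\<close> the second contributes \<open>- g (I j (I i (x j))) X\<close>.\<close>
  have "g (4 *\<^sub>R x 1 + I 3 (x 2) - I 2 (x 3)) X = 0" "g (4 *\<^sub>R x 2 - I 3 (x 1) + I 1 (x 3)) X = 0"
    "g (4 *\<^sub>R x 3 + I 2 (x 1) - I 1 (x 2)) X = 0" if X: "X \<in> H" for X
    using sum0[OF X, of 1] sum0[OF X, of 2] sum0[OF X, of 3] X x by (simp_all add: sum_3 skew')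
  note G = this
  have e1: "4 *\<^sub>R x 1 + I 3 (x 2) - I 2 (x 3) = 0"
    by (rule eq_0I[OF _ G(1)]) (simp_all add: x)
  have e2: "4 *\<^sub>R x 2 - I 3 (x 1) + I 1 (x 3) = 0"
    by (rule eq_0I[OF _ G(2)]) (simp_all add: x)
  have e3: "4 *\<^sub>R x 3 + I 2 (x 1) - I 1 (x 2) = 0"
    by (rule eq_0I[OF _ G(3)]) (simp_all add: x)
  \<comment> \<open>In these variables the system is symmetric: \<open>4 y i\<close> is the sum of
    the other two. Differences satisfy \<open>4 v = - v\<close>, so all \<open>y i\<close> agree,
    and then \<open>4 y = 2 y\<close>.\<close>
  define y where "y i = I i (x i)" for i
  have y4: "4 *\<^sub>R y 1 = y 2 + y 3" "4 *\<^sub>R y 2 = y 1 + y 3" "4 *\<^sub>R y 3 = y 1 + y 2"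
    using arg_cong[OF e1, of "I 1"] arg_cong[OF e2, of "I 2"] arg_cong[OF e3, of "I 3"] x
    by (simp_all add: y_def algebra_simps)
  have 0: "v = 0" if "4 *\<^sub>R v = - v" for v :: 't
    using scaleR_add_left[of 4 1 v] that by simp
  have "4 *\<^sub>R (y 2 - y 1) = - (y 2 - y 1)" "4 *\<^sub>R (y 3 - y 1) = - (y 3 - y 1)"
    unfolding scaleR_diff_right y4 by simp_all
  from 0[OF this(1)] 0[OF this(2)] have y: "y 2 = y 1" "y 3 = y 1" by simp_all
  with \<open>4 *\<^sub>R y 1 = y 2 + y 3\<close> have "4 *\<^sub>R y 1 = 2 *\<^sub>R y 1" by (simp add: scaleR_2)
  then have "y 1 = 0" by simp
  with y have "\<forall>i. y i = 0" by (simp add: forall_3)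
  then have "x i = 0" for i using mult(1)[OF x, of i i] by (simp add: y_def)
  then show ?thesis by (simp add: x_def fun_eq_iff)
qed


text \<open>The \<open>w k\<close> are projected into \<open>W\<close> along the kernel; two dual
  frames in \<open>W\<close> differ by vectors of the kernel that lie in \<open>W\<close>, hence by
  0. Since \<open>W\<close> is recovered as the span, uniqueness of a complement reduces to
  uniqueness of its frame.\<close>

lemma complement_dual_basis:
  fixes \<eta> :: "3 \<Rightarrow> 'b \<Rightarrow> 'f::euclidean_space \<Rightarrow>\<^sub>L real"
  assumes W: "complement_of {v. \<forall>i. blinfun_apply (\<eta> i p) v = 0} W"
    and w: "\<And>j k. blinfun_apply (\<eta> j p) (w k) = (if j = k then 1 else 0)"
  shows "dual_basis \<eta> p W i \<in> W"
    "blinfun_apply (\<eta> j p) (dual_basis \<eta> p W i) = (if i = j then 1 else 0)"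
    "W = span (range (dual_basis \<eta> p W))"
    "(\<And>i. R i \<in> W) \<Longrightarrow> (\<And>i j. blinfun_apply (\<eta> j p) (R i) = (if i = j then 1 else 0))
      \<Longrightarrow> dual_basis \<eta> p W = R"
proof -
  let ?H = "{v. \<forall>i. blinfun_apply (\<eta> i p) v = 0}"
  let ?P = "\<lambda>R. \<forall>i. R i \<in> W \<and> (\<forall>j. blinfun_apply (\<eta> j p) (R i) = (if i = j then 1 else 0))"
  have sub: "subspace W" and HW: "\<And>v. v \<in> ?H \<Longrightarrow> v \<in> W \<Longrightarrow> v = 0"
    and dec: "\<And>v. \<exists>s\<in>?H. \<exists>w\<in>W. v = s + w"
    using W by (auto simp: complement_of_def)
  have un: "R = R'" if "?P R" "?P R'" for R R'
  proof
    fix i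
    have "R i - R' i \<in> ?H" using that by (auto simp: blinfun.diff_right)
    moreover have "R i - R' i \<in> W" using that sub by (auto intro: subspace_diff)
    ultimately have "R i - R' i = 0" by (rule HW)
    then show "R i = R' i" by simp
  qed
  have "\<exists>r\<in>W. \<forall>j. blinfun_apply (\<eta> j p) r = (if i = j then 1 else 0)" for i
  proof -
    obtain s r where sr: "s \<in> ?H" "r \<in> W" "w i = s + r" using dec by blast
    have "\<forall>j. blinfun_apply (\<eta> j p) r = (if i = j then 1 else 0)"
    proof
      fix j
      show "blinfun_apply (\<eta> j p) r = (if i = j then 1 else 0)"
        using w[of j i] sr(1) unfolding sr(3) by (auto simp: blinfun.add_right)
    qed
    with sr(2) show ?thesis by blast
  qed
  then obtain R0 where R0: "?P R0" by metis
  have eq: "dual_basis \<eta> p W = R" if "?P R" for R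
    unfolding dual_basis_def by (rule the_equality) (use that un in blast)+
  have P: "?P (dual_basis \<eta> p W)" using R0 eq by metis
  then show "dual_basis \<eta> p W i \<in> W"
    "blinfun_apply (\<eta> j p) (dual_basis \<eta> p W i) = (if i = j then 1 else 0)" by blast+
  show "dual_basis \<eta> p W = R" if "\<And>i. R i \<in> W"
    "\<And>i j. blinfun_apply (\<eta> j p) (R i) = (if i = j then 1 else 0)" using eq that by blast
  let ?R = "dual_basis \<eta> p W"
  have PR: "blinfun_apply (\<eta> j p) (?R i) = (if i = j then 1 else 0)" for i j using P by blast
  have "v \<in> span (range ?R)" if "v \<in> W" for v
  proof -
    let ?v = "\<Sum>i\<in>UNIV. blinfun_apply (\<eta> i p) v *\<^sub>R ?R i"
    have "blinfun_apply (\<eta> j p) ?v = blinfun_apply (\<eta> j p) v" for j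
      by (simp add: PR blinfun.sum_right blinfun.scaleR_right if_distrib cong: if_cong)
    then have "v - ?v \<in> ?H" by (simp add: blinfun.diff_right)
    moreover have "v - ?v \<in> W"
      using that P sub by (intro subspace_diff subspace_sum subspace_scale) auto
    ultimately have "v = ?v" using HW by fastforce
    moreover have "?v \<in> span (range ?R)" by (intro span_sum span_scale span_base) auto
    ultimately show ?thesis by simp
  qed
  moreover have "span (range ?R) \<subseteq> W" using P sub by (intro span_minimal) auto
  ultimately show "W = span (range ?R)" by blast
qed

lemma span_dual_complement:
  fixes \<eta> :: "3 \<Rightarrow> 'b \<Rightarrow> 'f::euclidean_space \<Rightarrow>\<^sub>L real"
  assumes R: "\<And>i j. blinfun_apply (\<eta> j p) (R i) = (if i = j then 1 else 0)"
  shows "complement_of {v. \<forall>i. blinfun_apply (\<eta> i p) v = 0} (span (range R))"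
proof -
  let ?H = "{v. \<forall>i. blinfun_apply (\<eta> i p) v = 0}"
  let ?\<pi> = "\<lambda>v. \<Sum>i\<in>UNIV. blinfun_apply (\<eta> i p) v *\<^sub>R R i"
  have \<pi>: "blinfun_apply (\<eta> j p) (?\<pi> v) = blinfun_apply (\<eta> j p) v" for j v
    by (simp add: blinfun.sum_right blinfun.scaleR_right R if_distrib cong: if_cong)
  have "?\<pi> v = v" if "v \<in> span (range R)" for v
    using that
  proof (induction rule: span_induct_alt)
    case (step c x y)
    then obtain k where x: "x = R k" by blast
    have "?\<pi> (c *\<^sub>R x + y) = c *\<^sub>R ?\<pi> x + ?\<pi> y"
      by (simp add: blinfun.add_right blinfun.scaleR_right scaleR_add_left sum.distrib scaleR_sum_right)
    also have "?\<pi> x = x"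
      by (simp add: x R if_distrib if_distribR cong: if_cong)
    finally show ?case using step by simp
  qed simp
  note \<pi>R = this
  have "v = 0" if "v \<in> ?H" "v \<in> span (range R)" for v
  proof -
    have "?\<pi> v = 0" using that(1) by simp
    with \<pi>R[OF that(2)] show ?thesis by simp
  qed
  moreover have "\<exists>s\<in>?H. \<exists>w\<in>span (range R). v = s + w" for v
  proof (intro bexI)
    show "v - ?\<pi> v \<in> ?H" by (simp add: blinfun.diff_right \<pi>)
    show "?\<pi> v \<in> span (range R)" by (intro span_sum span_scale span_base) auto
  qed simp
  ultimately show ?thesis
    unfolding complement_of_def using span_0 by (auto simp: blinfun.zero_right)
qed

text \<open>The vectors \<open>I i Z\<close> are independent, and so are their tensor products.
  Testing with the inner product against \<open>im a Z\<close> itself detects whether that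
  combination vanishes.\<close>

lemma sum_tensor_eq_0D:
  fixes I :: "3 \<Rightarrow> 't::euclidean_space \<Rightarrow> 't" and c :: "3 \<Rightarrow> 3 \<Rightarrow> real"
  assumes S: "subspace S" and I: "quaternionic_structure S I" and Z: "Z \<in> S" "Z \<noteq> 0"
    and eq: "\<And>l m. (\<Sum>i\<in>UNIV. \<Sum>j\<in>UNIV. c i j * blinfun_apply l (I i Z) * blinfun_apply m (I j Z)) = 0"
  shows "c i j = 0"
proof -
  interpret quaternionic S I using S I by unfold_locales
  have im0: "\<forall>i. a i = 0" if "\<And>l. (\<Sum>i\<in>UNIV. a i * blinfun_apply l (I i Z)) = 0" for a :: "3 \<Rightarrow> real"
  proof -
    have "(\<Sum>i\<in>UNIV. a i * blinfun_apply l (I i Z)) = blinfun_apply l (im a Z)" for l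
      by (simp add: im_def blinfun.sum_right blinfun.scaleR_right)
    then have "blinfun_apply (blinfun_inner_right (im a Z)) (im a Z) = 0" by (metis that)
    then have "0 *\<^sub>R Z + im a Z = 0" by simp
    from independent[OF Z this] show ?thesis by blast
  qed
  have "(\<Sum>i\<in>UNIV. (\<Sum>j\<in>UNIV. c i j * blinfun_apply m (I j Z)) * blinfun_apply l (I i Z)) = 0" for l m
    using eq[of l m] by (simp add: sum_distrib_left mult_ac)
  from im0[OF this] have "(\<Sum>j\<in>UNIV. c i j * blinfun_apply m (I j Z)) = 0" for i m by blast
  from im0[OF this] show ?thesis by blast
qed

text \<open>The span of \<open>R\<close> has torsion 0, which is reduced with coefficients 0. By
  \<open>reduced_frame_unique\<close> every other complement with reduced torsion has the same
  frame, so the description in \<open>torsion_complement\<close> selects this span.\<close>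

lemma vertical_torsion_eq_0:
  fixes M :: "('b, 'f::euclidean_space) smfd" and \<eta> :: "3 \<Rightarrow> 'b \<Rightarrow> 'f \<Rightarrow>\<^sub>L real"
  assumes H: "H p = {v. \<forall>i. blinfun_apply (\<eta> i p) v = 0}" and Z: "Z \<in> H p" "Z \<noteq> 0"
    and I: "quaternionic_structure (H p) (\<lambda>i. I i p)" and g: "inner_on (H p) g"
    and skew: "\<And>i u v. u \<in> H p \<Longrightarrow> v \<in> H p \<Longrightarrow> g (I i p u) v = - g u (I i p v)"
    and lin: "\<And>j v. linear (\<lambda>u. ext_deriv M (\<eta> j) p u v)"
    and gD: "\<And>j u v. u \<in> H p \<Longrightarrow> v \<in> H p \<Longrightarrow> ext_deriv M (\<eta> j) p u v = g (I j p u) v"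
    and R: "\<And>i j. blinfun_apply (\<eta> j p) (R i) = (if i = j then 1 else 0)"
    and R0: "\<And>i j X. X \<in> H p \<Longrightarrow> ext_deriv M (\<eta> j) p (R i) X + ext_deriv M (\<eta> i) p (R j) X = 0"
  shows "tensor_eq_on (H p) (vertical_torsion M H \<eta> I p) (\<lambda>X Y Z l m. 0)"
proof -
  have S: "subspace (H p)"
    unfolding H by (auto simp: subspace_def blinfun.add_right blinfun.scaleR_right blinfun.zero_right)
 interpret q: quaternionic_inner "H p" "\<lambda>i. I i p" g
    using S I g skew by unfold_locales (auto simp: inner_on_def)
  let ?W = "span (range R)"
  have W: "complement_of (H p) ?W" unfolding H by (rule span_dual_complement[where \<eta> = \<eta> and p = p, OF R])
  have w: "blinfun_apply (\<eta> j p) (R k) = (if j = k then 1 else 0)" for j k using R by auto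
  note cd = complement_dual_basis[where \<eta> = \<eta> and p = p and w = R, OF _ w, folded H]
  have dR: "dual_basis \<eta> p ?W = R" by (rule cd(4)[OF W _ R]) (auto intro: span_base)
  have T0: "tensor_eq_on (H p) (torsion_tensor M \<eta> I p ?W) (\<lambda>X Y Z l m. 0)"
    by (simp add: tensor_eq_on_def torsion_tensor_def sum_tensor_def qc_alpha_def dR R0)
  have red: "reduced_tensor (H p) (\<lambda>i. I i p) (torsion_tensor M \<eta> I p ?W)"
    unfolding reduced_tensor_def
    by (rule exI[of _ "\<lambda>i j. 0"]) (use T0 in \<open>auto simp: tensor_eq_on_def sum_tensor_def\<close>)
  have un: "W' = ?W" if W': "complement_of (H p) W'"
    and red': "reduced_tensor (H p) (\<lambda>i. I i p) (torsion_tensor M \<eta> I p W')" for W'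
  proof -
    let ?R' = "dual_basis \<eta> p W'"
    from red' obtain a :: "3 \<Rightarrow> 3 \<Rightarrow> 'f \<Rightarrow>\<^sub>L real" where
      a0: "\<And>i X. X \<in> H p \<Longrightarrow> (\<Sum>j\<in>UNIV. blinfun_apply (a i j) (I j p X)) = 0" and
      at: "tensor_eq_on (H p) (torsion_tensor M \<eta> I p W') (sum_tensor (\<lambda>i. I i p) (\<lambda>i j. blinfun_apply (a i j)))"
      unfolding reduced_tensor_def by blast
    \<comment> \<open>The trace conditions are known for the coefficients of some representation;
      independence of the \<open>I i Z\<close> identifies these on \<open>H\<close> with the
      symmetrised forms.\<close>
    have coeff: "ext_deriv M (\<eta> j) p (?R' i) X + ext_deriv M (\<eta> i) p (?R' j) X = blinfun_apply (a i j) X"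
      if X: "X \<in> H p" for i j X
    proof -
      define c where "c i j = ext_deriv M (\<eta> j) p (?R' i) X + ext_deriv M (\<eta> i) p (?R' j) X
        - blinfun_apply (a i j) X" for i j
      have "(\<Sum>i\<in>UNIV. \<Sum>j\<in>UNIV. c i j * blinfun_apply l (I i p Z) * blinfun_apply m (I j p Z)) = 0" for l m
        using at X Z(1)
        by (auto simp: c_def tensor_eq_on_def torsion_tensor_def sum_tensor_def qc_alpha_def
            left_diff_distrib sum_subtractf)
      then have "c i j = 0" by (rule sum_tensor_eq_0D[OF S I Z])
      then show ?thesis by (simp add: c_def)
    qed
    have "?R' = R"
    proof (rule reduced_frame_unique[OF S I g skew lin gD])
      show "?R' i - R i \<in> H p" for i
        unfolding H using cd(2)[OF W'] R by (simp add: blinfun.diff_right)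
      show "(\<Sum>j\<in>UNIV. ext_deriv M (\<eta> j) p (R i) (I j p X) + ext_deriv M (\<eta> i) p (R j) (I j p X)) = 0"
        if "X \<in> H p" for i X using R0 that by simp
      show "(\<Sum>j\<in>UNIV. ext_deriv M (\<eta> j) p (?R' i) (I j p X) + ext_deriv M (\<eta> i) p (?R' j) (I j p X)) = 0"
        if "X \<in> H p" for i X using that a0 by (simp add: coeff)
    qed auto
    then show ?thesis using cd(3)[OF W'] by simp
  qed
  have "torsion_complement M H \<eta> I p = ?W"
    unfolding torsion_complement_def
  proof (rule the_equality)
    show "complement_of (H p) ?W \<and> reduced_tensor (H p) (\<lambda>i. I i p) (torsion_tensor M \<eta> I p ?W)"
      using W red by (rule conjI)
  qed (elim conjE, rule un)
  with T0 show ?thesis by (simp add: vertical_torsion_def)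
qed

subsection \<open>Charts\<close>

locale smooth_mfd =
  fixes M :: "('a, 'e::euclidean_space) smfd"
  assumes smfd: "smooth_manifold M"
begin

lemma chart_at:
  assumes "p \<in> points M"
  shows "chart_at M p \<in> atlas M" "p \<in> fst (chart_at M p)"
proof -
  have "\<exists>c. c \<in> atlas M \<and> p \<in> fst c" using smfd assms unfolding smooth_manifold_def by blast
  then have "chart_at M p \<in> atlas M \<and> p \<in> fst (chart_at M p)" unfolding chart_at_def by (rule someI_ex)
  then show "chart_at M p \<in> atlas M" "p \<in> fst (chart_at M p)" by auto
qed

lemma chart:
  assumes "c \<in> atlas M"
  shows "mopen M (fst c)" "open (snd c ` fst c)"
    "homeomorphic_map (subtopology (mtop M) (fst c)) (top_of_set (snd c ` fst c)) (snd c)"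
  using smfd assms unfolding smooth_manifold_def by blast+

lemma chart_points: "c \<in> atlas M \<Longrightarrow> p \<in> fst c \<Longrightarrow> p \<in> points M"
  using chart(1) openin_subset by blast

lemma inj_on_chart: "c \<in> atlas M \<Longrightarrow> inj_on (snd c) (fst c)"
proof -
  assume c: "c \<in> atlas M"
  have "topspace (subtopology (mtop M) (fst c)) = fst c"
    using openin_subset[OF chart(1)[OF c]] by (auto simp: topspace_subtopology)
  then show ?thesis using homeomorphic_imp_injective_map[OF chart(3)[OF c]] by simp
qed

lemma cinv_chart [simp]: "c \<in> atlas M \<Longrightarrow> p \<in> fst c \<Longrightarrow> cinv c (snd c p) = p"
  unfolding cinv_def by (rule inv_into_f_f[OF inj_on_chart])

lemma open_chart_image:
  assumes c: "c \<in> atlas M" and V: "mopen M V"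
  shows "open (snd c ` (fst c \<inter> V))"
proof -
  have "openin (subtopology (mtop M) (fst c)) (fst c \<inter> V)"
    using V by (auto simp: openin_subtopology)
  then have "openin (top_of_set (snd c ` fst c)) (snd c ` (fst c \<inter> V))"
    using homeomorphic_imp_open_map[OF chart(3)[OF c]] by (simp add: open_map_def)
  then show ?thesis using chart(2)[OF c] openin_open_eq by blast
qed

lemma eventually_chart:
  assumes c: "c \<in> atlas M" and V: "mopen M V" and p: "p \<in> fst c" "p \<in> V"
  shows "\<forall>\<^sub>F x in nhds (snd c p). x \<in> snd c ` (fst c \<inter> V)"
  using p by (intro eventually_nhds_in_open open_chart_image[OF c V]) auto

lemma smooth_transition:
  "c \<in> atlas M \<Longrightarrow> d \<in> atlas M \<Longrightarrow> smooth_on (snd c ` (fst c \<inter> fst d)) (\<lambda>x. snd d (cinv c x))"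
  using smfd by (simp add: smooth_manifold_def o_def)

lemma trans_has_derivative:
  assumes "c \<in> atlas M" "d \<in> atlas M" "p \<in> fst c" "p \<in> fst d"
  shows "((\<lambda>x. snd d (cinv c x)) has_derivative trans_deriv c d p) (at (snd c p))"
  unfolding trans_deriv_def o_def
  by (rule smooth_on_has_derivative[OF smooth_transition]) (use assms in auto)

lemma linear_trans:
  "c \<in> atlas M \<Longrightarrow> d \<in> atlas M \<Longrightarrow> p \<in> fst c \<Longrightarrow> p \<in> fst d \<Longrightarrow> linear (trans_deriv c d p)"
  using trans_has_derivative has_derivative_linear by blast

lemma trans_self:
  assumes "c \<in> atlas M" "p \<in> fst c"
  shows "trans_deriv c c p v = v"
proof -
  have "((\<lambda>x. x) has_derivative trans_deriv c c p) (at (snd c p))"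
  proof (rule has_derivative_cong_nhds[OF trans_has_derivative[OF assms(1,1,2,2)]])
    show "\<forall>\<^sub>F x in nhds (snd c p). snd c (cinv c x) = x"
      using eventually_chart[OF assms(1) chart(1)[OF assms(1)] assms(2,2)]
      by eventually_elim (use assms in auto)
  qed
  from has_derivative_unique[OF this has_derivative_ident] show ?thesis by (simp add: fun_eq_iff)
qed

lemma trans_trans:
  assumes c: "c \<in> atlas M" "p \<in> fst c" and d: "d \<in> atlas M" "p \<in> fst d" and e: "e \<in> atlas M" "p \<in> fst e"
  shows "trans_deriv d e p (trans_deriv c d p v) = trans_deriv c e p v"
proof -
  have "((\<lambda>x. snd e (cinv d (snd d (cinv c x)))) has_derivative
      (\<lambda>v. trans_deriv d e p (trans_deriv c d p v))) (at (snd c p))"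
    by (rule has_derivative_compose[OF trans_has_derivative[OF c(1) d(1) c(2) d(2)]])
       (use trans_has_derivative[OF d(1) e(1) d(2) e(2)] c in simp)
  moreover have "\<forall>\<^sub>F x in nhds (snd c p). snd e (cinv d (snd d (cinv c x))) = snd e (cinv c x)"
    using eventually_chart[OF c(1) chart(1)[OF d(1)] c(2) d(2)]
    by eventually_elim (use c d in auto)
  ultimately have "((\<lambda>x. snd e (cinv c x)) has_derivative
      (\<lambda>v. trans_deriv d e p (trans_deriv c d p v))) (at (snd c p))"
    by (rule has_derivative_cong_nhds)
  from has_derivative_unique[OF this trans_has_derivative[OF c(1) e(1) c(2) e(2)]]
  show ?thesis by (simp add: fun_eq_iff)
qed

text \<open>The field with constant components \<open>v\<close> in the chart \<open>c\<close>,
  expressed, as all fields are, in the preferred charts.\<close>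

definition coord_vf :: "('a, 'e) chart \<Rightarrow> 'e \<Rightarrow> 'a \<Rightarrow> 'e" where
  "coord_vf c v q = trans_deriv c (chart_at M q) q v"

lemma linear_coord_vf: "c \<in> atlas M \<Longrightarrow> q \<in> fst c \<Longrightarrow> linear (\<lambda>v. coord_vf c v q)"
  unfolding coord_vf_def using linear_trans chart_at chart_points by blast

lemma coord_vf_self: "p \<in> points M \<Longrightarrow> coord_vf (chart_at M p) v p = v"
  unfolding coord_vf_def using trans_self chart_at by blast

lemma vf_coord_coord_vf:
  assumes "c \<in> atlas M" "d \<in> atlas M" "q \<in> fst c" "q \<in> fst d"
  shows "trans_deriv (chart_at M q) d q (coord_vf c v q) = trans_deriv c d q v"
  unfolding coord_vf_def using assms chart_at chart_points by (intro trans_trans) auto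

lemma smooth_coord_vf:
  assumes c: "c \<in> atlas M" and V: "mopen M V" "V \<subseteq> fst c"
  shows "smooth_vf M V (coord_vf c v)"
  unfolding smooth_vf_def
proof
  fix d assume d: "d \<in> atlas M"
  have sm: "smooth_on (snd d ` (fst d \<inter> V)) (\<lambda>x. snd c (cinv d x))"
    by (rule smooth_on_subset[OF smooth_transition[OF d c] open_chart_image[OF d V(1)]]) (use V in auto)
  have "smooth_on (snd d ` (fst d \<inter> V))
      (\<lambda>x. frechet_derivative (\<lambda>x. snd d (cinv c x)) (at (snd c (cinv d x))) v)"
    by (rule smooth_on_compose[OF sm smooth_on_frechet[OF smooth_transition[OF c d]]])
       (use d V in auto)
  then show "smooth_on (snd d ` (fst d \<inter> V)) (vf_coord M d (coord_vf c v))"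
  proof (rule smooth_on_cong)
    fix x assume "x \<in> snd d ` (fst d \<inter> V)"
    then obtain q where q: "q \<in> fst d" "q \<in> V" "x = snd d q" by blast
    then have qc: "q \<in> fst c" using V by blast
    show "frechet_derivative (\<lambda>x. snd d (cinv c x)) (at (snd c (cinv d x))) v =
        vf_coord M d (coord_vf c v) x"
      using vf_coord_coord_vf[OF c d qc q(1), of v] d q by (simp add: vf_coord_def trans_deriv_def o_def)
  qed
qed

lemma vf_coord_expand:
  assumes c: "c \<in> atlas M" and q: "q \<in> fst c"
  shows "X q = coord_vf c (vf_coord M c X (snd c q)) q"
proof -
  have p: "q \<in> points M" using chart_points[OF c q] .
  show ?thesis
    using trans_trans[OF chart_at[OF p] c q chart_at[OF p], of "X q"] trans_self[OF chart_at[OF p], of "X q"] c q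
    by (simp add: coord_vf_def vf_coord_def)
qed

lemma smooth_form_coord:
  assumes c: "c \<in> atlas M" and V: "mopen M V" and \<eta>: "smooth_form M V \<eta>"
  shows "smooth_on (snd c ` (fst c \<inter> V)) (\<lambda>x. form_coord M c \<eta> x v)"
proof -
  have o: "mopen M (V \<inter> fst c)" using V chart(1)[OF c] by (rule openin_Int)
  have "smooth_fun M (V \<inter> fst c) (\<lambda>p. blinfun_apply (\<eta> p) (coord_vf c v p))"
    using \<eta> o smooth_coord_vf[OF c o] unfolding smooth_form_def by blast
  then have "smooth_on (snd c ` (fst c \<inter> (V \<inter> fst c)))
      ((\<lambda>p. blinfun_apply (\<eta> p) (coord_vf c v p)) \<circ> cinv c)"
    using c unfolding smooth_fun_def by blast
  moreover have "fst c \<inter> (V \<inter> fst c) = fst c \<inter> V" by blast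
  ultimately show ?thesis by (simp add: form_coord_def coord_vf_def o_def)
qed

lemma form_coord_chart:
  "c \<in> atlas M \<Longrightarrow> q \<in> fst c \<Longrightarrow> form_coord M c \<eta> (snd c q) v = blinfun_apply (\<eta> q) (coord_vf c v q)"
  by (simp add: form_coord_def coord_vf_def)

lemma linear_form_coord:
  "c \<in> atlas M \<Longrightarrow> q \<in> fst c \<Longrightarrow> linear (form_coord M c \<eta> (snd c q))"
  by (rule linearI) (simp_all add: form_coord_chart linear_add[OF linear_coord_vf]
    linear_cmul[OF linear_coord_vf] blinfun.add_right blinfun.scaleR_right)

lemma ext_deriv_coord_d:
  "ext_deriv M \<eta> p u v = coord_d (form_coord M (chart_at M p) \<eta>) (snd (chart_at M p) p) u v"
  by (simp add: ext_deriv_def coord_d_def Let_def)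

text \<open>The matrix of \<open>J\<close> in the chart \<open>c\<close>, at the coordinate point
  \<open>y\<close>.\<close>

definition endo_coord :: "('a, 'e) chart \<Rightarrow> ('a \<Rightarrow> 'e \<Rightarrow>\<^sub>L 'e) \<Rightarrow> 'e \<Rightarrow> 'e \<Rightarrow> 'e" where
  "endo_coord c J y v = vf_coord M c (\<lambda>q. blinfun_apply (J q) (coord_vf c v q)) y"

lemma smooth_endo_subset: "smooth_endo M V' J \<Longrightarrow> V \<subseteq> V' \<Longrightarrow> smooth_endo M V J"
  unfolding smooth_endo_def by blast

lemma smooth_endo_vf:
  assumes c: "c \<in> atlas M" and V: "mopen M V" "V \<subseteq> fst c" and J: "smooth_endo M V J"
  shows "smooth_vf M V (\<lambda>q. blinfun_apply (J q) (coord_vf c v q))"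
  using J V smooth_coord_vf[OF c V] unfolding smooth_endo_def by blast

lemma smooth_endo_coord:
  assumes c: "c \<in> atlas M" and V: "mopen M V" "V \<subseteq> fst c" and J: "smooth_endo M V J"
  shows "smooth_on (snd c ` V) (\<lambda>y. endo_coord c J y v)"
proof -
  have "smooth_on (snd c ` (fst c \<inter> V)) (vf_coord M c (\<lambda>q. blinfun_apply (J q) (coord_vf c v q)))"
    using smooth_endo_vf[OF assms] c by (simp add: smooth_vf_def)
  moreover have "fst c \<inter> V = V" using V by blast
  ultimately show ?thesis by (simp add: endo_coord_def[abs_def])
qed

lemma endo_coord_chart:
  "c \<in> atlas M \<Longrightarrow> q \<in> fst c \<Longrightarrow>
    endo_coord c J (snd c q) v = trans_deriv (chart_at M q) c q (blinfun_apply (J q) (coord_vf c v q))"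
  by (simp add: endo_coord_def vf_coord_def)

lemma trans_coord_vf:
  "c \<in> atlas M \<Longrightarrow> q \<in> fst c \<Longrightarrow> trans_deriv (chart_at M q) c q (coord_vf c v q) = v"
  by (simp add: vf_coord_coord_vf trans_self)

lemma coord_vf_trans:
  "c \<in> atlas M \<Longrightarrow> q \<in> fst c \<Longrightarrow> coord_vf c (trans_deriv (chart_at M q) c q v) q = v"
  unfolding coord_vf_def using trans_trans trans_self chart_at chart_points by metis

lemma linear_trans_at: "c \<in> atlas M \<Longrightarrow> q \<in> fst c \<Longrightarrow> linear (trans_deriv (chart_at M q) c q)"
  using linear_trans chart_at chart_points by blast

lemma quaternionic_endo_coord:
  assumes c: "c \<in> atlas M" "q \<in> fst c"
    and J: "quaternionic_structure UNIV (\<lambda>i. blinfun_apply (J i q))"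
  shows "quaternionic_structure UNIV (\<lambda>i. endo_coord c (J i) (snd c q))"
proof -
  note l = linear_coord_vf[OF c] linear_trans_at[OF c]
  have "quaternionic UNIV (\<lambda>i. blinfun_apply (J i q))" using J by unfold_locales auto
  then interpret J: quaternionic UNIV "\<lambda>i. blinfun_apply (J i q)" .
  show ?thesis
    unfolding quaternionic_structure_def endo_coord_chart[OF c] coord_vf_trans[OF c]
    by (simp add: linear_add[OF l(1)] linear_cmul[OF l(1)] linear_add[OF l(2)] linear_cmul[OF l(2)]
      linear_neg[OF l(2)] blinfun.add_right blinfun.scaleR_right trans_coord_vf[OF c])
qed

lemma smooth_vf_add:
  assumes V: "mopen M V" and X: "smooth_vf M V X" and Y: "smooth_vf M V Y"
  shows "smooth_vf M V (\<lambda>q. X q + Y q)"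
  unfolding smooth_vf_def
proof
  fix c assume c: "c \<in> atlas M"
  have "smooth_on (snd c ` (fst c \<inter> V)) (\<lambda>x. vf_coord M c X x + vf_coord M c Y x)"
    using X Y c by (auto simp: smooth_vf_def smooth_on_def intro: Ck_on_add)
  then show "smooth_on (snd c ` (fst c \<inter> V)) (vf_coord M c (\<lambda>q. X q + Y q))"
    by (rule smooth_on_cong) (use c in \<open>auto simp: vf_coord_def linear_add[OF linear_trans_at]\<close>)
qed

lemma smooth_vf_scaleR:
  assumes V: "mopen M V" and h: "smooth_fun M V h" and Y: "smooth_vf M V Y"
  shows "smooth_vf M V (\<lambda>q. h q *\<^sub>R Y q)"
  unfolding smooth_vf_def
proof
  fix c assume c: "c \<in> atlas M"
  have "smooth_on (snd c ` (fst c \<inter> V)) (\<lambda>x. h (cinv c x) *\<^sub>R vf_coord M c Y x)"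
    using h Y c by (intro smooth_on_scaleR) (auto simp: smooth_vf_def smooth_fun_def o_def)
  then show "smooth_on (snd c ` (fst c \<inter> V)) (vf_coord M c (\<lambda>q. h q *\<^sub>R Y q))"
    by (rule smooth_on_cong) (use c in \<open>auto simp: vf_coord_def linear_cmul[OF linear_trans_at]\<close>)
qed

lemma smooth_fun_const: "mopen M V \<Longrightarrow> (\<And>q. q \<in> V \<Longrightarrow> h q = k) \<Longrightarrow> smooth_fun M V h"
  unfolding smooth_fun_def
proof
  fix c assume V: "mopen M V" and h: "\<And>q. q \<in> V \<Longrightarrow> h q = k" and c: "c \<in> atlas M"
  show "smooth_on (snd c ` (fst c \<inter> V)) (h \<circ> cinv c)"
    by (rule smooth_on_cong[OF smooth_on_const[OF open_chart_image[OF c V], of k]]) (use c h in auto)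
qed

lemma fun_deriv_const:
  assumes V: "mopen M V" "p \<in> V" and h: "\<And>q. q \<in> V \<Longrightarrow> h q = k"
  shows "fun_deriv M h p v = 0"
proof -
  have p: "p \<in> points M" using V openin_subset by blast
  note c = chart_at[OF p]
  have "((\<lambda>x. k) has_derivative (\<lambda>_. 0)) (at (snd (chart_at M p) p))" by simp
  moreover have "\<forall>\<^sub>F x in nhds (snd (chart_at M p) p). k = (h \<circ> cinv (chart_at M p)) x"
    using eventually_chart[OF c(1) V(1) c(2) V(2)] by eventually_elim (use c h in auto)
  ultimately have "((h \<circ> cinv (chart_at M p)) has_derivative (\<lambda>_. 0)) (at (snd (chart_at M p) p))"
    by (rule has_derivative_cong_nhds)
  from frechet_derivative_at[OF this] show ?thesis by (simp add: fun_deriv_def fun_eq_iff)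
qed

end

subsection \<open>Connections in coordinates\<close>

locale connection_mfd = smooth_mfd N for N :: "('a, 'e::euclidean_space) smfd" +
  fixes nabla :: "'a \<Rightarrow> 'e \<Rightarrow> ('a \<Rightarrow> 'e) \<Rightarrow> 'e"
  assumes conn: "affine_connection N nabla" and tf: "torsion_free N nabla"
begin

lemma nabla_add:
  assumes "mopen N V" "p \<in> V" "smooth_vf N V Y" "smooth_vf N V Z"
  shows "nabla p v (\<lambda>q. Y q + Z q) = nabla p v Y + nabla p v Z"
  using conn assms smooth_fun_const[OF assms(1), of "\<lambda>_. 0" 0] unfolding affine_connection_def by blast

lemma linear_nabla:
  assumes "mopen N V" "p \<in> V" "smooth_vf N V Y"
  shows "linear (\<lambda>v. nabla p v Y)"
  using conn assms smooth_fun_const[OF assms(1), of "\<lambda>_. 0" 0] unfolding affine_connection_def by blast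

lemma nabla_scaleR:
  assumes "mopen N V" "p \<in> V" "smooth_vf N V Y" "smooth_fun N V h"
  shows "nabla p v (\<lambda>q. h q *\<^sub>R Y q) = fun_deriv N h p v *\<^sub>R Y p + h p *\<^sub>R nabla p v Y"
  using conn assms unfolding affine_connection_def by blast

text \<open>The indicator function of \<open>V\<close> is smooth on \<open>V\<close>, and multiplying by it removes the values
  off \<open>V\<close>.\<close>

lemma nabla_local:
  assumes V: "mopen N V" "p \<in> V" and Y: "smooth_vf N V Y" "smooth_vf N V Y'"
    and eq: "\<And>q. q \<in> V \<Longrightarrow> Y q = Y' q"
  shows "nabla p v Y = nabla p v Y'"
proof -
  let ?h = "\<lambda>q. if q \<in> V then 1 else 0 :: real"
  have h: "smooth_fun N V ?h" by (rule smooth_fun_const[OF V(1), of _ 1]) auto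
  have d: "fun_deriv N ?h p v = 0" by (rule fun_deriv_const[OF V, of _ 1]) auto
  have "nabla p v Y = nabla p v (\<lambda>q. ?h q *\<^sub>R Y q)"
    unfolding nabla_scaleR[OF V Y(1) h] d using V(2) by simp
  also have "(\<lambda>q. ?h q *\<^sub>R Y q) = (\<lambda>q. ?h q *\<^sub>R Y' q)" using eq by auto
  also have "nabla p v \<dots> = nabla p v Y'"
    unfolding nabla_scaleR[OF V Y(2) h] d using V(2) by simp
  finally show ?thesis .
qed

text \<open>Smoothness of the partial sums is carried along because additivity asks for it. The
  empty sum is treated as the function 0 times the smooth field \<open>Z\<close>.\<close>

lemma nabla_sum:
  assumes V: "mopen N V" "p \<in> V" and fin: "finite B"
    and h: "\<And>b. b \<in> B \<Longrightarrow> smooth_fun N V (h b)" and Y: "\<And>b. b \<in> B \<Longrightarrow> smooth_vf N V (Y b)"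
    and Z: "smooth_vf N V Z"
  shows "smooth_vf N V (\<lambda>q. \<Sum>b\<in>B. h b q *\<^sub>R Y b q) \<and>
    nabla p v (\<lambda>q. \<Sum>b\<in>B. h b q *\<^sub>R Y b q) =
      (\<Sum>b\<in>B. fun_deriv N (h b) p v *\<^sub>R Y b p + h b p *\<^sub>R nabla p v (Y b))"
  using fin h Y
proof (induction B rule: finite_induct)
  case empty
  have h0: "smooth_fun N V (\<lambda>_. 0)" by (rule smooth_fun_const[OF V(1)]) simp
  have "fun_deriv N (\<lambda>_. 0) p v = 0" by (rule fun_deriv_const[OF V]) simp
  then show ?case
    using smooth_vf_scaleR[OF V(1) h0 Z] nabla_scaleR[OF V Z h0, of v] by simp
next
  case (insert b B)
  then show ?case
    using nabla_add[OF V smooth_vf_scaleR[OF V(1)], of "h b" "Y b" "\<lambda>q. \<Sum>b\<in>B. h b q *\<^sub>R Y b q" v]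
      smooth_vf_add[OF V(1) smooth_vf_scaleR[OF V(1)], of "h b" "Y b" "\<lambda>q. \<Sum>b\<in>B. h b q *\<^sub>R Y b q"]
      nabla_scaleR[OF V, of "Y b" "h b" v] by simp
qed

text \<open>The Christoffel symbol in the preferred chart at \<open>p\<close>; the expansion over
  \<open>Basis\<close> makes it linear in \<open>v\<close> by construction.\<close>

definition christoffel :: "'a \<Rightarrow> 'e \<Rightarrow> 'e \<Rightarrow> 'e" where
  "christoffel p u v = (\<Sum>b\<in>Basis. (v \<bullet> b) *\<^sub>R nabla p u (coord_vf (chart_at N p) b))"

text \<open>On \<open>V\<close> the field is a combination of coordinate fields with smooth
  coefficients; the Leibniz rule splits off the derivatives of the coefficients, and locality
  discards the values off \<open>V\<close>.\<close>

lemma nabla_eq: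
  assumes V: "mopen N V" "p \<in> V" "V \<subseteq> fst (chart_at N p)" and Y: "smooth_vf N V Y"
  shows "nabla p v Y = frechet_derivative (vf_coord N (chart_at N p) Y) (at (snd (chart_at N p) p)) v
    + christoffel p v (Y p)"
proof -
  let ?c = "chart_at N p" and ?x = "snd (chart_at N p) p"
  have p: "p \<in> points N" using V openin_subset by blast
  note c = chart_at[OF p]
  let ?y = "vf_coord N ?c Y"
  let ?h = "\<lambda>b q. ?y (snd ?c q) \<bullet> b"
  have fV: "fst ?c \<inter> V = V" using V by blast
  have y: "smooth_on (snd ?c ` V) ?y" using Y c fV by (auto simp: smooth_vf_def)
  have xV: "?x \<in> snd ?c ` V" using V by blast
  have h: "smooth_fun N V (?h b)" for b
    unfolding smooth_fun_def o_def
  proof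
    fix d assume d: "d \<in> atlas N"
    have "smooth_on (snd d ` (fst d \<inter> V)) (\<lambda>x. snd ?c (cinv d x))"
      by (rule smooth_on_subset[OF smooth_transition[OF d c(1)] open_chart_image[OF d V(1)]]) (use V in auto)
    then have "smooth_on (snd d ` (fst d \<inter> V)) (\<lambda>x. ?y (snd ?c (cinv d x)))"
      by (rule smooth_on_compose[OF _ y]) (use d in auto)
    then show "smooth_on (snd d ` (fst d \<inter> V)) (\<lambda>x. ?h b (cinv d x))"
      by (rule smooth_on_linear[OF bounded_linear_inner_left])
  qed
  have E: "smooth_vf N V (coord_vf ?c b)" for b by (rule smooth_coord_vf[OF c(1) V(1,3)])
  have dh: "fun_deriv N (?h b) p v = frechet_derivative ?y (at ?x) v \<bullet> b" for b
  proof -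
    have "((\<lambda>x. ?y x \<bullet> b) has_derivative (\<lambda>v. frechet_derivative ?y (at ?x) v \<bullet> b)) (at ?x)"
      by (intro has_derivative_inner_left smooth_on_has_derivative[OF y xV])
    moreover have "\<forall>\<^sub>F x in nhds ?x. ?y x \<bullet> b = (?h b \<circ> cinv ?c) x"
      using eventually_chart[OF c(1) V(1) c(2) V(2)] by eventually_elim (use c in auto)
    ultimately have "((?h b \<circ> cinv ?c) has_derivative (\<lambda>v. frechet_derivative ?y (at ?x) v \<bullet> b)) (at ?x)"
      by (rule has_derivative_cong_nhds)
    from frechet_derivative_at[OF this] show ?thesis by (simp add: fun_deriv_def fun_eq_iff)
  qed
  have Yx: "?y ?x = Y p" using c trans_self[OF c] by (simp add: vf_coord_def)
  note s = nabla_sum[where h = ?h and Y = "coord_vf ?c" and v = v, OF V(1,2) finite_Basis h E Y]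
  have Yexp: "Y q = (\<Sum>b\<in>Basis. ?h b q *\<^sub>R coord_vf ?c b q)" if q: "q \<in> V" for q
  proof -
    have qc: "q \<in> fst ?c" using q V by blast
    show ?thesis
      using vf_coord_expand[OF c(1) qc, of Y] linear_basis_expansion[OF linear_coord_vf[OF c(1) qc]] by metis
  qed
  have "nabla p v Y = nabla p v (\<lambda>q. \<Sum>b\<in>Basis. ?h b q *\<^sub>R coord_vf ?c b q)"
    using s by (intro nabla_local[OF V(1,2) Y]) (auto intro: Yexp)
  also have "\<dots> = (\<Sum>b\<in>Basis. (frechet_derivative ?y (at ?x) v \<bullet> b) *\<^sub>R b) + christoffel p v (Y p)"
    using s by (simp add: dh coord_vf_self[OF p] sum.distrib christoffel_def Yx)
  finally show ?thesis by (simp add: euclidean_representation)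
qed

text \<open>Coordinate fields have constant components, so their brackets vanish and absence of
  torsion is symmetry on basis vectors.\<close>

lemma christoffel_symmetric:
  assumes p: "p \<in> points N"
  shows "christoffel p u v = christoffel p v u"
proof -
  let ?c = "chart_at N p" and ?x = "snd (chart_at N p) p"
  note c = chart_at[OF p]
  have V: "mopen N (fst ?c)" using chart(1)[OF c(1)] .
  have E: "smooth_vf N (fst ?c) (coord_vf ?c b)" for b by (rule smooth_coord_vf[OF c(1) V]) simp
  have dE: "frechet_derivative (vf_coord N ?c (coord_vf ?c b)) (at ?x) w = 0" for b w
  proof -
    have "((\<lambda>x. b) has_derivative (\<lambda>_. 0)) (at ?x)" by simp
    moreover have "\<forall>\<^sub>F x in nhds ?x. b = vf_coord N ?c (coord_vf ?c b) x"
      using eventually_chart[OF c(1) V c(2,2)]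
      by eventually_elim (use c in \<open>auto simp: vf_coord_def trans_coord_vf\<close>)
    ultimately have "(vf_coord N ?c (coord_vf ?c b) has_derivative (\<lambda>_. 0)) (at ?x)"
      by (rule has_derivative_cong_nhds)
    from frechet_derivative_at[OF this] show ?thesis by (simp add: fun_eq_iff)
  qed
  have "nabla p (coord_vf ?c b p) (coord_vf ?c b') - nabla p (coord_vf ?c b' p) (coord_vf ?c b)
      = lie_bracket N (coord_vf ?c b) (coord_vf ?c b') p" for b b'
    using tf V c(2) E unfolding torsion_free_def by blast
  then have s: "nabla p b (coord_vf ?c b') = nabla p b' (coord_vf ?c b)" for b b'
    by (simp add: coord_vf_self[OF p] lie_bracket_def Let_def dE)
  have l: "linear (\<lambda>v. nabla p v (coord_vf ?c b))" for b by (rule linear_nabla[OF V c(2) E])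
  have exp: "christoffel p u v = (\<Sum>b\<in>Basis. \<Sum>a\<in>Basis. (v \<bullet> b) *\<^sub>R (u \<bullet> a) *\<^sub>R nabla p a (coord_vf ?c b))" for u v
    unfolding christoffel_def
    by (intro sum.cong refl, subst linear_basis_expansion[OF l]) (simp add: scaleR_sum_right)
  show ?thesis
    unfolding exp by (subst sum.swap) (simp add: s[symmetric] mult.commute s)
qed

lemma linear_christoffel: "linear (christoffel p u)"
  by (rule linearI) (simp_all add: christoffel_def inner_add_left scaleR_add_left sum.distrib scaleR_sum_right)

text \<open>On fields with constant components \<open>nabla\<close> acts by the Christoffel symbol
  alone, so preservation of \<open>Q\<close> becomes a condition on the derivative of the matrix of
  \<open>J\<close> and its commutator with that symbol. \<open>K\<close> is obtained before the test
  field and thus serves all \<open>e\<close>.\<close>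

lemma endo_coord_derivative:
  assumes p: "p \<in> V" and V: "mopen N V" and Q: "preserves_subbundle N Q nabla"
    and J: "smooth_endo N V J" "\<And>q. q \<in> V \<Longrightarrow> J q \<in> Q q"
  defines "c \<equiv> chart_at N p"
  shows "\<exists>K\<in>Q p. \<forall>e. frechet_derivative (\<lambda>y. endo_coord c J y e) (at (snd c p)) v
    + christoffel p v (blinfun_apply (J p) e) - blinfun_apply (J p) (christoffel p v e) = blinfun_apply K e"
proof -
  have pp: "p \<in> points N" using V p openin_subset by blast
  note c = chart_at[OF pp, folded c_def]
  let ?V = "V \<inter> fst c"
  have V': "mopen N ?V" "p \<in> ?V" "?V \<subseteq> fst c" using V chart(1)[OF c(1)] p c(2) by auto
  have V3: "?V \<subseteq> fst (chart_at N p)" by (simp add: c_def)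
  have J': "smooth_endo N ?V J" by (rule smooth_endo_subset[OF J(1)]) auto
  have "mopen N ?V \<and> smooth_endo N ?V J \<and> (\<forall>q\<in>?V. J q \<in> Q q) \<and> p \<in> ?V"
    using V' J' J(2) by blast
  from Q[unfolded preserves_subbundle_def, rule_format, OF this, of v]
  obtain K where K: "K \<in> Q p" and KY: "\<And>Y. smooth_vf N ?V Y \<Longrightarrow>
      nabla p v (\<lambda>q. blinfun_apply (J q) (Y q)) - blinfun_apply (J p) (nabla p v Y) = blinfun_apply K (Y p)"
    by blast
  have "frechet_derivative (\<lambda>y. endo_coord c J y e) (at (snd c p)) v
      + christoffel p v (blinfun_apply (J p) e) - blinfun_apply (J p) (christoffel p v e) = blinfun_apply K e" for e
  proof -
    have E: "smooth_vf N ?V (coord_vf c e)" by (rule smooth_coord_vf[OF c(1) V'(1,3)])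
    have JE: "smooth_vf N ?V (\<lambda>q. blinfun_apply (J q) (coord_vf c e q))"
      by (rule smooth_endo_vf[OF c(1) V'(1,3) J'])
    have Ep: "coord_vf c e p = e" unfolding c_def by (rule coord_vf_self[OF pp])
    have "((\<lambda>x. e) has_derivative (\<lambda>_. 0)) (at (snd c p))" by simp
    moreover have "\<forall>\<^sub>F x in nhds (snd c p). e = vf_coord N c (coord_vf c e) x"
      using eventually_chart[OF c(1) V'(1) c(2) V'(2)]
      by eventually_elim (use c in \<open>auto simp: vf_coord_def trans_coord_vf\<close>)
    ultimately have "(vf_coord N c (coord_vf c e) has_derivative (\<lambda>_. 0)) (at (snd c p))"
      by (rule has_derivative_cong_nhds)
    from frechet_derivative_at[OF this] have "nabla p v (coord_vf c e) = christoffel p v e"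
      using nabla_eq[OF V'(1,2) V3 E, of v] by (simp add: c_def[symmetric] Ep fun_eq_iff)
    moreover have "nabla p v (\<lambda>q. blinfun_apply (J q) (coord_vf c e q)) =
        frechet_derivative (\<lambda>y. endo_coord c J y e) (at (snd c p)) v + christoffel p v (blinfun_apply (J p) e)"
      using nabla_eq[OF V'(1,2) V3 JE, of v]
      by (simp add: c_def[symmetric] Ep endo_coord_def[abs_def])
    ultimately show ?thesis using KY[OF E] by (simp add: Ep)
  qed
  with K show ?thesis by blast
qed

end

subsection \<open>Immersions in coordinates\<close>

text \<open>\<open>tangent_map\<close> refers to preferred charts, which jump from point to point;
  the chain rule relates it to the derivative in one fixed pair of charts.\<close>

lemma immersion_coord:
  fixes N :: "('a, 'e::euclidean_space) smfd" and M :: "('b, 'f::euclidean_space) smfd"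
  assumes M: "smooth_manifold M" and N: "smooth_manifold N" and f: "immersion M N f"
    and c: "c \<in> atlas M" and d: "d \<in> atlas N"
  defines "F \<equiv> \<lambda>x. snd d (f (cinv c x))" and "U \<equiv> snd c ` {q \<in> fst c. f q \<in> fst d}"
  shows "smooth_on U F"
    "q \<in> fst c \<Longrightarrow> f q \<in> fst d \<Longrightarrow> frechet_derivative F (at (snd c q)) v =
      trans_deriv (chart_at N (f q)) d (f q) (tangent_map M N f q (smooth_mfd.coord_vf M c v q))"
    "q \<in> fst c \<Longrightarrow> linear (tangent_map M N f q)" "q \<in> fst c \<Longrightarrow> inj (tangent_map M N f q)"
proof -
  interpret M: smooth_mfd M using M by unfold_locales
  interpret N: smooth_mfd N using N by unfold_locales
  have sm: "smooth_on (snd c ` {q \<in> fst c. f q \<in> fst d}) (\<lambda>x. snd d (f (cinv c x)))"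
    if "c \<in> atlas M" "d \<in> atlas N" for c d
    using f that by (simp add: immersion_def o_def)
  show smF: "smooth_on U F" unfolding U_def F_def by (rule sm[OF c d])
  have fp: "f q \<in> points N" if "q \<in> points M" for q
    using f that by (auto simp: immersion_def continuous_map_def)
  have tm: "((\<lambda>x. snd (chart_at N (f q)) (f (cinv (chart_at M q) x))) has_derivative
      tangent_map M N f q) (at (snd (chart_at M q) q))" if q: "q \<in> points M" for q
    unfolding tangent_map_def o_def
    by (rule smooth_on_has_derivative[OF sm[OF M.chart_at(1)[OF q] N.chart_at(1)[OF fp[OF q]]]])
       (use M.chart_at(2)[OF q] N.chart_at(2)[OF fp[OF q]] in auto)
  show "linear (tangent_map M N f q)" if "q \<in> fst c"
    using tm[OF M.chart_points[OF c that]] has_derivative_linear by blast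
  show "inj (tangent_map M N f q)" if "q \<in> fst c"
    using f M.chart_points[OF c that] by (simp add: immersion_def)
  assume q: "q \<in> fst c" and fq: "f q \<in> fst d"
  let ?c = "chart_at M q" and ?d = "chart_at N (f q)"
  have qp: "q \<in> points M" using M.chart_points[OF c q] .
  note c' = M.chart_at[OF qp] and d' = N.chart_at[OF fp[OF qp]]
  have "((\<lambda>x. snd ?d (f (cinv ?c (snd ?c (cinv c x))))) has_derivative
      (\<lambda>v. tangent_map M N f q (trans_deriv c ?c q v))) (at (snd c q))"
    by (rule has_derivative_compose[OF M.trans_has_derivative[OF c c'(1) q c'(2)]])
       (use tm[OF qp] c q in simp)
  then have "((\<lambda>x. snd d (cinv ?d (snd ?d (f (cinv ?c (snd ?c (cinv c x))))))) has_derivative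
      (\<lambda>v. trans_deriv ?d d (f q) (tangent_map M N f q (trans_deriv c ?c q v)))) (at (snd c q))"
    by (rule has_derivative_compose)
       (use N.trans_has_derivative[OF d'(1) d d'(2) fq] c q c' in simp)
  moreover have "\<forall>\<^sub>F x in nhds (snd c q). snd d (cinv ?d (snd ?d (f (cinv ?c (snd ?c (cinv c x)))))) = F x"
  proof -
    let ?V = "{r \<in> topspace (mtop M). f r \<in> fst ?d} \<inter> fst ?c"
    have "openin (mtop M) {r \<in> topspace (mtop M). f r \<in> fst ?d}"
      using f by (intro openin_continuous_map_preimage[OF _ N.chart(1)[OF d'(1)]]) (simp add: immersion_def)
    then have V: "mopen M ?V" using M.chart(1)[OF c'(1)] by (rule openin_Int)
    have "q \<in> ?V" using qp c' d' by blast
    from M.eventually_chart[OF c V q this] show ?thesis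
      by eventually_elim (use c c' d' in \<open>auto simp: F_def\<close>)
  qed
  ultimately have "(F has_derivative
      (\<lambda>v. trans_deriv ?d d (f q) (tangent_map M N f q (trans_deriv c ?c q v)))) (at (snd c q))"
    by (rule has_derivative_cong_nhds)
  from frechet_derivative_at[OF this]
  show "frechet_derivative F (at (snd c q)) v =
      trans_deriv (chart_at N (f q)) d (f q) (tangent_map M N f q (M.coord_vf c v q))"
    by (simp add: M.coord_vf_def fun_eq_iff)
qed

subsection \<open>Linear-algebraic preliminaries\<close>

lemma has_derivative_family_linear:
  fixes L :: "'a::euclidean_space \<Rightarrow> 'b::euclidean_space \<Rightarrow> 'c::real_normed_vector"
  assumes lin: "\<forall>\<^sub>F x in nhds x0. linear (L x)"
    and L: "\<And>e. ((\<lambda>x. L x e) has_derivative L' e) (at x0)"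
  shows "linear (\<lambda>e. L' e u)"
proof (rule linearI)
  fix e e' :: 'b and r :: real
  have "((\<lambda>x. L x (e + e')) has_derivative (\<lambda>u. L' e u + L' e' u)) (at x0)"
    by (rule has_derivative_cong_nhds[OF has_derivative_add[OF L L]])
       (use lin in eventually_elim, simp add: linear_add)
  from has_derivative_unique[OF L this] show "L' (e + e') u = L' e u + L' e' u" by simp
  have "((\<lambda>x. L x (r *\<^sub>R e)) has_derivative (\<lambda>u. r *\<^sub>R L' e u)) (at x0)"
    by (rule has_derivative_cong_nhds[OF has_derivative_scaleR_right[OF L]])
       (use lin in eventually_elim, simp add: linear_cmul)
  from has_derivative_unique[OF L this] show "L' (r *\<^sub>R e) u = r *\<^sub>R L' e u" by simp
qed

lemma same_kernel_proportional:
  fixes \<phi> \<psi> :: "'a::real_vector \<Rightarrow> real"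
  assumes "linear \<phi>" "linear \<psi>" and ker: "\<And>z. \<phi> z = 0 \<longleftrightarrow> \<psi> z = 0"
  shows "\<exists>r. r \<noteq> 0 \<and> (\<forall>z. \<phi> z = r * \<psi> z)"
proof (cases "\<forall>z. \<psi> z = 0")
  case True
  then show ?thesis using ker by (intro exI[of _ 1]) auto
next
  case False
  then obtain z where z: "\<psi> z \<noteq> 0" by blast
  have "\<phi> w = (\<phi> z / \<psi> z) * \<psi> w" for w
  proof -
    have "\<psi> (w - (\<psi> w / \<psi> z) *\<^sub>R z) = 0"
      using z by (simp add: linear_diff[OF assms(2)] linear_cmul[OF assms(2)])
    then have "\<phi> (w - (\<psi> w / \<psi> z) *\<^sub>R z) = 0" using ker by blast
    then show ?thesis by (simp add: linear_diff[OF assms(1)] linear_cmul[OF assms(1)])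
  qed
  moreover have "\<phi> z / \<psi> z \<noteq> 0" using z ker[of z] by simp
  ultimately show ?thesis by blast
qed

text \<open>Orthonormal rows say that the transpose is a right inverse; for a square matrix it is
  then also a left inverse.\<close>

lemma so3_columns:
  assumes "so3 A"
  shows "(\<Sum>m\<in>UNIV. A m i * A m j) = (if i = j then 1 else 0)"
proof -
  define B where "B = (\<chi> i j. A i j)"
  have r: "A i 1 * A i 1 + A i 2 * A i 2 + A i 3 * A i 3 = 1" for i
    using assms by (simp add: so3_def)
  have o: "A 1 1 * A 2 1 + A 1 2 * A 2 2 + A 1 3 * A 2 3 = 0"
    and c: "A 3 1 = A 1 2 * A 2 3 - A 1 3 * A 2 2" "A 3 2 = A 1 3 * A 2 1 - A 1 1 * A 2 3"
      "A 3 3 = A 1 1 * A 2 2 - A 1 2 * A 2 1"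
    using assms by (simp_all add: so3_def)
  have o3: "A 1 1 * A 3 1 + A 1 2 * A 3 2 + A 1 3 * A 3 3 = 0"
    "A 2 1 * A 3 1 + A 2 2 * A 3 2 + A 2 3 * A 3 3 = 0"
    unfolding c by (simp_all add: algebra_simps)
  have "\<forall>i j. (B ** transpose B) $ i $ j = (mat 1 :: real^3^3) $ i $ j"
    using r o o3 by (simp add: forall_3 matrix_matrix_mult_def transpose_def B_def mat_def sum_3 mult.commute)
  then have "B ** transpose B = mat 1" by (simp add: vec_eq_iff)
  then have "transpose B ** B = mat 1" using matrix_left_right_inverse by blast
  then have "(transpose B ** B) $ i $ j = (mat 1 :: real^3^3) $ i $ j" by simp
  then show ?thesis by (simp add: matrix_matrix_mult_def transpose_def B_def mat_def)
qed

lemma span_range_real: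
  fixes K :: "'n::finite \<Rightarrow> 'v::real_vector"
  assumes "x \<in> span (range K)"
  shows "\<exists>b. x = (\<Sum>i\<in>UNIV. b i *\<^sub>R K i)"
  using assms
proof (induction rule: span_induct_alt)
  case base
  show ?case by (intro exI[of _ "\<lambda>_. 0"]) simp
next
  case (step c x y)
  then obtain k b where k: "x = K k" and b: "y = (\<Sum>i\<in>UNIV. b i *\<^sub>R K i)" by blast
  have "(\<Sum>i\<in>UNIV. ((if i = k then c else 0) + b i) *\<^sub>R K i) = c *\<^sub>R x + y"
    by (simp add: scaleR_add_left sum.distrib k b if_distrib[of "\<lambda>c. c *\<^sub>R _"] if_distribR cong: if_cong)
  then show ?case by metis
qed

lemma metric_inner_on:
  "metric_on_dist M H g \<Longrightarrow> p \<in> points M \<Longrightarrow> inner_on (H p) (g p)"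
  unfolding metric_on_dist_def inner_on_def sym_bilinear_on_def by blast

subsection \<open>The distribution of a hypersurface\<close>

text \<open>\<open>K\<close> is a frame of \<open>Q\<close> on \<open>VN\<close>. The bijection
  \<open>bas\<close> matches the rows other than 0 of an 8 by 8 determinant with the standard basis
  of the tangent space of the hypersurface, as \<open>conormal\<close> requires.\<close>

locale qc_setup = N: connection_mfd N nabla + M: smooth_mfd M
  for N :: "('a, real ^ 8) smfd" and nabla and M :: "('b, real ^ 7) smfd" +
  fixes Q :: "'a \<Rightarrow> ((real ^ 8) \<Rightarrow>\<^sub>L (real ^ 8)) set" and f :: "'b \<Rightarrow> 'a"
    and K :: "3 \<Rightarrow> 'a \<Rightarrow> (real ^ 8) \<Rightarrow>\<^sub>L (real ^ 8)" and VN :: "'a set" and bas :: "8 \<Rightarrow> 7"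
  assumes pres: "preserves_subbundle N Q nabla" and imm: "immersion M N f"
    and VN: "mopen N VN" and Ksm: "\<And>i. smooth_endo N VN (K i)"
    and Kq: "\<And>y. y \<in> VN \<Longrightarrow> quaternionic_structure UNIV (\<lambda>i. blinfun_apply (K i y))"
    and QK: "\<And>y. y \<in> VN \<Longrightarrow> Q y = span (range (\<lambda>i. K i y))"
    and bas: "bij_betw bas (- {0}) UNIV"
    and Hdim: "\<And>q. q \<in> points M \<Longrightarrow> dim (hypersurface_dist N Q M f q) + 3 = 7"
begin

abbreviation H :: "'b \<Rightarrow> (real ^ 7) set" where "H \<equiv> hypersurface_dist N Q M f"
abbreviation tm :: "'b \<Rightarrow> real ^ 7 \<Rightarrow> real ^ 8" where "tm \<equiv> tangent_map M N f"

lemma f_points: "q \<in> points M \<Longrightarrow> f q \<in> points N"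
  using imm by (auto simp: immersion_def continuous_map_def)

lemma tm:
  assumes q: "q \<in> points M"
  shows "linear (tm q)" "inj (tm q)"
  using immersion_coord(3,4)[OF M.smfd N.smfd imm M.chart_at(1)[OF q] N.chart_at(1)[OF f_points[OF q]]
      M.chart_at(2)[OF q]] by auto

lemma range_tm: "q \<in> points M \<Longrightarrow> subspace (range (tm q))"
  by (rule linear_subspace_image[OF tm(1) subspace_UNIV])

text \<open>The tangent vectors that every \<open>K j\<close> keeps tangent already form a
  \<open>Q\<close>-invariant subspace, because a product of two \<open>K j\<close> is again some
  \<open>K l\<close> or the identity, up to sign.\<close>

lemma H_iff:
  assumes q: "q \<in> points M" and fq: "f q \<in> VN"
  shows "v \<in> H q \<longleftrightarrow> (\<forall>j. blinfun_apply (K j (f q)) (tm q v) \<in> range (tm q))"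
proof -
  let ?K = "\<lambda>j. blinfun_apply (K j (f q))"
  define R where "R = range (tm q)"
  define X where "X = {z \<in> R. \<forall>j. ?K j z \<in> R}"
  interpret K: quaternionic UNIV ?K using Kq[OF fq] by unfold_locales auto
  have R: "subspace R" unfolding R_def by (rule range_tm[OF q])
  note RI = subspace_0[OF R] subspace_add[OF R] subspace_scale[OF R] subspace_neg[OF R]
  have X: "subspace X"
    unfolding X_def subspace_def
    by (auto simp: blinfun.add_right blinfun.scaleR_right blinfun.zero_right intro: RI)
  have KX: "?K j z \<in> X" if "z \<in> X" for j z
  proof -
    have "\<forall>i j. ?K i (?K j z) \<in> R" using that by (auto simp: forall_3 X_def intro: RI)
    then show ?thesis using that by (simp add: X_def)
  qed
  have QX: "blinfun_apply J z \<in> X" if J: "J \<in> Q (f q)" and z: "z \<in> X" for J z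
  proof -
    from J QK[OF fq] have "J \<in> span (range (\<lambda>i. K i (f q)))" by simp
    from span_range_real[OF this] obtain b where "J = (\<Sum>i\<in>UNIV. b i *\<^sub>R K i (f q))" by blast
    then have "blinfun_apply J z = (\<Sum>i\<in>UNIV. b i *\<^sub>R ?K i z)"
      by (simp add: blinfun.sum_left blinfun.scaleR_left)
    then show ?thesis using KX[OF z] by (simp add: subspace_sum[OF X] subspace_scale[OF X])
  qed
  have "X \<subseteq> max_invariant_subspace (Q (f q)) R"
  proof -
    have "X \<in> {U. subspace U \<and> U \<subseteq> R \<and> (\<forall>J\<in>Q (f q). blinfun_apply J ` U \<subseteq> U)}"
      using X QX by (auto simp: X_def)
    then show ?thesis unfolding max_invariant_subspace_def by (blast intro: span_base)
  qed
  moreover have "max_invariant_subspace (Q (f q)) R \<subseteq> X"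
    unfolding max_invariant_subspace_def
  proof (rule span_minimal[OF _ X])
    have "K j (f q) \<in> Q (f q)" for j using QK[OF fq] by (auto intro: span_base)
    then show "\<Union>{U. subspace U \<and> U \<subseteq> R \<and> (\<forall>J\<in>Q (f q). blinfun_apply J ` U \<subseteq> U)} \<subseteq> X"
      unfolding X_def by blast
  qed
  ultimately show ?thesis
    unfolding hypersurface_dist_def R_def[symmetric] by (auto simp: X_def) (auto simp: R_def)
qed

lemma H_subspace:
  assumes q: "q \<in> points M" and fq: "f q \<in> VN"
  shows "subspace (H q)"
proof -
  define R where "R = range (tm q)"
  have R: "subspace R" unfolding R_def by (rule range_tm[OF q])
  note RI = subspace_0[OF R] subspace_add[OF R] subspace_scale[OF R]
  note l = linear_0[OF tm(1)[OF q]] linear_add[OF tm(1)[OF q]] linear_cmul[OF tm(1)[OF q]]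
  show ?thesis
    unfolding subspace_def
    by (auto simp: H_iff[OF q fq] R_def[symmetric] l blinfun.add_right blinfun.scaleR_right blinfun.zero_right intro: RI)
qed

lemma H_nonzero:
  assumes q: "q \<in> points M"
  obtains Z where "Z \<in> H q" "Z \<noteq> 0"
proof -
  have "\<not> H q \<subseteq> {0}"
  proof
    assume "H q \<subseteq> {0}"
    then have "dim (H q) = 0" by (simp add: dim_eq_0)
    with Hdim[OF q] show False by simp
  qed
  then show ?thesis using that by blast
qed

text \<open>\<open>K j\<close> transported to \<open>H\<close> along the injective tangent map; off
  \<open>H\<close> the value is arbitrary.\<close>

definition KH :: "'b \<Rightarrow> 3 \<Rightarrow> real ^ 7 \<Rightarrow> real ^ 7" where
  "KH q j v = inv (tm q) (blinfun_apply (K j (f q)) (tm q v))"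

lemma tm_KH:
  assumes "q \<in> points M" "f q \<in> VN" "v \<in> H q"
  shows "tm q (KH q j v) = blinfun_apply (K j (f q)) (tm q v)"
  using assms H_iff unfolding KH_def by (intro f_inv_into_f) auto

lemma quaternionic_KH:
  assumes q: "q \<in> points M" and fq: "f q \<in> VN"
  shows "quaternionic_structure (H q) (KH q)"
proof -
  let ?K = "\<lambda>j. blinfun_apply (K j (f q))"
  interpret K: quaternionic UNIV ?K using Kq[OF fq] by unfold_locales auto
  note l = linear_0[OF tm(1)[OF q]] linear_add[OF tm(1)[OF q]] linear_cmul[OF tm(1)[OF q]]
    linear_neg[OF tm(1)[OF q]]
  note S = H_subspace[OF q fq] and t = tm_KH[OF q fq]
  have inj: "u = v" if "tm q u = tm q v" for u v using tm(2)[OF q] that by (simp add: inj_def)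
  have KHin: "KH q j v \<in> H q" if v: "v \<in> H q" for j v
  proof -
    define R where "R = range (tm q)"
    have R: "subspace R" "tm q v \<in> R" unfolding R_def using range_tm[OF q] by auto
    have "?K i (tm q v) \<in> R" for i using v H_iff[OF q fq] by (simp add: R_def)
    then have "\<forall>i j. ?K i (?K j (tm q v)) \<in> R"
      using R(2) by (auto simp: forall_3 intro: subspace_neg[OF R(1)])
    then show ?thesis unfolding H_iff[OF q fq] t[OF v] R_def by blast
  qed
  show ?thesis
    unfolding quaternionic_structure_def
  proof (intro conjI allI ballI)
    fix i u v and a b :: real assume uv: "u \<in> H q" "v \<in> H q"
    have "a *\<^sub>R u + b *\<^sub>R v \<in> H q" using S uv by (simp add: subspace_add subspace_scale)
    then show "KH q i (a *\<^sub>R u + b *\<^sub>R v) = a *\<^sub>R KH q i u + b *\<^sub>R KH q i v"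
      by (intro inj) (simp add: t uv l blinfun.add_right blinfun.scaleR_right)
  next
    fix i v assume v: "v \<in> H q"
    show "KH q i v \<in> H q" using KHin v .
    show "KH q i (KH q i v) = - v" by (intro inj) (simp add: t KHin v l)
  next
    fix v assume v: "v \<in> H q"
    show "KH q 1 (KH q 2 v) = KH q 3 v" by (intro inj) (simp add: t KHin v l)
    show "KH q 2 (KH q 1 v) = - KH q 3 v" by (intro inj) (simp add: t KHin v l)
  qed
qed

end

section \<open>The hypersurface in coordinates around a point\<close>

locale qc_point = qc_setup +
  fixes p
  assumes p: "p \<in> points M" and fp: "f p \<in> VN"
begin

text \<open>Everything is a function of the coordinate \<open>x\<close> on the hypersurface in the
  fixed charts \<open>c\<close> and \<open>d\<close>: \<open>P\<close> is the differential of the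
  immersion, \<open>k\<close> the frame of \<open>Q\<close> along it, \<open>\<theta>\<close> its
  conormal. \<open>Td\<close> passes to the chart \<open>d\<close> from the preferred charts, in
  which \<open>tm\<close> and \<open>K\<close> are expressed.\<close>

definition c where "c = chart_at M p"
definition d where "d = chart_at N (f p)"
definition x0 where "x0 = snd c p"
definition F where "F x = snd d (f (cinv c x))" for x
definition P where "P x = frechet_derivative F (at x)" for x
definition k where "k j x = N.endo_coord d (K j) (F x)" for j x
definition \<theta> where "\<theta> x = conormal 0 bas (P x)" for x
definition U where "U = {r \<in> points M. f r \<in> VN \<inter> fst d} \<inter> fst c"
definition Td where "Td q = trans_deriv (chart_at N (f q)) d (f q)" for q

lemma c: "c \<in> atlas M" "p \<in> fst c"
  unfolding c_def using M.chart_at[OF p] by auto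

lemma d: "d \<in> atlas N" "f p \<in> fst d"
  unfolding d_def using N.chart_at[OF f_points[OF p]] by auto

lemma U: "mopen M U" "p \<in> U"
proof -
  have "mopen N (VN \<inter> fst d)" using VN N.chart(1)[OF d(1)] by (rule openin_Int)
  then have "mopen M {r \<in> topspace (mtop M). f r \<in> VN \<inter> fst d}"
    using imm by (intro openin_continuous_map_preimage) (auto simp: immersion_def)
  then show "mopen M U" unfolding U_def using M.chart(1)[OF c(1)] by (rule openin_Int)
  show "p \<in> U" using p fp c d by (simp add: U_def)
qed

lemma UD: "q \<in> U \<Longrightarrow> q \<in> points M \<and> f q \<in> VN \<and> f q \<in> fst d \<and> q \<in> fst c"
  by (simp add: U_def)

lemma F_chart: "q \<in> U \<Longrightarrow> F (snd c q) = snd d (f q)"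
  using UD c by (simp add: F_def)

lemma P_chart: "q \<in> U \<Longrightarrow> P (snd c q) v = Td q (tm q (M.coord_vf c v q))"
  unfolding P_def Td_def F_def
  using UD by (intro immersion_coord(2)[OF M.smfd N.smfd imm c(1) d(1)]) auto

lemma P_p: "P x0 v = tm p v"
proof -
  have "Td p z = z" for z unfolding Td_def d_def
    using N.trans_self N.chart_at[OF f_points[OF p]] by blast
  moreover have "M.coord_vf c v p = v" unfolding c_def by (rule M.coord_vf_self[OF p])
  ultimately show ?thesis using P_chart[OF U(2), of v] by (simp add: x0_def)
qed

lemma Td: "q \<in> U \<Longrightarrow> linear (Td q)" "q \<in> U \<Longrightarrow> N.coord_vf d (Td q z) (f q) = z"
  unfolding Td_def using UD N.linear_trans_at[OF d(1)] N.coord_vf_trans[OF d(1)] by auto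

lemma Td_inj: "q \<in> U \<Longrightarrow> Td q z = Td q z' \<longleftrightarrow> z = z'"
  using Td(2) by metis

lemma k_chart: "q \<in> U \<Longrightarrow> k j (snd c q) (Td q z) = Td q (blinfun_apply (K j (f q)) z)"
  using Td(2)[of q z] UD[of q] by (simp add: k_def F_chart N.endo_coord_chart[OF d(1)] Td_def)

lemma k_p: "k j x0 z = blinfun_apply (K j (f p)) z"
proof -
  have "Td p z = z" for z unfolding Td_def d_def
    using N.trans_self N.chart_at[OF f_points[OF p]] by blast
  then show ?thesis using k_chart[OF U(2), of j z] by (simp add: x0_def)
qed

lemma quaternionic_k: "q \<in> U \<Longrightarrow> quaternionic_structure UNIV (\<lambda>j. k j (snd c q))"
  unfolding k_def using UD[of q] F_chart[of q] N.quaternionic_endo_coord[OF d(1), of "f q" K] Kq by simp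

lemma linear_k: "q \<in> U \<Longrightarrow> linear (k j (snd c q))"
proof -
  assume "q \<in> U"
  then interpret quaternionic UNIV "\<lambda>j. k j (snd c q)" using quaternionic_k by unfold_locales auto
  show ?thesis by (rule linearI) auto
qed

lemma linear_P: "q \<in> U \<Longrightarrow> linear (P (snd c q))"
proof -
  assume q: "q \<in> U"
  then have q': "q \<in> points M" "q \<in> fst c" using UD by auto
  note l = Td(1)[OF q] tm(1)[OF q'(1)] M.linear_coord_vf[OF c(1) q'(2)]
  show ?thesis
    by (rule linearI) (simp_all add: P_chart[OF q] linear_add[OF l(1)] linear_add[OF l(2)]
      linear_add[OF l(3)] linear_cmul[OF l(1)] linear_cmul[OF l(2)] linear_cmul[OF l(3)])
qed

lemma coord_vf_surj: "q \<in> U \<Longrightarrow> \<exists>v. M.coord_vf c v q = w"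
  using M.coord_vf_trans[OF c(1)] UD by blast

lemma coord_vf_inj: "q \<in> U \<Longrightarrow> M.coord_vf c v q = M.coord_vf c w q \<Longrightarrow> v = w"
  using M.trans_coord_vf[OF c(1)] UD by metis

lemma range_P: "q \<in> U \<Longrightarrow> Td q z \<in> range (P (snd c q)) \<longleftrightarrow> z \<in> range (tm q)"
  unfolding image_iff using coord_vf_surj by (auto simp: P_chart Td_inj) metis

lemma \<theta>_eq_0_iff: "q \<in> U \<Longrightarrow> \<theta> (snd c q) z = 0 \<longleftrightarrow> z \<in> range (P (snd c q))"
proof -
  assume q: "q \<in> U"
  have "inj (P (snd c q))"
    using tm(2)[of q] UD[OF q] coord_vf_inj[OF q] by (auto simp: inj_def P_chart[OF q] Td_inj[OF q])
  then show ?thesis unfolding \<theta>_def by (intro conormal_eq_0_iff bas linear_P q)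
qed

lemma linear_\<theta>: "linear (\<theta> x)"
  unfolding \<theta>_def by (rule linear_conormal)

lemma \<theta>k_eq_0_iff:
  assumes q: "q \<in> U"
  shows "(\<forall>j. \<theta> (snd c q) (k j (snd c q) (P (snd c q) v)) = 0) \<longleftrightarrow> M.coord_vf c v q \<in> H q"
proof -
  have "\<theta> (snd c q) (k j (snd c q) (P (snd c q) v)) = 0 \<longleftrightarrow>
      blinfun_apply (K j (f q)) (tm q (M.coord_vf c v q)) \<in> range (tm q)" for j
    unfolding \<theta>_eq_0_iff[OF q] P_chart[OF q, of v] k_chart[OF q] by (rule range_P[OF q])
  then show ?thesis using H_iff UD[OF q] by simp
qed

lemma eventually_U:
  assumes V: "mopen M V" "p \<in> V" and Pr: "\<And>q. q \<in> U \<Longrightarrow> q \<in> V \<Longrightarrow> R (snd c q)"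
  shows "\<forall>\<^sub>F x in nhds x0. R x"
proof -
  have "mopen M (U \<inter> V)" using U(1) V(1) by (rule openin_Int)
  then have "\<forall>\<^sub>F x in nhds x0. x \<in> snd c ` (fst c \<inter> (U \<inter> V))"
    unfolding x0_def using U(2) V(2) c by (intro M.eventually_chart) auto
  then show ?thesis by eventually_elim (use Pr in auto)
qed

lemmas eventually_U' = eventually_U[OF U]

lemma F_smooth: "smooth_on (snd c ` {q \<in> fst c. f q \<in> fst d}) F"
  unfolding F_def by (rule immersion_coord(1)[OF M.smfd N.smfd imm c(1) d(1)])

lemma x0_in: "x0 \<in> snd c ` {q \<in> fst c. f q \<in> fst d}"
  unfolding x0_def using c d by blast

lemma P_derivative:
  obtains B where "\<And>v. ((\<lambda>x. P x v) has_derivative B v) (at x0)" "\<And>u v. B u v = B v u"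
proof -
  define B where "B v = frechet_derivative (\<lambda>x. P x v) (at x0)" for v
  have B: "((\<lambda>x. P x v) has_derivative B v) (at x0)" for v
    unfolding B_def P_def by (rule smooth_on_has_derivative[OF smooth_on_frechet[OF F_smooth] x0_in])
  have "B u v = B v u" for u v
    by (rule second_derivative_symmetric[OF smooth_on_open[OF F_smooth] x0_in _ B, of F])
       (simp add: P_def smooth_on_has_derivative[OF F_smooth])
  with B that show ?thesis by blast
qed

lemma \<theta>_differentiable: "(\<lambda>x. \<theta> x z) differentiable (at x0)"
  unfolding \<theta>_def using P_derivative by (intro differentiable_conormal) (metis differentiable_def)

text \<open>\<open>\<beta>\<close> is the connection matrix of the frame \<open>k\<close> along the
  hypersurface: the covariant derivative of \<open>K j\<close> in the direction
  \<open>P x0 u\<close>, expanded in the frame of \<open>Q\<close>.\<close>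

lemma k_derivative:
  obtains k' \<beta> where "\<And>j e. ((\<lambda>x. k j x e) has_derivative k' j e) (at x0)"
    "\<And>j e u. k' j e u + N.christoffel (f p) (P x0 u) (k j x0 e) - k j x0 (N.christoffel (f p) (P x0 u) e)
      = (\<Sum>l\<in>UNIV. \<beta> j l u *\<^sub>R k l x0 e)"
proof -
  let ?y = "snd d (f p)"
  have Fx0: "F x0 = ?y" using F_chart[OF U(2)] by (simp add: x0_def)
  define V where "V = VN \<inter> fst d"
  have V: "mopen N V" "V \<subseteq> fst d" "f p \<in> V"
    unfolding V_def using VN N.chart(1)[OF d(1)] fp d by auto
  have KV: "smooth_endo N V (K j)" for j
    using Ksm N.smooth_endo_subset unfolding V_def by blast
  have sm: "smooth_on (snd d ` V) (\<lambda>y. N.endo_coord d (K j) y e)" for j e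
    by (rule N.smooth_endo_coord[OF d(1) V(1,2) KV])
  let ?D = "\<lambda>j e. frechet_derivative (\<lambda>y. N.endo_coord d (K j) y e) (at ?y)"
  have F': "(F has_derivative P x0) (at x0)"
    unfolding P_def by (rule smooth_on_has_derivative[OF F_smooth x0_in])
  have 1: "((\<lambda>x. k j x e) has_derivative (\<lambda>u. ?D j e (P x0 u))) (at x0)" for j e
    unfolding k_def
    by (rule has_derivative_compose[OF F']) (use smooth_on_has_derivative[OF sm] V(3) Fx0 in auto)
  have "\<exists>b. \<forall>e. ?D j e v + N.christoffel (f p) v (k j x0 e) - k j x0 (N.christoffel (f p) v e)
      = (\<Sum>l\<in>UNIV. b l *\<^sub>R k l x0 e)" for j v
  proof -
    have "K j y \<in> Q y" if "y \<in> V" for y using that QK unfolding V_def by (auto intro: span_base)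
    then obtain L where L: "L \<in> Q (f p)" and Le: "\<And>e. ?D j e v + N.christoffel (f p) v (blinfun_apply (K j (f p)) e)
        - blinfun_apply (K j (f p)) (N.christoffel (f p) v e) = blinfun_apply L e"
      using N.endo_coord_derivative[OF V(3,1) pres KV[of j], of v] unfolding d_def by blast
    from L QK[OF fp] have "L \<in> span (range (\<lambda>i. K i (f p)))" by simp
    from span_range_real[OF this] obtain b where b: "L = (\<Sum>i\<in>UNIV. b i *\<^sub>R K i (f p))" by blast
    show ?thesis
      using Le by (intro exI[of _ b]) (simp add: k_p b blinfun.sum_left blinfun.scaleR_left)
  qed
  then obtain b where b: "\<And>j v e. ?D j e v + N.christoffel (f p) v (k j x0 e)
      - k j x0 (N.christoffel (f p) v e) = (\<Sum>l\<in>UNIV. b j v l *\<^sub>R k l x0 e)" by metis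
  show ?thesis by (rule that[OF 1, of "\<lambda>j l u. b j (P x0 u) l"]) (rule b)
qed

text \<open>The pull-back of \<open>\<theta> \<circ> K j\<close>. These forms also cut out
  \<open>H\<close> but need not be adapted to a metric; adapted frames are measured against
  them.\<close>

definition \<eta>N where "\<eta>N j x v = \<theta> x (k j x (P x v))" for j x v

lemma \<eta>N_derivative: "(\<lambda>x. \<eta>N j x v) differentiable (at x0)"
proof -
  obtain B where B: "\<And>v. ((\<lambda>x. P x v) has_derivative B v) (at x0)" using P_derivative by metis
  obtain k' where k': "\<And>j e. ((\<lambda>x. k j x e) has_derivative k' j e) (at x0)" using k_derivative by metis
  have \<theta>': "((\<lambda>x. \<theta> x z) has_derivative frechet_derivative (\<lambda>x. \<theta> x z) (at x0)) (at x0)" for z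
    using \<theta>_differentiable frechet_derivative_works by blast
  have "\<forall>\<^sub>F x in nhds x0. linear (k j x)" by (rule eventually_U') (rule linear_k)
  note kP = has_derivative_apply[where L = "k j" and L' = "k' j" and w = "\<lambda>x. P x v", OF this k' B]
  have "\<forall>\<^sub>F x in nhds x0. linear (\<theta> x)" by (simp add: linear_\<theta>)
  from has_derivative_apply[where L = \<theta> and w = "\<lambda>x. k j x (P x v)", OF this \<theta>' kP]
  show ?thesis unfolding \<eta>N_def differentiable_def by blast
qed

lemma linear_\<eta>N: "q \<in> U \<Longrightarrow> linear (\<eta>N j (snd c q))"
  unfolding \<eta>N_def
  by (rule linearI) (simp_all add: linear_add[OF linear_P] linear_cmul[OF linear_P]
    linear_add[OF linear_k] linear_cmul[OF linear_k] linear_add[OF linear_\<theta>] linear_cmul[OF linear_\<theta>])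

lemma \<eta>N_p: "\<eta>N j x0 v = \<theta> x0 (blinfun_apply (K j (f p)) (tm p v))"
  by (simp add: \<eta>N_def k_p P_p)

lemma \<eta>N_kernel: "q \<in> U \<Longrightarrow> (\<forall>j. \<eta>N j (snd c q) v = 0) \<longleftrightarrow> M.coord_vf c v q \<in> H q"
  unfolding \<eta>N_def by (rule \<theta>k_eq_0_iff)

lemma \<eta>N_kernel_p: "{v. \<forall>j. \<eta>N j x0 v = 0} = H p"
  using \<eta>N_kernel[OF U(2)] M.coord_vf_self[OF p] by (auto simp: x0_def c_def)

lemma \<eta>N_dual:
  obtains w where "\<And>j k. \<eta>N j x0 (w k) = (if j = k then 1 else 0)"
proof -
  have "dim {v. \<forall>j. \<eta>N j x0 v = 0} + CARD(3) = DIM(real ^ 7)"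
    unfolding \<eta>N_kernel_p using Hdim[OF p] by simp
  moreover have "linear (\<eta>N j x0)" for j using linear_\<eta>N[OF U(2)] by (simp add: x0_def)
  ultimately show ?thesis using dual_vectors_exist[where \<eta> = "\<lambda>j. \<eta>N j x0"] that by blast
qed

lemma \<theta>_derivative:
  obtains \<theta>' where "\<And>z. ((\<lambda>x. \<theta> x z) has_derivative \<theta>' z) (at x0)"
  by (rule that[of "\<lambda>z. frechet_derivative (\<lambda>x. \<theta> x z) (at x0)"])
     (use \<theta>_differentiable frechet_derivative_works in blast)

lemma eventually_linear_k: "\<forall>\<^sub>F x in nhds x0. linear (k j x)"
  by (rule eventually_U') (rule linear_k)

lemma \<theta>_P: "\<forall>\<^sub>F x in nhds x0. \<forall>v. \<theta> x (P x v) = 0"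
  by (rule eventually_U') (simp add: \<theta>_eq_0_iff)

text \<open>In the twisted formula the connection terms are multiples of the forms
  \<open>\<eta>N l\<close>, which vanish on \<open>H\<close>; what remains is the second fundamental
  form \<open>h\<close>.\<close>

lemma \<eta>N_coord_d:
  obtains h where "sym_bilinear_on (H p) h"
    "\<And>j u v. u \<in> H p \<Longrightarrow> v \<in> H p \<Longrightarrow> coord_d (\<eta>N j) x0 u v = h (KH p j u) v - h u (KH p j v)"
proof -
  obtain \<theta>' where \<theta>': "\<And>z. ((\<lambda>x. \<theta> x z) has_derivative \<theta>' z) (at x0)" using \<theta>_derivative by blast
  obtain B where B: "\<And>v. ((\<lambda>x. P x v) has_derivative B v) (at x0)" and Bs: "\<And>u v. B u v = B v u"
    using P_derivative by blast
  obtain k' \<beta> where k': "\<And>j e. ((\<lambda>x. k j x e) has_derivative k' j e) (at x0)"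
    and \<beta>: "\<And>j e u. k' j e u + N.christoffel (f p) (P x0 u) (k j x0 e)
      - k j x0 (N.christoffel (f p) (P x0 u) e) = (\<Sum>l\<in>UNIV. \<beta> j l u *\<^sub>R k l x0 e)"
    using k_derivative by blast
  let ?\<Gamma> = "N.christoffel (f p)"
  have \<Gamma>: "?\<Gamma> y z = ?\<Gamma> z y" for y z by (rule N.christoffel_symmetric[OF f_points[OF p]])
  have lin\<theta>: "\<forall>\<^sub>F x in nhds x0. linear (\<theta> x)" by (simp add: linear_\<theta>)
  define \<tau> where "\<tau> u z = \<theta>' z u - \<theta> x0 (?\<Gamma> (P x0 u) z)" for u z
  have \<tau>s: "\<tau> u (tm p v) = \<tau> v (tm p u)" for u v
    using second_fundamental_form_symmetric[where \<Gamma> = ?\<Gamma>, OF lin\<theta> \<theta>' B Bs \<Gamma> \<theta>_P, of u v] by (simp add: \<tau>_def P_p)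
  have l: "linear (\<theta>' z)" for z using \<theta>' has_derivative_linear by blast
  have lt: "linear (tm p)" by (rule tm(1)[OF p])
  have \<Gamma>l: "?\<Gamma> (a *\<^sub>R y + b *\<^sub>R y') z = a *\<^sub>R ?\<Gamma> y z + b *\<^sub>R ?\<Gamma> y' z" for a b y y' z
    by (simp add: \<Gamma>[of _ z] linear_add[OF N.linear_christoffel] linear_cmul[OF N.linear_christoffel])
  have \<tau>l: "\<tau> (a *\<^sub>R u + b *\<^sub>R v) z = a * \<tau> u z + b * \<tau> v z" for a b u v z
    by (simp add: \<tau>_def P_p linear_add[OF l] linear_cmul[OF l] linear_add[OF lt] linear_cmul[OF lt] \<Gamma>l
      linear_add[OF linear_\<theta>] linear_cmul[OF linear_\<theta>] algebra_simps)
  define h where "h u v = - \<tau> u (tm p v)" for u v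
  have "sym_bilinear_on (H p) h"
    unfolding sym_bilinear_on_def by (simp add: h_def \<tau>l algebra_simps) (metis \<tau>s)
  moreover have "coord_d (\<eta>N j) x0 u v = h (KH p j u) v - h u (KH p j v)"
    if uv: "u \<in> H p" "v \<in> H p" for j u v
  proof -
    have z: "\<theta> x0 (k l x0 (P x0 w)) = 0" if "w \<in> H p" for l w
      using that \<eta>N_kernel_p by (auto simp: \<eta>N_def)
    have "coord_d (\<eta>N j) x0 u v = \<tau> u (k j x0 (P x0 v)) - \<tau> v (k j x0 (P x0 u))
        + \<theta> x0 (\<Sum>l\<in>UNIV. \<beta> j l u *\<^sub>R k l x0 (P x0 v)) - \<theta> x0 (\<Sum>l\<in>UNIV. \<beta> j l v *\<^sub>R k l x0 (P x0 u))"
      unfolding \<tau>_def \<beta>[symmetric]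
      by (rule coord_d_twisted[where \<Gamma> = ?\<Gamma> and J = "k j", OF lin\<theta> eventually_linear_k \<theta>' k' B Bs \<Gamma>]) (simp add: \<eta>N_def)
    also have "\<dots> = \<tau> u (tm p (KH p j v)) - \<tau> v (tm p (KH p j u))"
      using z uv by (simp add: linear_sum[OF linear_\<theta>] linear_cmul[OF linear_\<theta>] k_p P_p tm_KH[OF p fp])
    also have "\<dots> = h (KH p j u) v - h u (KH p j v)"
      by (simp add: h_def \<tau>s[of v])
    finally show ?thesis .
  qed
  ultimately show ?thesis using that by blast
qed

section \<open>Comparison of adapted frames with the conormal frame\<close>

lemma frame_coords:
  assumes fr: "qc_frame M H g V \<eta> I" and pV: "p \<in> V"
  defines "e \<equiv> \<lambda>i x v. form_coord M c (\<eta> i) x v"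
  shows "(\<lambda>x. e i x v) differentiable (at x0)"
    "\<forall>\<^sub>F x in nhds x0. \<forall>i. linear (e i x) \<and> linear (\<eta>N i x)"
    "\<forall>\<^sub>F x in nhds x0. \<forall>v. (\<forall>i. e i x v = 0) \<longleftrightarrow> (\<forall>i. \<eta>N i x v = 0)"
    "e i x0 v = blinfun_apply (\<eta> i p) v"
    "ext_deriv M (\<eta> i) p u v = coord_d (e i) x0 u v"
    "\<exists>w. \<forall>j k. e j x0 (w k) = (if j = k then 1 else 0)"
proof -
  have V: "mopen M V" and sm: "\<And>i. smooth_form M V (\<eta> i)"
    and HV: "\<And>q. q \<in> V \<Longrightarrow> H q = {v. \<forall>i. blinfun_apply (\<eta> i q) v = 0}"
    using fr by (auto simp: qc_frame_def)
  show "(\<lambda>x. e i x v) differentiable (at x0)"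
    unfolding e_def x0_def using c pV
    by (intro smooth_on_differentiable[OF M.smooth_form_coord[OF c(1) V sm]]) auto
  show lin: "\<forall>\<^sub>F x in nhds x0. \<forall>i. linear (e i x) \<and> linear (\<eta>N i x)"
    by (rule eventually_U[OF V pV]) (use UD M.linear_form_coord[OF c(1)] linear_\<eta>N in \<open>auto simp: e_def\<close>)
  have ker: "(\<forall>i. e i (snd c q) v = 0) \<longleftrightarrow> (\<forall>i. \<eta>N i (snd c q) v = 0)" if "q \<in> U" "q \<in> V" for q v
    unfolding \<eta>N_kernel[OF that(1)] HV[OF that(2)] e_def
    using UD[OF that(1)] by (simp add: M.form_coord_chart[OF c(1)])
  show "\<forall>\<^sub>F x in nhds x0. \<forall>v. (\<forall>i. e i x v = 0) \<longleftrightarrow> (\<forall>i. \<eta>N i x v = 0)"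
    by (rule eventually_U[OF V pV]) (simp add: ker)
  show ep: "e i x0 v = blinfun_apply (\<eta> i p) v" for i v
    unfolding e_def x0_def using M.form_coord_chart[OF c] M.coord_vf_self[OF p] by (simp add: c_def)
  show "ext_deriv M (\<eta> i) p u v = coord_d (e i) x0 u v"
    unfolding e_def x0_def c_def by (rule M.ext_deriv_coord_d)
  have "{v. \<forall>i. e i x0 v = 0} = H p" using HV[OF pV] by (simp add: ep)
  then have "dim {v. \<forall>j. e j x0 v = 0} + CARD(3) = DIM(real ^ 7)" using Hdim[OF p] by simp
  moreover have "linear (e j x0)" for j using eventually_nhds_x_imp_x[OF lin] by blast
  ultimately show "\<exists>w. \<forall>j k. e j x0 (w k) = (if j = k then 1 else 0)"
    using dual_vectors_exist[where \<eta> = "\<lambda>j. e j x0"] by blast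
qed

lemma frame_inner:
  assumes "qc_compatible M H g" "qc_frame M H g V \<eta> I" "p \<in> V"
  shows "inner_on (H p) (g p)" "quaternionic_structure (H p) (\<lambda>i. I i p)"
    "\<And>i u v. u \<in> H p \<Longrightarrow> v \<in> H p \<Longrightarrow> ext_deriv M (\<eta> i) p u v = g p (I i p u) v"
    "\<And>i u v. u \<in> H p \<Longrightarrow> v \<in> H p \<Longrightarrow> g p (I i p u) v = - g p u (I i p v)"
proof -
  show g: "inner_on (H p) (g p)"
    using assms(1) p by (auto simp: qc_compatible_def intro: metric_inner_on)
  show I: "quaternionic_structure (H p) (\<lambda>i. I i p)"
    and e: "\<And>i u v. u \<in> H p \<Longrightarrow> v \<in> H p \<Longrightarrow> ext_deriv M (\<eta> i) p u v = g p (I i p u) v"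
    using assms(2,3) by (auto simp: qc_frame_def)
  interpret g: inner_product "H p" "g p"
    using H_subspace[OF p fp] g by unfold_locales (auto simp: inner_on_def)
  interpret I: quaternionic "H p" "\<lambda>i. I i p" using H_subspace[OF p fp] I by unfold_locales
  show "g p (I i p u) v = - g p u (I i p v)" if uv: "u \<in> H p" "v \<in> H p" for i u v
  proof -
    have "ext_deriv M (\<eta> i) p u v = - ext_deriv M (\<eta> i) p v u" by (simp add: ext_deriv_def Let_def)
    then show ?thesis using e[OF uv, of i] e[OF uv(2,1), of i] g.sym[of u "I i p v"] uv by simp
  qed
qed

lemma coefficients_\<eta>N:
  assumes fr: "qc_frame M H g V \<eta> I" and pV: "p \<in> V"
  obtains A where "\<And>i j. A i j differentiable (at x0)"
    "\<forall>\<^sub>F x in nhds x0. \<forall>i v. form_coord M c (\<eta> i) x v = (\<Sum>j\<in>UNIV. A i j x * \<eta>N j x v)"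
proof -
  note e = frame_coords[OF fr pV]
  obtain w where w: "\<And>j k. \<eta>N j x0 (w k) = (if j = k then 1 else 0)" using \<eta>N_dual by blast
  have ker: "\<forall>\<^sub>F x in nhds x0. \<forall>v. (\<forall>j. \<eta>N j x v = 0) \<longrightarrow> (\<forall>i. form_coord M c (\<eta> i) x v = 0)"
    using e(3) by eventually_elim blast
  from coefficient_functions[where \<zeta> = \<eta>N, OF e(2) ker e(1) \<eta>N_derivative w] that
  show ?thesis by blast
qed

text \<open>The forms \<open>\<eta>N j\<close> link the two metrics. For \<open>g'\<close>, whose
  structure spans \<open>Q\<close> on \<open>H\<close>, \<open>hermitian_defect_scalar\<close> makes
  their exterior derivatives on \<open>H\<close> equal to \<open>s * g' p (KH p j u) v\<close>. The
  given \<open>\<eta> i\<close> are combinations of the \<open>\<eta>N j\<close>, and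
  \<open>conformal_rigidity\<close> then determines \<open>I\<close>. The conormal
  \<open>\<theta>0\<close> is left free because the comparison is also made at nearby points, where
  the conormal carried over from the point of interest may be another multiple.\<close>

lemma pointwise_comparison:
  assumes fr: "qc_compatible M H g" "qc_frame M H g V \<eta> I" "p \<in> V"
    and fr': "qc_compatible M H g'" "qc_frame M H g' V' \<eta>' I'" "p \<in> V'"
    and QI: "\<forall>L\<in>Q (f p). \<exists>a. \<forall>v\<in>H p. blinfun_apply L (tm p v) = tm p (\<Sum>i\<in>UNIV. a i *\<^sub>R I' i p v)"
    and IQ: "\<forall>a. \<exists>L\<in>Q (f p). \<forall>v\<in>H p. blinfun_apply L (tm p v) = tm p (\<Sum>i\<in>UNIV. a i *\<^sub>R I' i p v)"
    and \<theta>0: "linear \<theta>0" "\<And>z. \<theta>0 z = 0 \<longleftrightarrow> z \<in> range (tm p)"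
    and A: "\<And>i v. blinfun_apply (\<eta> i p) v = (\<Sum>j\<in>UNIV. A i j * \<theta>0 (blinfun_apply (K j (f p)) (tm p v)))"
  shows "\<exists>\<sigma>. \<sigma> \<noteq> 0 \<and> so3 (\<lambda>i j. \<sigma> * A i j) \<and>
    (\<forall>i. \<forall>v\<in>H p. tm p (I i p v) = (\<Sum>j\<in>UNIV. (\<sigma> * A i j) *\<^sub>R blinfun_apply (K j (f p)) (tm p v)))"
proof -
  note g = frame_inner[OF fr] and g' = frame_inner[OF fr']
  note S = H_subspace[OF p fp] and t = tm_KH[OF p fp]
  have inj: "u = v" if "tm p u = tm p v" for u v using tm(2)[OF p] that by (simp add: inj_def)
  note l = linear_sum[OF tm(1)[OF p]] linear_cmul[OF tm(1)[OF p]]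
  obtain Z where Z: "Z \<in> H p" "Z \<noteq> 0" using H_nonzero[OF p] by blast
  interpret K: quaternionic "H p" "KH p" using S quaternionic_KH[OF p fp] by unfold_locales
  interpret I': quaternionic_inner "H p" "\<lambda>i. I' i p" "g' p"
    using S g'(1,2,4) by unfold_locales (auto simp: inner_on_def)
  have "\<exists>b. \<forall>v\<in>H p. KH p j v = I'.im b v" for j
  proof -
    have "K j (f p) \<in> Q (f p)" using QK[OF fp] by (auto intro: span_base)
    then obtain b where "\<forall>v\<in>H p. blinfun_apply (K j (f p)) (tm p v) = tm p (\<Sum>i\<in>UNIV. b i *\<^sub>R I' i p v)"
      using QI by blast
    then have "\<forall>v\<in>H p. KH p j v = I'.im b v"
      using t inj by (simp add: I'.im_def)
    then show ?thesis by blast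
  qed
  then obtain b where b: "\<And>j v. v \<in> H p \<Longrightarrow> KH p j v = I'.im (b j) v" by metis
  have "\<exists>b. \<forall>v\<in>H p. I'.im a v = K.im b v" for a
  proof -
    obtain L where L: "L \<in> Q (f p)" "\<And>v. v \<in> H p \<Longrightarrow> blinfun_apply L (tm p v) = tm p (I'.im a v)"
      using IQ unfolding I'.im_def by meson
    from L(1) QK[OF fp] have "L \<in> span (range (\<lambda>i. K i (f p)))" by simp
    from span_range_real[OF this] obtain d where d: "L = (\<Sum>i\<in>UNIV. d i *\<^sub>R K i (f p))" by blast
    have "I'.im a v = K.im d v" if v: "v \<in> H p" for v
      by (rule inj) (simp add: L(2)[OF v, symmetric] d K.im_def l t[OF v] blinfun.sum_left blinfun.scaleR_left)
    then show ?thesis by blast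
  qed
  then obtain m where m: "\<And>a v. v \<in> H p \<Longrightarrow> I'.im a v = K.im (m a) v" by metis
  \<comment> \<open>The \<open>KH p j\<close> are combinations of the \<open>I' i p\<close> and
    hence also skew for \<open>g'\<close>.\<close>
  interpret Kg: quaternionic_inner "H p" "KH p" "g' p"
    using I'.im_skew by unfold_locales (simp add: b)
  obtain h where h: "sym_bilinear_on (H p) h" and dh: "\<And>j u v. u \<in> H p \<Longrightarrow> v \<in> H p \<Longrightarrow>
      coord_d (\<eta>N j) x0 u v = h (KH p j u) v - h u (KH p j v)" using \<eta>N_coord_d by blast
  have \<eta>N0: "\<eta>N j x0 v = 0" if "v \<in> H p" for j v using that \<eta>N_kernel_p by blast
  \<comment> \<open>On \<open>H\<close>, combining the \<open>\<eta>' i\<close> turns their exterior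
    derivatives into \<open>g'\<close> composed with combinations of the \<open>I' i p\<close>,
    which \<open>m\<close> rewrites through the \<open>KH p j\<close>.\<close>
  have "\<exists>C. \<forall>j. \<forall>u\<in>H p. \<forall>v\<in>H p. coord_d (\<eta>N j) x0 u v = g' p (K.im (C j) u) v"
  proof -
    note e = frame_coords[OF fr'(2,3)]
    obtain w where w: "\<And>j k. form_coord M c (\<eta>' j) x0 (w k) = (if j = k then 1 else 0)" using e(6) by blast
    have lin: "\<forall>\<^sub>F x in nhds x0. \<forall>i. linear (\<eta>N i x) \<and> linear (form_coord M c (\<eta>' i) x)"
      using e(2) by eventually_elim blast
    have ker: "\<forall>\<^sub>F x in nhds x0. \<forall>v. (\<forall>j. form_coord M c (\<eta>' j) x v = 0) \<longrightarrow> (\<forall>i. \<eta>N i x v = 0)"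
      using e(3) by eventually_elim blast
    obtain D where D: "\<And>i j. D i j differentiable (at x0)"
      "\<forall>\<^sub>F x in nhds x0. \<forall>i v. \<eta>N i x v = (\<Sum>j\<in>UNIV. D i j x * form_coord M c (\<eta>' j) x v)"
      using coefficient_functions[where \<eta> = \<eta>N, OF lin ker \<eta>N_derivative e(1) w] by blast
    have "coord_d (\<eta>N j) x0 u v = g' p (K.im (m (\<lambda>i. D j i x0)) u) v" if uv: "u \<in> H p" "v \<in> H p" for j u v
    proof -
      have D2: "\<forall>\<^sub>F x in nhds x0. \<forall>v. \<eta>N j x v = (\<Sum>i\<in>UNIV. D j i x * form_coord M c (\<eta>' i) x v)"
        using D(2) by eventually_elim blast
      have z: "form_coord M c (\<eta>' i) x0 w = 0" if "w \<in> H p" for i w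
        using \<eta>N0[OF that] eventually_nhds_x_imp_x[OF e(3)] by blast
      have "coord_d (\<eta>N j) x0 u v = (\<Sum>i\<in>UNIV. D j i x0 * coord_d (form_coord M c (\<eta>' i)) x0 u v)"
        by (rule coord_d_combination[OF D(1) e(1) D2 z z]) (use uv in auto)
      also have "\<dots> = (\<Sum>i\<in>UNIV. D j i x0 * g' p (I' i p u) v)"
        using g'(3)[OF uv] by (simp add: e(5))
      also have "\<dots> = g' p (I'.im (\<lambda>i. D j i x0) u) v" using uv by (simp add: I'.im_3 sum_3)
      finally show ?thesis using uv by (simp add: m)
    qed
    then show ?thesis by (intro exI[of _ "\<lambda>j. m (\<lambda>i. D j i x0)"]) blast
  qed
  then obtain C where C: "\<And>j u v. u \<in> H p \<Longrightarrow> v \<in> H p \<Longrightarrow> coord_d (\<eta>N j) x0 u v = g' p (K.im (C j) u) v"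
    by blast
  have "\<exists>s. \<forall>j k. C j k = (if j = k then s else 0)"
    by (rule Kg.hermitian_defect_scalar[OF h Z]) (simp add: C[symmetric] dh)
  then obtain s where s: "\<And>j k. C j k = (if j = k then s else 0)" by blast
  have "K.im (C j) v = s *\<^sub>R KH p j v" for j v
    by (simp add: K.im_def s if_distrib[of "\<lambda>c. c *\<^sub>R _"] if_distribR cong: if_cong)
  then have ds: "coord_d (\<eta>N j) x0 u v = s * g' p (KH p j u) v" if "u \<in> H p" "v \<in> H p" for j u v
    using C[OF that] that by simp
  note e = frame_coords[OF fr(2,3)]
  obtain A' where A': "\<And>i j. A' i j differentiable (at x0)"
    "\<forall>\<^sub>F x in nhds x0. \<forall>i v. form_coord M c (\<eta> i) x v = (\<Sum>j\<in>UNIV. A' i j x * \<eta>N j x v)"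
    using coefficients_\<eta>N[OF fr(2,3)] by blast
  define B where "B i j = s * A' i j x0" for i j
  have "g p (I i p u) v = g' p (K.im (B i) u) v" if uv: "u \<in> H p" "v \<in> H p" for i u v
  proof -
    have "\<forall>\<^sub>F x in nhds x0. \<forall>v. form_coord M c (\<eta> i) x v = (\<Sum>j\<in>UNIV. A' i j x * \<eta>N j x v)"
      using A'(2) by eventually_elim blast
    then have "coord_d (form_coord M c (\<eta> i)) x0 u v = (\<Sum>j\<in>UNIV. A' i j x0 * coord_d (\<eta>N j) x0 u v)"
      by (rule coord_d_combination[OF A'(1) \<eta>N_derivative]) (use uv \<eta>N0 in auto)
    then show ?thesis
      using g(3)[OF uv, of i] uv by (simp add: e(5) ds K.im_3 sum_3 B_def algebra_simps)
  qed
  from Kg.conformal_rigidity[OF g(2,1) Z this] obtain \<gamma> where \<gamma>: "\<gamma> \<noteq> 0"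
    "\<And>i v. v \<in> H p \<Longrightarrow> K.im (B i) v = \<gamma> *\<^sub>R I i p v" by blast
  have lx: "linear (\<theta> x0)" by (rule linear_\<theta>)
  have "\<theta> x0 z = 0 \<longleftrightarrow> \<theta>0 z = 0" for z
  proof -
    have "P x0 = tm p" using P_p by blast
    then show ?thesis using \<theta>_eq_0_iff[OF U(2), of z] \<theta>0(2) by (simp add: x0_def)
  qed
  from same_kernel_proportional[OF lx \<theta>0(1) this] obtain r where
    r: "r \<noteq> 0" "\<And>z. \<theta> x0 z = r * \<theta>0 z" by blast
  have AA: "A i j = r * A' i j x0" for i j
  proof -
    obtain w where w: "\<And>j k. \<eta>N j x0 (w k) = (if j = k then 1 else 0)" using \<eta>N_dual by blast
    have 1: "blinfun_apply (\<eta> i p) (w j) = A' i j x0"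
      using eventually_nhds_x_imp_x[OF A'(2)] e(4)[of i "w j"] by (simp add: w if_distrib cong: if_cong)
    have th: "\<theta>0 (blinfun_apply (K l (f p)) (tm p (w j))) = (if l = j then 1 / r else 0)" for l
      using w[of l j] r by (auto simp: \<eta>N_p field_simps)
    have "blinfun_apply (\<eta> i p) (w j) = A i j / r"
      unfolding A th by (simp add: if_distrib cong: if_cong)
    with 1 r(1) show ?thesis by (simp add: field_simps)
  qed
  \<comment> \<open>\<open>s\<close> is the scale of the exterior derivatives of the
    \<open>\<eta>N j\<close>, \<open>\<gamma>\<close> the ratio of the two metrics and
    \<open>r\<close> the ratio of the two conormals.\<close>
  define \<sigma> where "\<sigma> = s / (\<gamma> * r)"
  have \<sigma>A: "\<sigma> * A i j = B i j / \<gamma>" for i j using r(1) by (simp add: \<sigma>_def AA B_def)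
  have I: "I i p v = (\<Sum>j\<in>UNIV. (\<sigma> * A i j) *\<^sub>R KH p j v)" if v: "v \<in> H p" for i v
  proof -
    have "(\<Sum>j\<in>UNIV. (\<sigma> * A i j) *\<^sub>R KH p j v) = (1 / \<gamma>) *\<^sub>R K.im (B i) v"
      by (simp add: \<sigma>A K.im_def scaleR_sum_right)
    then show ?thesis using \<gamma> v by simp
  qed
  have so: "so3 (\<lambda>i j. \<sigma> * A i j)"
    by (rule quaternionic_structure_so3[OF S quaternionic_KH[OF p fp] g(2) Z I])
  have "\<sigma> \<noteq> 0"
  proof
    assume "\<sigma> = 0"
    then show False using so by (simp add: so3_def)
  qed
  moreover have "tm p (I i p v) = (\<Sum>j\<in>UNIV. (\<sigma> * A i j) *\<^sub>R blinfun_apply (K j (f p)) (tm p v))"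
    if "v \<in> H p" for i v
    unfolding I[OF that] by (simp add: l t[OF that])
  ultimately show ?thesis using so by blast
qed

end

context qc_setup
begin

definition spans_Q :: "'b \<Rightarrow> (3 \<Rightarrow> 'b \<Rightarrow> real ^ 7 \<Rightarrow> real ^ 7) \<Rightarrow> bool" where
  "spans_Q q I \<longleftrightarrow>
    (\<forall>L\<in>Q (f q). \<exists>a. \<forall>v\<in>H q. blinfun_apply L (tm q v) = tm q (\<Sum>i\<in>UNIV. a i *\<^sub>R I i q v)) \<and>
    (\<forall>a. \<exists>L\<in>Q (f q). \<forall>v\<in>H q. blinfun_apply L (tm q v) = tm q (\<Sum>i\<in>UNIV. a i *\<^sub>R I i q v))"

text \<open>Instantiates the pointwise setting at another point \<open>q\<close> with its own
  charts; only \<open>\<theta>0\<close> and \<open>A\<close> are carried over from outside.\<close>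

lemma comparison_at:
  assumes q: "q \<in> points M" "f q \<in> VN"
    and fr: "qc_compatible M H g" "qc_frame M H g V \<eta> I" "q \<in> V"
    and hyp: "qc_compatible M H g'" "\<exists>V' \<eta>' I'. q \<in> V' \<and> qc_frame M H g' V' \<eta>' I' \<and> spans_Q q I'"
    and \<theta>0: "linear \<theta>0" "\<And>z. \<theta>0 z = 0 \<longleftrightarrow> z \<in> range (tm q)"
    and A: "\<And>i v. blinfun_apply (\<eta> i q) v = (\<Sum>j\<in>UNIV. A i j * \<theta>0 (blinfun_apply (K j (f q)) (tm q v)))"
  shows "\<exists>\<sigma>. \<sigma> \<noteq> 0 \<and> so3 (\<lambda>i j. \<sigma> * A i j) \<and>
    (\<forall>i. \<forall>v\<in>H q. tm q (I i q v) = (\<Sum>j\<in>UNIV. (\<sigma> * A i j) *\<^sub>R blinfun_apply (K j (f q)) (tm q v)))"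
proof -
  interpret q: qc_point N nabla M Q f K VN bas q using q by unfold_locales
  show ?thesis
    using hyp(2) q.pointwise_comparison[OF fr hyp(1) _ _ _ _ \<theta>0 A] unfolding spans_Q_def by blast
qed

end

section \<open>Differentiable adaptation and vanishing of the torsion\<close>

context qc_point
begin

text \<open>The factor \<open>\<sigma>\<close> is differentiable because \<open>\<sigma> A\<close> is in SO(3): its third row is the cross product of
  the first two, so that \<open>A\<^sub>3 = \<sigma> A\<^sub>1 \<times> A\<^sub>2\<close>.\<close>

lemma adapted_coefficients:
  assumes fr: "qc_compatible M H g" "qc_frame M H g V \<eta> I" "p \<in> V"
    and hyp: "qc_compatible M H g'"
      "\<And>q. q \<in> points M \<Longrightarrow> \<exists>V' \<eta>' I'. q \<in> V' \<and> qc_frame M H g' V' \<eta>' I' \<and> spans_Q q I'"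
  obtains \<sigma> A where "\<sigma> differentiable (at x0)" "\<And>i j. A i j differentiable (at x0)"
    "\<forall>\<^sub>F x in nhds x0. \<forall>i v. form_coord M c (\<eta> i) x v = (\<Sum>j\<in>UNIV. A i j x * \<eta>N j x v)"
    "\<forall>\<^sub>F x in nhds x0. \<sigma> x \<noteq> 0 \<and> so3 (\<lambda>i j. \<sigma> x * A i j x)"
    "\<And>i v. v \<in> H p \<Longrightarrow> tm p (I i p v) = (\<Sum>j\<in>UNIV. (\<sigma> x0 * A i j x0) *\<^sub>R k j x0 (tm p v))"
proof -
  obtain A where A: "\<And>i j. A i j differentiable (at x0)"
    and Aeq: "\<forall>\<^sub>F x in nhds x0. \<forall>i v. form_coord M c (\<eta> i) x v = (\<Sum>j\<in>UNIV. A i j x * \<eta>N j x v)"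
    using coefficients_\<eta>N[OF fr(2,3)] by blast
  have V: "mopen M V" using fr(2) by (simp add: qc_frame_def)
  let ?R = "\<lambda>x. (\<forall>i v. form_coord M c (\<eta> i) x v = (\<Sum>j\<in>UNIV. A i j x * \<eta>N j x v)) \<longrightarrow>
    (\<exists>\<sigma>. \<sigma> \<noteq> 0 \<and> so3 (\<lambda>i j. \<sigma> * A i j x))"
  have "\<forall>\<^sub>F x in nhds x0. ?R x"
  proof (rule eventually_U[OF V fr(3)], rule impI)
    fix q assume q: "q \<in> U" "q \<in> V"
      and eq: "\<forall>i v. form_coord M c (\<eta> i) (snd c q) v = (\<Sum>j\<in>UNIV. A i j (snd c q) * \<eta>N j (snd c q) v)"
    \<comment> \<open>The conormal in the chart \<open>d\<close> around \<open>f p\<close>,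
      transported by \<open>Td\<close> to the preferred chart at \<open>f q\<close>; relative to it
      the coefficients at \<open>q\<close> are those of the fixed chart.\<close>
    let ?x = "snd c q" and ?\<theta>0 = "\<lambda>z. \<theta> (snd c q) (Td q z)"
    have q': "q \<in> points M" "f q \<in> VN" "q \<in> fst c" using UD[OF q(1)] by auto
    have 1: "linear ?\<theta>0" using linear_compose[OF Td(1)[OF q(1)] linear_\<theta>[of ?x]] by (simp add: o_def)
    have 2: "?\<theta>0 z = 0 \<longleftrightarrow> z \<in> range (tm q)" for z
      unfolding \<theta>_eq_0_iff[OF q(1)] by (rule range_P[OF q(1)])
    have 3: "blinfun_apply (\<eta> i q) w = (\<Sum>j\<in>UNIV. A i j ?x * ?\<theta>0 (blinfun_apply (K j (f q)) (tm q w)))" for i w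
    proof -
      obtain v where v: "w = M.coord_vf c v q" using coord_vf_surj[OF q(1)] by metis
      show ?thesis
        using eq[rule_format, of i v] q' by (simp add: v M.form_coord_chart[OF c(1)] \<eta>N_def
            P_chart[OF q(1), of v] k_chart[OF q(1)])
    qed
    show "\<exists>\<sigma>. \<sigma> \<noteq> 0 \<and> so3 (\<lambda>i j. \<sigma> * A i j ?x)"
      using comparison_at[OF q'(1,2) fr(1,2) q(2) hyp(1) hyp(2)[OF q'(1)] 1 2 3] by blast
  qed
  with Aeq have ev: "\<forall>\<^sub>F x in nhds x0. \<exists>\<sigma>. \<sigma> \<noteq> 0 \<and> so3 (\<lambda>i j. \<sigma> * A i j x)"
    by eventually_elim blast
  have Pp: "P x0 = tm p" using P_p by blast
  have "\<exists>\<sigma>. \<sigma> \<noteq> 0 \<and> so3 (\<lambda>i j. \<sigma> * A i j x0) \<and> (\<forall>i. \<forall>v\<in>H p. tm p (I i p v) =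
      (\<Sum>j\<in>UNIV. (\<sigma> * A i j x0) *\<^sub>R blinfun_apply (K j (f p)) (tm p v)))"
  proof (rule comparison_at[OF p fp fr hyp(1) hyp(2)[OF p] linear_\<theta>[of x0]])
    show "\<theta> x0 z = 0 \<longleftrightarrow> z \<in> range (tm p)" for z
      using \<theta>_eq_0_iff[OF U(2), of z] Pp by (simp add: x0_def)
    show "blinfun_apply (\<eta> i p) v = (\<Sum>j\<in>UNIV. A i j x0 * \<theta> x0 (blinfun_apply (K j (f p)) (tm p v)))" for i v
      using eventually_nhds_x_imp_x[OF Aeq] frame_coords(4)[OF fr(2,3), of i v] by (simp add: \<eta>N_p)
  qed
  then obtain \<sigma>0 where \<sigma>0: "\<sigma>0 \<noteq> 0" "so3 (\<lambda>i j. \<sigma>0 * A i j x0)" "\<And>i v. v \<in> H p \<Longrightarrow> tm p (I i p v) =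
      (\<Sum>j\<in>UNIV. (\<sigma>0 * A i j x0) *\<^sub>R blinfun_apply (K j (f p)) (tm p v))" by blast
  define X where "X l x = (if l = (1::3) then A 1 2 x * A 2 3 x - A 1 3 x * A 2 2 x else
      if l = 2 then A 1 3 x * A 2 1 x - A 1 1 x * A 2 3 x else A 1 1 x * A 2 2 x - A 1 2 x * A 2 1 x)" for l x
  have dX: "X l differentiable (at x0)" for l
  proof -
    have "\<forall>l. X l differentiable (at x0)"
      unfolding forall_3 X_def[abs_def] using A by (auto intro!: differentiable_diff differentiable_mult)
    then show ?thesis by blast
  qed
  have AX: "A 3 l x = \<sigma> * X l x" if "\<sigma> \<noteq> 0" "so3 (\<lambda>i j. \<sigma> * A i j x)" for \<sigma> x l
  proof -
    have e: "\<sigma> * A 3 1 x = \<sigma> * A 1 2 x * (\<sigma> * A 2 3 x) - \<sigma> * A 1 3 x * (\<sigma> * A 2 2 x)"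
      "\<sigma> * A 3 2 x = \<sigma> * A 1 3 x * (\<sigma> * A 2 1 x) - \<sigma> * A 1 1 x * (\<sigma> * A 2 3 x)"
      "\<sigma> * A 3 3 x = \<sigma> * A 1 1 x * (\<sigma> * A 2 2 x) - \<sigma> * A 1 2 x * (\<sigma> * A 2 1 x)"
      using that(2) unfolding so3_def by blast+
    have "\<forall>l. \<sigma> * A 3 l x = \<sigma> * (\<sigma> * X l x)"
      unfolding forall_3 e X_def by (simp add: algebra_simps)
    then show ?thesis using that(1) by simp
  qed
  have "\<exists>l. A 3 l x0 \<noteq> 0"
  proof (rule ccontr)
    assume "\<nexists>l. A 3 l x0 \<noteq> 0"
    then show False using \<sigma>0(2) by (auto simp: so3_def dest: spec[of _ 3])
  qed
  then obtain l where l: "A 3 l x0 \<noteq> 0" by blast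
  then have Xl: "X l x0 \<noteq> 0" using AX[OF \<sigma>0(1,2), of l] by auto
  \<comment> \<open>One column suffices: the third row has a nonzero entry at \<open>x0\<close>, so
    \<open>X l\<close> is nonzero near \<open>x0\<close>, and there the quotient equals whatever
    scalar the comparison provides.\<close>
  define \<sigma> where "\<sigma> x = A 3 l x / X l x" for x
  have \<sigma>eq: "\<sigma> x = s" if "X l x \<noteq> 0" "s \<noteq> 0" "so3 (\<lambda>i j. s * A i j x)" for s x
    using AX[OF that(2,3), of l] that(1) by (simp add: \<sigma>_def)
  have d\<sigma>: "\<sigma> differentiable (at x0)"
    unfolding \<sigma>_def[abs_def] using A dX Xl by (intro differentiable_divide) auto
  have "\<forall>\<^sub>F x in nhds x0. X l x \<noteq> 0" by (rule eventually_nonzero[OF dX Xl])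
  with ev have ev\<sigma>: "\<forall>\<^sub>F x in nhds x0. \<sigma> x \<noteq> 0 \<and> so3 (\<lambda>i j. \<sigma> x * A i j x)"
  proof eventually_elim
    case (elim x)
    then obtain s where "s \<noteq> 0" "so3 (\<lambda>i j. s * A i j x)" by blast
    with \<sigma>eq[OF elim(2) this] show ?case by simp
  qed
  have "\<sigma> x0 = \<sigma>0" by (rule \<sigma>eq[OF Xl \<sigma>0(1,2)])
  then show ?thesis
    using \<sigma>0(3) by (intro that[OF d\<sigma> A Aeq ev\<sigma>]) (simp add: k_p)
qed

text \<open>Near \<open>x0\<close> the coefficients \<open>Cf\<close> are rotations, so the
  combinations \<open>J i\<close> of the frame \<open>k\<close> stay quaternionic on a neighbourhood
  and their relations can be differentiated. The resulting skew matrix \<open>a\<close> is what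
  \<open>torsion_free_frame_exists\<close> asks for.\<close>

lemma vertical_torsion_0:
  assumes fr: "qc_compatible M H g" "qc_frame M H g V \<eta> I" "p \<in> V"
    and hyp: "qc_compatible M H g'"
      "\<And>q. q \<in> points M \<Longrightarrow> \<exists>V' \<eta>' I'. q \<in> V' \<and> qc_frame M H g' V' \<eta>' I' \<and> spans_Q q I'"
  shows "tensor_eq_on (H p) (vertical_torsion M H \<eta> I p) (\<lambda>X Y Z l m. 0)"
proof -
  obtain \<sigma> A where d\<sigma>: "\<sigma> differentiable (at x0)" and dA: "\<And>i j. A i j differentiable (at x0)"
    and Aeq: "\<forall>\<^sub>F x in nhds x0. \<forall>i v. form_coord M c (\<eta> i) x v = (\<Sum>j\<in>UNIV. A i j x * \<eta>N j x v)"
    and ev\<sigma>: "\<forall>\<^sub>F x in nhds x0. \<sigma> x \<noteq> 0 \<and> so3 (\<lambda>i j. \<sigma> x * A i j x)"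
    and IK: "\<And>i v. v \<in> H p \<Longrightarrow> tm p (I i p v) = (\<Sum>j\<in>UNIV. (\<sigma> x0 * A i j x0) *\<^sub>R k j x0 (tm p v))"
    using adapted_coefficients[OF fr hyp] by blast
  note g = frame_inner[OF fr] and e = frame_coords[OF fr(2,3)]
  obtain \<theta>' where \<theta>': "\<And>z. ((\<lambda>x. \<theta> x z) has_derivative \<theta>' z) (at x0)" using \<theta>_derivative by blast
  obtain B where B: "\<And>v. ((\<lambda>x. P x v) has_derivative B v) (at x0)" and Bs: "\<And>u v. B u v = B v u"
    using P_derivative by blast
  obtain k' \<beta> where k': "\<And>j e. ((\<lambda>x. k j x e) has_derivative k' j e) (at x0)"
    and \<beta>: "\<And>j e u. k' j e u + N.christoffel (f p) (P x0 u) (k j x0 e)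
      - k j x0 (N.christoffel (f p) (P x0 u) e) = (\<Sum>l\<in>UNIV. \<beta> j l u *\<^sub>R k l x0 e)"
    using k_derivative by blast
  have Pp: "P x0 = tm p" using P_p by blast
  define \<Gamma> where "\<Gamma> u = N.christoffel (f p) (P x0 u)" for u
  have \<Gamma>s: "N.christoffel (f p) y z = N.christoffel (f p) z y" for y z
    by (rule N.christoffel_symmetric[OF f_points[OF p]])
  have \<Gamma>lin: "linear (\<Gamma> u)" for u unfolding \<Gamma>_def by (rule N.linear_christoffel)
  have \<sigma>0: "\<sigma> x0 \<noteq> 0" using eventually_nhds_x_imp_x[OF ev\<sigma>] by simp
  define Cf where "Cf i j x = \<sigma> x * A i j x" for i j x
  have evC: "\<forall>\<^sub>F x in nhds x0. so3 (\<lambda>i j. Cf i j x)" using ev\<sigma> by eventually_elim (simp add: Cf_def)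
  have Cf0: "so3 (\<lambda>i j. Cf i j x0)" by (rule eventually_nhds_x_imp_x[OF evC])
  have "Cf i j differentiable (at x0)" for i j
    unfolding Cf_def[abs_def] using d\<sigma> dA by (intro differentiable_mult)
  then have Cf': "(Cf i j has_derivative frechet_derivative (Cf i j) (at x0)) (at x0)" for i j
    using frechet_derivative_works by blast
  define J where "J i x z = (\<Sum>j\<in>UNIV. Cf i j x *\<^sub>R k j x z)" for i x z
  define J' where "J' i z u = (\<Sum>j\<in>UNIV. Cf i j x0 *\<^sub>R k' j z u + frechet_derivative (Cf i j) (at x0) u *\<^sub>R k j x0 z)" for i z u
  have J': "((\<lambda>x. J i x z) has_derivative J' i z) (at x0)" for i z
    unfolding J_def J'_def by (intro has_derivative_sum has_derivative_scaleR Cf' k')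
  have "\<forall>\<^sub>F x in nhds x0. quaternionic_structure UNIV (\<lambda>j. k j x)"
    by (rule eventually_U') (rule quaternionic_k)
  with evC have qJ: "\<forall>\<^sub>F x in nhds x0. quaternionic_structure UNIV (\<lambda>i. J i x)"
  proof eventually_elim
    case (elim x)
    from so3_quaternionic_structure[OF subspace_UNIV elim(2,1)] show ?case by (simp add: J_def[abs_def])
  qed
  have qJ0: "quaternionic_structure UNIV (\<lambda>i. J i x0)" by (rule eventually_nhds_x_imp_x[OF qJ])
  interpret J: quaternionic UNIV "\<lambda>i. J i x0" using qJ0 by unfold_locales auto
  have linJ: "\<forall>\<^sub>F x in nhds x0. linear (J i x)" for i
    using qJ
  proof eventually_elim
    case (elim x)
    then interpret quaternionic UNIV "\<lambda>i. J i x" by unfold_locales auto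
    show ?case by (rule linearI) auto
  qed
  have lJ: "linear (J i x0)" for i by (rule eventually_nhds_x_imp_x[OF linJ])

  \<comment> \<open>\<open>b\<close> expands the covariant derivative of \<open>J i\<close> in the
    frame \<open>k\<close>, including the derivative of the rotation; multiplying by the transposed
    rotation gives its matrix \<open>a\<close> in the frame \<open>J\<close>.\<close>
  define b where "b i l u = frechet_derivative (Cf i l) (at x0) u + (\<Sum>j\<in>UNIV. Cf i j x0 * \<beta> j l u)" for i l u
  define a where "a i m u = (\<Sum>l\<in>UNIV. b i l u * Cf m l x0)" for i m u
  define D where "D i u z = J' i z u + \<Gamma> u (J i x0 z) - J i x0 (\<Gamma> u z)" for i u z
  have kJ: "k l x0 z = (\<Sum>m\<in>UNIV. Cf m l x0 *\<^sub>R J m x0 z)" for l z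
  proof -
    have "(\<Sum>m\<in>UNIV. Cf m l x0 *\<^sub>R J m x0 z) = (\<Sum>j\<in>UNIV. (\<Sum>m\<in>UNIV. Cf m l x0 * Cf m j x0) *\<^sub>R k j x0 z)"
      unfolding J_def scaleR_sum_right scaleR_sum_left by (subst sum.swap) simp
    also have "\<dots> = k l x0 z"
      unfolding so3_columns[OF Cf0] by (simp add: if_distrib[of "\<lambda>c. c *\<^sub>R _"] if_distribR cong: if_cong)
    finally show ?thesis by simp
  qed
  have D: "D i u z = (\<Sum>m\<in>UNIV. a i m u *\<^sub>R J m x0 z)" for i u z
  proof -
    have "D i u z = (\<Sum>j\<in>UNIV. Cf i j x0 *\<^sub>R (k' j z u + \<Gamma> u (k j x0 z) - k j x0 (\<Gamma> u z))
        + frechet_derivative (Cf i j) (at x0) u *\<^sub>R k j x0 z)"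
      by (simp add: D_def J_def J'_def linear_sum[OF \<Gamma>lin] linear_cmul[OF \<Gamma>lin] sum.distrib
          sum_subtractf scaleR_add_right scaleR_diff_right)
    also have "\<dots> = (\<Sum>j\<in>UNIV. Cf i j x0 *\<^sub>R (\<Sum>l\<in>UNIV. \<beta> j l u *\<^sub>R k l x0 z))
        + (\<Sum>l\<in>UNIV. frechet_derivative (Cf i l) (at x0) u *\<^sub>R k l x0 z)"
      by (simp add: \<Gamma>_def \<beta> sum.distrib)
    also have "(\<Sum>j\<in>UNIV. Cf i j x0 *\<^sub>R (\<Sum>l\<in>UNIV. \<beta> j l u *\<^sub>R k l x0 z)) =
        (\<Sum>l\<in>UNIV. (\<Sum>j\<in>UNIV. Cf i j x0 * \<beta> j l u) *\<^sub>R k l x0 z)"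
      unfolding scaleR_sum_right scaleR_sum_left by (subst sum.swap) simp
    finally have "D i u z = (\<Sum>l\<in>UNIV. b i l u *\<^sub>R k l x0 z)"
      by (simp add: b_def scaleR_add_left sum.distrib)
    also have "\<dots> = (\<Sum>m\<in>UNIV. a i m u *\<^sub>R J m x0 z)"
      unfolding a_def kJ scaleR_sum_right scaleR_sum_left by (subst sum.swap) simp
    finally show ?thesis .
  qed
  text \<open>Differentiating \<open>J\<^sub>i J\<^sub>j + J\<^sub>j J\<^sub>i = - 2 \<delta>\<^sub>i\<^sub>j\<close> shows that the connection matrix is skew.\<close>
  have skew: "a i j u + a j i u = 0" for i j u
  proof -
    obtain z :: "real ^ 8" where z: "z \<noteq> 0" using nonempty_Basis nonzero_Basis by blast
    have two: "(2 * r) *\<^sub>R w = r *\<^sub>R w + r *\<^sub>R w" for r and w :: "real ^ 8"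
      by (metis scaleR_add_left mult_2)
    define \<delta> :: real where "\<delta> = (if i = j then 2 else 0)"
    have JJ: "J i x0 (J j x0 w) + J j x0 (J i x0 w) = - \<delta> *\<^sub>R w" for w
    proof -
      have "\<forall>i j. J i x0 (J j x0 w) + J j x0 (J i x0 w) = - (if i = j then 2 else 0) *\<^sub>R w"
        by (simp add: forall_3 scaleR_2)
      then show ?thesis unfolding \<delta>_def by blast
    qed
    have "((\<lambda>x. J i x (J j x z) + J j x (J i x z)) has_derivative
        (\<lambda>u. (J' i (J j x0 z) u + J i x0 (J' j z u)) + (J' j (J i x0 z) u + J j x0 (J' i z u)))) (at x0)"
      by (intro has_derivative_add has_derivative_apply linJ J')
    moreover have "\<forall>\<^sub>F x in nhds x0. J i x (J j x z) + J j x (J i x z) = - \<delta> *\<^sub>R z"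
      using qJ
    proof eventually_elim
      case (elim x)
      then interpret quaternionic UNIV "\<lambda>i. J i x" by unfold_locales auto
      have "\<forall>i j. J i x (J j x z) + J j x (J i x z) = - (if i = j then 2 else 0) *\<^sub>R z"
        by (simp add: forall_3 scaleR_2)
      then show ?case unfolding \<delta>_def by blast
    qed
    ultimately have "((\<lambda>x. - \<delta> *\<^sub>R z) has_derivative
        (\<lambda>u. (J' i (J j x0 z) u + J i x0 (J' j z u)) + (J' j (J i x0 z) u + J j x0 (J' i z u)))) (at x0)"
      by (rule has_derivative_cong_nhds)
    from has_derivative_unique[OF this has_derivative_const]
    have 0: "(J' i (J j x0 z) u + J i x0 (J' j z u)) + (J' j (J i x0 z) u + J j x0 (J' i z u)) = 0"
      by meson
    have J'D: "J' i z u = D i u z - \<Gamma> u (J i x0 z) + J i x0 (\<Gamma> u z)" for i z by (simp add: D_def)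
    \<comment> \<open>The anticommutators of the \<open>J i\<close> are scalars and so commute with
      \<open>\<Gamma> u\<close>; covariant derivatives obey the same relation as ordinary
      ones.\<close>
    have "D i u (J j x0 z) + J i x0 (D j u z) + (D j u (J i x0 z) + J j x0 (D i u z)) =
        \<Gamma> u (J i x0 (J j x0 z) + J j x0 (J i x0 z)) - (J i x0 (J j x0 (\<Gamma> u z)) + J j x0 (J i x0 (\<Gamma> u z)))"
      using 0 by (simp add: J'D linear_add[OF \<Gamma>lin] algebra_simps)
    also have "\<dots> = 0" unfolding JJ by (simp add: linear_cmul[OF \<Gamma>lin] linear_neg[OF \<Gamma>lin])
    finally have "(\<Sum>m\<in>UNIV. a i m u *\<^sub>R (J m x0 (J j x0 z) + J j x0 (J m x0 z))) +
        (\<Sum>m\<in>UNIV. a j m u *\<^sub>R (J i x0 (J m x0 z) + J m x0 (J i x0 z))) = 0"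
      by (simp add: D linear_sum[OF lJ] linear_cmul[OF lJ] scaleR_add_right sum.distrib algebra_simps)
    \<comment> \<open>Different \<open>J m\<close> anticommute, so only \<open>m = j\<close>
      contributes, with \<open>J j x0 (J j x0 z) = - z\<close> counted twice.\<close>
    moreover have "(\<Sum>m\<in>UNIV. a i m u *\<^sub>R (J m x0 (J j x0 z) + J j x0 (J m x0 z))) = - (2 * a i j u) *\<^sub>R z"
    proof -
      have "\<forall>j. (\<Sum>m\<in>UNIV. a i m u *\<^sub>R (J m x0 (J j x0 z) + J j x0 (J m x0 z))) = - (2 * a i j u) *\<^sub>R z"
        by (simp add: forall_3 sum_3 scaleR_diff_right two)
      then show ?thesis by blast
    qed
    moreover have "(\<Sum>m\<in>UNIV. a j m u *\<^sub>R (J i x0 (J m x0 z) + J m x0 (J i x0 z))) = - (2 * a j i u) *\<^sub>R z"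
    proof -
      have "\<forall>i. (\<Sum>m\<in>UNIV. a j m u *\<^sub>R (J i x0 (J m x0 z) + J m x0 (J i x0 z))) = - (2 * a j i u) *\<^sub>R z"
        by (simp add: forall_3 sum_3 scaleR_diff_right two)
      then show ?thesis by blast
    qed
    ultimately have "(- (2 * a i j u) - 2 * a j i u) *\<^sub>R z = 0" by (simp add: scaleR_diff_left)
    then show ?thesis using z by simp
  qed

  \<comment> \<open>Dividing by \<open>\<sigma>\<close> undoes the factor in \<open>Cf\<close>, so
    that \<open>\<theta>s\<close> composed with \<open>J i\<close> and \<open>P\<close> is exactly
    \<open>\<eta> i\<close> in coordinates.\<close>
  define \<theta>s where "\<theta>s x z = (1 / \<sigma> x) * \<theta> x z" for x z
  have lin\<theta>s: "linear (\<theta>s x)" for x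
    by (rule linearI) (simp_all add: \<theta>s_def linear_add[OF linear_\<theta>] linear_cmul[OF linear_\<theta>] algebra_simps)
  then have ev\<theta>s: "\<forall>\<^sub>F x in nhds x0. linear (\<theta>s x)" by simp
  have "(\<lambda>x. \<theta>s x z) differentiable (at x0)" for z
    unfolding \<theta>s_def using d\<sigma> \<sigma>0 \<theta>_differentiable by (intro differentiable_mult differentiable_divide) auto
  then obtain \<theta>s' where \<theta>s': "\<And>z. ((\<lambda>x. \<theta>s x z) has_derivative \<theta>s' z) (at x0)"
    unfolding differentiable_def by metis
  have \<theta>sP: "\<forall>\<^sub>F x in nhds x0. \<forall>v. \<theta>s x (P x v) = 0"
    using \<theta>_P by eventually_elim (simp add: \<theta>s_def)
  have eJ: "\<forall>\<^sub>F x in nhds x0. \<forall>i v. form_coord M c (\<eta> i) x v = \<theta>s x (J i x (P x v))"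
    using Aeq ev\<sigma>
  proof eventually_elim
    case (elim x)
    have "\<theta>s x (J i x (P x v)) = (\<Sum>j\<in>UNIV. A i j x * \<eta>N j x v)" for i v
      unfolding J_def linear_sum[OF lin\<theta>s] linear_cmul[OF lin\<theta>s]
      using elim(2) by (simp add: \<theta>s_def Cf_def \<eta>N_def)
    then show ?case using elim(1) by simp
  qed
  define \<tau> where "\<tau> u z = \<theta>s' z u - \<theta>s x0 (\<Gamma> u z)" for u z
  have ext: "ext_deriv M (\<eta> j) p u v = \<tau> u (J j x0 (tm p v)) - \<tau> v (J j x0 (tm p u))
      + (\<Sum>l\<in>UNIV. a j l u * blinfun_apply (\<eta> l p) v) - (\<Sum>l\<in>UNIV. a j l v * blinfun_apply (\<eta> l p) u)" for j u v
  proof -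
    have "\<forall>\<^sub>F x in nhds x0. \<forall>v. form_coord M c (\<eta> j) x v = \<theta>s x (J j x (P x v))"
      using eJ by eventually_elim blast
    from coord_d_twisted[where \<Gamma> = "N.christoffel (f p)" and J = "J j" and \<theta> = \<theta>s, OF ev\<theta>s linJ \<theta>s' J' B Bs \<Gamma>s this, of u v]
    have "coord_d (form_coord M c (\<eta> j)) x0 u v = \<tau> u (J j x0 (P x0 v)) - \<tau> v (J j x0 (P x0 u))
        + \<theta>s x0 (D j u (P x0 v)) - \<theta>s x0 (D j v (P x0 u))"
      unfolding \<tau>_def D_def \<Gamma>_def .
    moreover have "\<theta>s x0 (J l x0 (P x0 v)) = blinfun_apply (\<eta> l p) v" for l v
      using eventually_nhds_x_imp_x[OF eJ] e(4)[of l v] by simp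
    ultimately show ?thesis
      unfolding e(5)[of j u v] D linear_sum[OF lin\<theta>s] linear_cmul[OF lin\<theta>s] by (simp add: Pp)
  qed
  have \<eta>lin: "linear (blinfun_apply (\<eta> i p))" for i
    by (rule bounded_linear.linear[OF blinfun.bounded_linear_right])
  obtain w where w: "\<And>j k. blinfun_apply (\<eta> j p) (w k) = (if j = k then 1 else 0)"
    using e(6) by (auto simp: e(4))
  have Hp: "H p = {v. \<forall>i. blinfun_apply (\<eta> i p) v = 0}"
    using fr(2,3) by (auto simp: qc_frame_def)
  have "\<exists>R. (\<forall>i j. blinfun_apply (\<eta> j p) (R i) = (if i = j then 1 else 0)) \<and>
    (\<forall>i j. \<forall>X\<in>H p. ext_deriv M (\<eta> j) p (R i) X + ext_deriv M (\<eta> i) p (R j) X = 0)"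
  proof (rule torsion_free_frame_exists[where \<eta> = "\<lambda>i. blinfun_apply (\<eta> i p)" and w = w and g = "g p"
        and P = "tm p" and \<theta> = "\<theta>s x0" and J = "\<lambda>i. J i x0" and I = "\<lambda>i. I i p" and \<tau> = \<tau> and a = a
        and D = "\<lambda>j. ext_deriv M (\<eta> j) p"])
    show "\<theta>s x0 z = 0 \<longleftrightarrow> z \<in> range (tm p)" for z
      using \<theta>_eq_0_iff[OF U(2), of z] \<sigma>0 by (simp add: \<theta>s_def x0_def[symmetric] Pp)
    show "tm p (I i p X) = J i x0 (tm p X)" if "X \<in> H p" for i X
      using IK[OF that] by (simp add: J_def Cf_def)
    show "blinfun_apply (\<eta> i p) v = \<theta>s x0 (J i x0 (tm p v))" for i v
      using eventually_nhds_x_imp_x[OF eJ] e(4)[of i v] by (simp add: Pp)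
    have l': "linear (\<theta>s' z)" for z using \<theta>s' has_derivative_linear by blast
    have l2: "linear (\<lambda>z. \<theta>s' z u)" for u by (rule has_derivative_family_linear[OF ev\<theta>s \<theta>s'])
    have lt: "linear (tm p)" by (rule tm(1)[OF p])
    show "linear (\<lambda>u. \<tau> u z)" for z
      by (rule linearI) (simp_all add: \<tau>_def \<Gamma>_def Pp \<Gamma>s[of _ z] linear_add[OF l'] linear_cmul[OF l']
        linear_add[OF lt] linear_cmul[OF lt] linear_add[OF N.linear_christoffel]
        linear_cmul[OF N.linear_christoffel] linear_add[OF lin\<theta>s] linear_cmul[OF lin\<theta>s] algebra_simps)
    show "linear (\<tau> u)" for u
      by (rule linearI) (simp_all add: \<tau>_def linear_add[OF l2] linear_cmul[OF l2]
        linear_add[OF \<Gamma>lin] linear_cmul[OF \<Gamma>lin] linear_add[OF lin\<theta>s] linear_cmul[OF lin\<theta>s] algebra_simps)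
    show "\<tau> u (tm p v) = \<tau> v (tm p u)" for u v
      using second_fundamental_form_symmetric[where \<Gamma> = "N.christoffel (f p)", OF ev\<theta>s \<theta>s' B Bs \<Gamma>s \<theta>sP, of u v]
      by (simp add: \<tau>_def \<Gamma>_def Pp)
  qed (use \<eta>lin w Hp g(1,2,3) tm(1)[OF p] lin\<theta>s qJ0 skew ext in auto)
  then obtain R where R: "\<And>i j. blinfun_apply (\<eta> j p) (R i) = (if i = j then 1 else 0)"
    "\<And>i j X. X \<in> H p \<Longrightarrow> ext_deriv M (\<eta> j) p (R i) X + ext_deriv M (\<eta> i) p (R j) X = 0" by blast
  obtain Z where Z: "Z \<in> H p" "Z \<noteq> 0" using H_nonzero[OF p] by blast
  have lin: "linear (\<lambda>u. ext_deriv M (\<eta> j) p u v)" for j v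
  proof -
    have fd: "((\<lambda>y. form_coord M c (\<eta> j) y u) has_derivative
        frechet_derivative (\<lambda>y. form_coord M c (\<eta> j) y u) (at x0)) (at x0)" for u
      using e(1) frechet_derivative_works by blast
    have ev: "\<forall>\<^sub>F x in nhds x0. linear (form_coord M c (\<eta> j) x)" using e(2) by eventually_elim blast
    have "linear (\<lambda>u. frechet_derivative (\<lambda>y. form_coord M c (\<eta> j) y u) (at x0) v)"
      by (rule has_derivative_family_linear[OF ev fd])
    moreover have "linear (frechet_derivative (\<lambda>y. form_coord M c (\<eta> j) y v) (at x0))"
      using fd has_derivative_linear by blast
    ultimately show ?thesis
      unfolding e(5) coord_d_def by (intro linear_compose_sub)
  qed
  show ?thesis
    by (rule vertical_torsion_eq_0[where H = H and p = p and \<eta> = \<eta> and I = I and g = "g p" and R = R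
          and M = M, OF Hp Z g(2,1,4) lin g(3) R])
qed

end

theorem theorem3p2:
  fixes N :: "('a, real ^ 8) smfd" and Q :: "'a \<Rightarrow> ((real ^ 8) \<Rightarrow>\<^sub>L (real ^ 8)) set"
    and M :: "('b, real ^ 7) smfd" and f :: "'b \<Rightarrow> 'a"
  assumes "quaternionic_manifold N Q"
    and "qc_hypersurface N Q M f"
  shows "qc_integrable M (hypersurface_dist N Q M f)"
proof -
  let ?H = "hypersurface_dist N Q M f"
  from assms(1) obtain nabla where N: "smooth_manifold N" and
    nabla: "affine_connection N nabla" "torsion_free N nabla" "preserves_subbundle N Q nabla"
    by (auto simp: quaternionic_manifold_def)
  from assms(2) have M: "smooth_manifold M" and imm: "immersion M N f" and qd: "qc_distribution M ?H"
    by (auto simp: qc_hypersurface_def Let_def)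
  from assms(2) obtain g' where g': "qc_compatible M ?H g'" and
    fr': "\<forall>p\<in>points M. \<exists>V \<eta> I. p \<in> V \<and> qc_frame M ?H g' V \<eta> I \<and>
      (\<forall>K\<in>Q (f p). \<exists>a. \<forall>v\<in>?H p.
         blinfun_apply K (tangent_map M N f p v) = tangent_map M N f p (\<Sum>i\<in>UNIV. a i *\<^sub>R I i p v)) \<and>
      (\<forall>a. \<exists>K\<in>Q (f p). \<forall>v\<in>?H p.
         blinfun_apply K (tangent_map M N f p v) = tangent_map M N f p (\<Sum>i\<in>UNIV. a i *\<^sub>R I i p v))"
    unfolding qc_hypersurface_def Let_def by blast
  have "card (- {0 :: 8}) = card (UNIV :: 7 set)" by (simp add: Compl_eq_Diff_UNIV card_Diff_singleton)
  then obtain bas :: "8 \<Rightarrow> 7" where bas: "bij_betw bas (- {0}) UNIV"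
    using finite_same_card_bij[of "- {0 :: 8}" "UNIV :: 7 set"] by auto
  have dim: "dim (?H q) + 3 = 7" if "q \<in> points M" for q
    using qd that by (auto simp: qc_distribution_def)
  have "tensor_eq_on (?H p) (vertical_torsion M ?H \<eta> I p) (\<lambda>X Y Z l m. 0)"
    if fr: "qc_compatible M ?H g" "qc_frame M ?H g V \<eta> I" "p \<in> V" for g V \<eta> I p
  proof -
    have p: "p \<in> points M" using fr(2,3) openin_subset by (auto simp: qc_frame_def)
    then have fp: "f p \<in> points N" using imm by (auto simp: immersion_def continuous_map_def)
    with assms(1) obtain VN K where VN: "mopen N VN" "f p \<in> VN" and K: "\<And>i. smooth_endo N VN (K i)"
      "\<And>q. q \<in> VN \<Longrightarrow> quaternionic_structure UNIV (\<lambda>i::3. blinfun_apply (K i q))"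
      "\<And>q. q \<in> VN \<Longrightarrow> Q q = span (range (\<lambda>i. K i q))"
      unfolding quaternionic_manifold_def by metis
    \<comment> \<open>The frame of \<open>Q\<close> exists only locally, so the setting is
      instantiated anew for each \<open>p\<close>, with the connection and \<open>bas\<close> kept
      fixed.\<close>
    interpret qc_point N nabla M Q f K VN bas p
      using N nabla M imm VN K bas dim p fp by unfold_locales auto
    show ?thesis
      by (rule vertical_torsion_0[OF fr g']) (use fr' in \<open>auto simp: spans_Q_def\<close>)
  qed
  then show ?thesis using qd unfolding qc_integrable_def by blast
qed

end
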